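(* Let $(M,g,\xi,\lambda)$ be an $n$-dimensional connected Yamabe soliton with scalar curvature $R$. If the soliton field $\xi$ is not closed and it annihilates its associated operator $\varphi$, i.e. $\varphi(\xi)=0$, then $g$ is a Yamabe metric, i.e. $R$ is constant on $M$.
   Context: A Yamabe soliton $(M,g,\xi,\lambda)$ is a connected smooth Riemannian manifold $(M,g)$ together with a smooth vector field $\xi$ (the soliton field) and a constant $\lambda\in\mathbb{R}$ such that $\frac12\mathcal{L}_\xi g=(R-\lambda)g$, where $\mathcal{L}_\xi$ is the Lie derivative and $R$ is the scalar curvature of $g$. No compactness or completeness is assumed. The metric $g$ is called a Yamabe metric if $R$ is constant. Let $\eta$ be the $1$-form dual to $\xi$, $\eta(X)=g(X,\xi)$. The operator associated to the soliton field is the skew-symmetric $(1,1)$-tensor field $\varphi$ defined by $\frac12 d\eta(X,Y)=g(\varphi X,Y)$, where $d\eta(X,Y)=X(\eta(Y))-Y(\eta(X))-\eta([X,Y])$; with $\nabla$ the Levi-Civita connection one then has $\nabla_X\xi=(R-\lambda)X+\varphi X$. The soliton field $\xi$ is closed if $d\eta=0$, equivalently $\varphi=0$; it is not closed if $\varphi\ne 0$. *)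

theory Defs
  imports "HOL-Analysis.Analysis"
begin

section \<open>Smooth manifolds\<close>

text \<open>Meant for open \<open>S\<close>, where \<open>frechet_derivative f (at x)\<close> only depends on \<open>f\<close> in \<open>S\<close>.\<close>

fun Ck_on :: "nat \<Rightarrow> 'a::real_normed_vector set \<Rightarrow> ('a \<Rightarrow> 'b::real_normed_vector) \<Rightarrow> bool" where
  "Ck_on 0 S f \<longleftrightarrow> continuous_on S f"
| "Ck_on (Suc k) S f \<longleftrightarrow>
     (\<forall>x\<in>S. f differentiable (at x)) \<and> (\<forall>v. Ck_on k S (\<lambda>x. frechet_derivative f (at x) v))"

definition smooth_on :: "'a::real_normed_vector set \<Rightarrow> ('a \<Rightarrow> 'b::real_normed_vector) \<Rightarrow> bool" where
  "smooth_on S f \<longleftrightarrow> (\<forall>k. Ck_on k S f)"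

text \<open>A chart is a domain together with a coordinate map, whose values off the domain are irrelevant.\<close>

type_synonym ('a, 'n) chart = "'a set \<times> ('a \<Rightarrow> real ^ 'n)"

abbreviation chart_inv :: "('a, 'n::finite) chart \<Rightarrow> real ^ 'n \<Rightarrow> 'a" where
  "chart_inv c \<equiv> inv_into (fst c) (snd c)"

record ('a, 'n::finite) charted_space =
  Top :: "'a topology"
  Atlas :: "('a, 'n) chart set"

abbreviation points :: "('a, 'n::finite) charted_space \<Rightarrow> 'a set" where
  "points M \<equiv> topspace (Top M)"

text \<open>The atlas need not be maximal. The dimension is \<open>CARD('n)\<close>.\<close>

definition smooth_manifold :: "('a, 'n::finite) charted_space \<Rightarrow> bool" where
  "smooth_manifold M \<longleftrightarrow>
     Hausdorff_space (Top M) \<and> second_countable (Top M) \<and>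
     (\<Union>c\<in>Atlas M. fst c) = points M \<and>
     (\<forall>c\<in>Atlas M. openin (Top M) (fst c) \<and> open (snd c ` fst c) \<and>
        homeomorphic_map (subtopology (Top M) (fst c)) (top_of_set (snd c ` fst c)) (snd c)) \<and>
     (\<forall>c\<in>Atlas M. \<forall>d\<in>Atlas M. smooth_on (snd c ` (fst c \<inter> fst d)) (snd d \<circ> chart_inv c))"

definition charts_at :: "('a, 'n::finite) charted_space \<Rightarrow> 'a \<Rightarrow> ('a, 'n) chart set" where
  "charts_at M p = {c \<in> Atlas M. p \<in> fst c}"


section \<open>Tangent vectors and vector fields\<close>

text \<open>
  A tangent vector at \<open>p\<close> assigns to each chart \<open>c\<close> around \<open>p\<close> its coordinate vector
  \<open>v c\<close>, and these are related by the Jacobians of the coordinate changes. It is \<open>0\<close> on all other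
  charts, so that equality of functions is equality of tangent vectors.
\<close>

type_synonym ('a, 'n) tvec = "('a, 'n) chart \<Rightarrow> real ^ 'n"

definition tangent_space :: "('a, 'n::finite) charted_space \<Rightarrow> 'a \<Rightarrow> ('a, 'n) tvec set" where
  "tangent_space M p =
     {v. (\<forall>c. c \<notin> charts_at M p \<longrightarrow> v c = 0) \<and>
         (\<forall>c\<in>charts_at M p. \<forall>d\<in>charts_at M p.
            v d = frechet_derivative (snd d \<circ> chart_inv c) (at (snd c p)) (v c))}"

definition zero_tvec :: "('a, 'n::finite) tvec" where
  "zero_tvec = (\<lambda>c. 0)"

definition lincomb :: "real \<Rightarrow> ('a, 'n::finite) tvec \<Rightarrow> real \<Rightarrow> ('a, 'n) tvec \<Rightarrow> ('a, 'n) tvec" where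
  "lincomb a u b v = (\<lambda>c. a *\<^sub>R u c + b *\<^sub>R v c)"

text \<open>The tangent vector at \<open>p\<close> with coordinates \<open>w\<close> in the chart \<open>c\<close>.\<close>

definition coord_tvec ::
    "('a, 'n::finite) charted_space \<Rightarrow> ('a, 'n) chart \<Rightarrow> 'a \<Rightarrow> real ^ 'n \<Rightarrow> ('a, 'n) tvec" where
  "coord_tvec M c p w =
     (\<lambda>d. if d \<in> charts_at M p
          then frechet_derivative (snd d \<circ> chart_inv c) (at (snd c p)) w else 0)"

type_synonym ('a, 'n) vfield = "'a \<Rightarrow> ('a, 'n) tvec"

definition smooth_vfield :: "('a, 'n::finite) charted_space \<Rightarrow> 'a set \<Rightarrow> ('a, 'n) vfield \<Rightarrow> bool" where
  "smooth_vfield M W X \<longleftrightarrow>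
     (\<forall>p\<in>W. X p \<in> tangent_space M p) \<and>
     (\<forall>c\<in>Atlas M. smooth_on (snd c ` (W \<inter> fst c)) (\<lambda>x. X (chart_inv c x) c))"

text \<open>
  The derivative \<open>(X f)(p)\<close>, computed in some chart around \<open>p\<close>; by the chain rule and the
  transformation law of \<open>X p\<close> it does not depend on the choice.
\<close>

definition chart_at :: "('a, 'n::finite) charted_space \<Rightarrow> 'a \<Rightarrow> ('a, 'n) chart" where
  "chart_at M p = (SOME c. c \<in> charts_at M p)"

definition deriv_along ::
    "('a, 'n::finite) charted_space \<Rightarrow> ('a, 'n) vfield \<Rightarrow> ('a \<Rightarrow> real) \<Rightarrow> 'a \<Rightarrow> real" where
  "deriv_along M X f p =
     (let c = chart_at M p in frechet_derivative (f \<circ> chart_inv c) (at (snd c p)) (X p c))"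

text \<open>In coordinates, \<open>[X, Y]\<^sup>k = X\<^sup>i \<partial>\<^sub>i Y\<^sup>k - Y\<^sup>i \<partial>\<^sub>i X\<^sup>k\<close>.\<close>

definition lie_bracket ::
    "('a, 'n::finite) charted_space \<Rightarrow> ('a, 'n) vfield \<Rightarrow> ('a, 'n) vfield \<Rightarrow> ('a, 'n) vfield" where
  "lie_bracket M X Y = (\<lambda>p c. if c \<in> charts_at M p
     then frechet_derivative (\<lambda>x. Y (chart_inv c x) c) (at (snd c p)) (X p c)
        - frechet_derivative (\<lambda>x. X (chart_inv c x) c) (at (snd c p)) (Y p c)
     else 0)"


section \<open>Riemannian metrics and scalar curvature\<close>

type_synonym ('a, 'n) metric = "'a \<Rightarrow> ('a, 'n) tvec \<Rightarrow> ('a, 'n) tvec \<Rightarrow> real"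

text \<open>The components \<open>g\<^sub>i\<^sub>j\<close> of \<open>g\<close> in the chart \<open>c\<close>, as functions of the coordinates.\<close>

definition metric_matrix ::
    "('a, 'n::finite) charted_space \<Rightarrow> ('a, 'n) metric \<Rightarrow> ('a, 'n) chart \<Rightarrow> real ^ 'n \<Rightarrow> real ^ 'n ^ 'n" where
  "metric_matrix M g c x =
     (let p = chart_inv c x
      in \<chi> i j. g p (coord_tvec M c p (axis i 1)) (coord_tvec M c p (axis j 1)))"

definition riemannian_metric :: "('a, 'n::finite) charted_space \<Rightarrow> ('a, 'n) metric \<Rightarrow> bool" where
  "riemannian_metric M g \<longleftrightarrow>
     (\<forall>p\<in>points M. \<forall>u\<in>tangent_space M p. \<forall>v\<in>tangent_space M p. \<forall>w\<in>tangent_space M p. \<forall>a b.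
        g p (lincomb a u b v) w = a * g p u w + b * g p v w) \<and>
     (\<forall>p\<in>points M. \<forall>u\<in>tangent_space M p. \<forall>v\<in>tangent_space M p. g p u v = g p v u) \<and>
     (\<forall>p\<in>points M. \<forall>u\<in>tangent_space M p. u \<noteq> zero_tvec \<longrightarrow> g p u u > 0) \<and>
     (\<forall>c\<in>Atlas M. smooth_on (snd c ` fst c) (metric_matrix M g c))"

definition partial_deriv :: "'n::finite \<Rightarrow> (real ^ 'n \<Rightarrow> real) \<Rightarrow> real ^ 'n \<Rightarrow> real" where
  "partial_deriv i f x = frechet_derivative f (at x) (axis i 1)"

text \<open>
  The classical local formulas for the Levi-Civita connection and its curvature, with
  \<open>G = (g\<^sub>i\<^sub>j)\<close>: \<open>christoffel G k i j\<close> is \<open>\<Gamma>\<^sup>k\<^sub>i\<^sub>j\<close>, and \<open>ricci G j k\<close> is the trace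
  \<open>R\<^sub>j\<^sub>k\<close> of \<open>X \<mapsto> R(X, \<partial>\<^sub>j) \<partial>\<^sub>k\<close> with
  \<open>R(X, Y) Z = \<nabla>\<^sub>X \<nabla>\<^sub>Y Z - \<nabla>\<^sub>Y \<nabla>\<^sub>X Z - \<nabla>\<^bsub>[X, Y]\<^esub> Z\<close>; round spheres have positive
  scalar curvature.
\<close>

definition christoffel ::
    "(real ^ 'n \<Rightarrow> real ^ 'n ^ 'n) \<Rightarrow> 'n \<Rightarrow> 'n \<Rightarrow> 'n \<Rightarrow> real ^ 'n::finite \<Rightarrow> real" where
  "christoffel G k i j x =
     (1/2) * (\<Sum>l\<in>UNIV. matrix_inv (G x) $ k $ l *
        (partial_deriv i (\<lambda>y. G y $ j $ l) x
         + partial_deriv j (\<lambda>y. G y $ i $ l) x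
         - partial_deriv l (\<lambda>y. G y $ i $ j) x))"

definition ricci ::
    "(real ^ 'n \<Rightarrow> real ^ 'n ^ 'n) \<Rightarrow> 'n \<Rightarrow> 'n \<Rightarrow> real ^ 'n::finite \<Rightarrow> real" where
  "ricci G j k x =
     (\<Sum>i\<in>UNIV.
        partial_deriv i (christoffel G i j k) x - partial_deriv j (christoffel G i i k) x
        + (\<Sum>l\<in>UNIV. christoffel G i i l x * christoffel G l j k x
                   - christoffel G i j l x * christoffel G l i k x))"

definition scalar_curvature_coord ::
    "(real ^ 'n \<Rightarrow> real ^ 'n ^ 'n) \<Rightarrow> real ^ 'n::finite \<Rightarrow> real" where
  "scalar_curvature_coord G x =
     (\<Sum>j\<in>UNIV. \<Sum>k\<in>UNIV. matrix_inv (G x) $ j $ k * ricci G j k x)"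

text \<open>The value does not depend on the chart, because curvature is a tensor.\<close>

definition scalar_curvature ::
    "('a, 'n::finite) charted_space \<Rightarrow> ('a, 'n) metric \<Rightarrow> 'a \<Rightarrow> real" where
  "scalar_curvature M g p =
     (let c = chart_at M p in scalar_curvature_coord (metric_matrix M g c) (snd c p))"


section \<open>Yamabe solitons\<close>

text \<open>
  Identities between tensor fields are tested on smooth vector fields defined on open subsets
  of \<open>M\<close>. As both sides are tensorial, this is the same as testing them on global fields.
\<close>

definition lie_deriv_metric ::
    "('a, 'n::finite) charted_space \<Rightarrow> ('a, 'n) vfield \<Rightarrow> ('a, 'n) metric \<Rightarrow>
     ('a, 'n) vfield \<Rightarrow> ('a, 'n) vfield \<Rightarrow> 'a \<Rightarrow> real" where
  "lie_deriv_metric M \<xi> g X Y p =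
     deriv_along M \<xi> (\<lambda>q. g q (X q) (Y q)) p
     - g p (lie_bracket M \<xi> X p) (Y p) - g p (X p) (lie_bracket M \<xi> Y p)"

definition yamabe_soliton ::
    "('a, 'n::finite) charted_space \<Rightarrow> ('a, 'n) metric \<Rightarrow> ('a, 'n) vfield \<Rightarrow> real \<Rightarrow> bool" where
  "yamabe_soliton M g \<xi> lam \<longleftrightarrow>
     smooth_manifold M \<and> connected_space (Top M) \<and>
     riemannian_metric M g \<and> smooth_vfield M (points M) \<xi> \<and>
     (\<forall>W X Y. openin (Top M) W \<and> smooth_vfield M W X \<and> smooth_vfield M W Y \<longrightarrow>
        (\<forall>p\<in>W. (1/2) * lie_deriv_metric M \<xi> g X Y p
              = (scalar_curvature M g p - lam) * g p (X p) (Y p)))"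

definition yamabe_metric :: "('a, 'n::finite) charted_space \<Rightarrow> ('a, 'n) metric \<Rightarrow> bool" where
  "yamabe_metric M g \<longleftrightarrow> (\<exists>K. \<forall>p\<in>points M. scalar_curvature M g p = K)"

definition dual_form ::
    "('a, 'n::finite) metric \<Rightarrow> ('a, 'n) vfield \<Rightarrow> 'a \<Rightarrow> ('a, 'n) tvec \<Rightarrow> real" where
  "dual_form g \<xi> p v = g p v (\<xi> p)"

definition ext_deriv ::
    "('a, 'n::finite) charted_space \<Rightarrow> ('a \<Rightarrow> ('a, 'n) tvec \<Rightarrow> real) \<Rightarrow>
     ('a, 'n) vfield \<Rightarrow> ('a, 'n) vfield \<Rightarrow> 'a \<Rightarrow> real" where
  "ext_deriv M \<eta> X Y p =
     deriv_along M X (\<lambda>q. \<eta> q (Y q)) p - deriv_along M Y (\<lambda>q. \<eta> q (X q)) p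
     - \<eta> p (lie_bracket M X Y p)"

definition closed_vfield ::
    "('a, 'n::finite) charted_space \<Rightarrow> ('a, 'n) metric \<Rightarrow> ('a, 'n) vfield \<Rightarrow> bool" where
  "closed_vfield M g \<xi> \<longleftrightarrow>
     (\<forall>W X Y. openin (Top M) W \<and> smooth_vfield M W X \<and> smooth_vfield M W Y \<longrightarrow>
        (\<forall>p\<in>W. ext_deriv M (dual_form g \<xi>) X Y p = 0))"

definition tensor_field_11 ::
    "('a, 'n::finite) charted_space \<Rightarrow> ('a \<Rightarrow> ('a, 'n) tvec \<Rightarrow> ('a, 'n) tvec) \<Rightarrow> bool" where
  "tensor_field_11 M \<phi> \<longleftrightarrow>
     (\<forall>p\<in>points M. \<forall>u\<in>tangent_space M p. \<phi> p u \<in> tangent_space M p) \<and>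
     (\<forall>p\<in>points M. \<forall>u\<in>tangent_space M p. \<forall>v\<in>tangent_space M p. \<forall>a b.
        \<phi> p (lincomb a u b v) = lincomb a (\<phi> p u) b (\<phi> p v)) \<and>
     (\<forall>W X. openin (Top M) W \<and> smooth_vfield M W X \<longrightarrow> smooth_vfield M W (\<lambda>p. \<phi> p (X p)))"

text \<open>
  Nondegeneracy of \<open>g\<close> makes such a \<open>\<phi>\<close> unique on tangent vectors; it always exists,
  and it is skew-symmetric because \<open>d\<eta>\<close> is.
\<close>

definition associated_operator ::
    "('a, 'n::finite) charted_space \<Rightarrow> ('a, 'n) metric \<Rightarrow> ('a, 'n) vfield \<Rightarrow>
     ('a \<Rightarrow> ('a, 'n) tvec \<Rightarrow> ('a, 'n) tvec) \<Rightarrow> bool" where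
  "associated_operator M g \<xi> \<phi> \<longleftrightarrow>
     tensor_field_11 M \<phi> \<and>
     (\<forall>W X Y. openin (Top M) W \<and> smooth_vfield M W X \<and> smooth_vfield M W Y \<longrightarrow>
        (\<forall>p\<in>W. (1/2) * ext_deriv M (dual_form g \<xi>) X Y p = g p (\<phi> p (X p)) (Y p)))"

end

theory Submission
  imports Defs
begin

text \<open>
  Write \<open>f = R - \<lambda>\<close> and \<open>\<eta> = g(\<xi>, \<sqdot>)\<close>. Since \<open>\<phi> \<xi> = 0\<close> means that \<open>\<xi>\<close> contracts \<open>d\<eta>\<close> to zero,
  \<open>\<nabla>\<^sub>X \<xi> = f X + \<phi> X\<close> gives \<open>d|\<xi>|\<^sup>2 = 2 f \<eta>\<close>. Taking \<open>d\<close> once more yields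
  \<open>df \<and> \<eta> + f d\<eta> = 0\<close>, and contracting this with \<open>\<xi>\<close> yields \<open>|\<xi>|\<^sup>2 df = \<xi>(f) \<eta>\<close>. So where \<open>\<xi>\<close> does
  not vanish, \<open>df = \<mu> \<eta>\<close> and \<open>f d\<eta> = 0\<close>; differentiating these again, \<open>\<mu> d\<eta> = 0\<close> and
  \<open>d\<mu> = \<nu> \<eta>\<close>. In particular \<open>f = 0\<close> near any point at which \<open>d\<eta> \<noteq> 0\<close> and \<open>\<xi> \<noteq> 0\<close>. Such a point
  exists as \<open>\<xi>\<close> is not closed, and it forces the dimension \<open>n\<close> to be at least 2.

  To spread \<open>f = 0\<close> from there over \<open>M\<close>, the soliton equation is needed a second time, now through
  the fact that \<open>f + \<lambda>\<close> is the scalar curvature. A field with \<open>\<L>\<^sub>\<xi> g = 2 f g\<close> satisfies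
  \<open>\<xi>(R) = - 2 f R - 2 (n - 1) \<Delta>f\<close> (lemma \<open>lie_scalar_curvature\<close>), and \<open>df = \<mu> \<eta>\<close> turns \<open>\<Delta>f\<close> into
  \<open>\<nu> |\<xi>|\<^sup>2 + n \<mu> f\<close>. As \<open>\<xi>(f) = \<mu> |\<xi>|\<^sup>2\<close>, this expresses \<open>\<nu>\<close> as a combination of \<open>f\<close> and \<open>\<mu>\<close> with
  continuous coefficients. Hence \<open>(f, \<mu>)\<close> solves a homogeneous linear system along curves in
  \<open>{\<xi> \<noteq> 0}\<close>, and by Gronwall \<open>f = \<mu> = 0\<close> at one point with \<open>\<xi> \<noteq> 0\<close> implies \<open>f = 0\<close> around it
  (lemma \<open>f_vanishes_locally\<close>).

  Zeros of \<open>\<xi>\<close> are never met: where \<open>f = 0\<close> locally, \<open>|\<xi>|\<^sup>2\<close> is locally constant. So for a suitable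
  \<open>s > 0\<close> the set of points around which \<open>f = 0\<close> and at which \<open>|\<xi>|\<^sup>2 = s\<close> is nonempty and open, and a
  limit of such points still has \<open>|\<xi>|\<^sup>2 = s > 0\<close> and \<open>f = \<mu> = 0\<close>, so it belongs to the set. By
  connectedness the set is \<open>M\<close>, and \<open>R = \<lambda>\<close> everywhere.

  All computations take place in one chart, with directional derivatives of expressions in constant
  vectors instead of indices. As the scalar curvature at a point is computed in a chart that
  depends arbitrarily on the point, its invariance under changes of charts
  (lemma \<open>scalar_curvature_pull\<close>) is needed before it can be differentiated at all.
\<close>

section \<open>Directional derivatives and smooth functions\<close>

definition dd :: "'a::real_normed_vector \<Rightarrow> ('a \<Rightarrow> 'b::real_normed_vector) \<Rightarrow> 'a \<Rightarrow> 'b" where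
  "dd v f x = frechet_derivative f (at x) v"

lemma dd_eqI: "(f has_derivative f') (at x) \<Longrightarrow> dd v f x = f' v"
  unfolding dd_def using frechet_derivative_at by metis

lemma has_derivative_dd: "f differentiable (at x) \<Longrightarrow> (f has_derivative (\<lambda>v. dd v f x)) (at x)"
  unfolding dd_def using frechet_derivative_works by metis

lemma dd_const [simp]: "dd v (\<lambda>x. c) x = 0"
  unfolding dd_def by simp

lemma dd_ident [simp]: "dd v (\<lambda>x. x) x = v"
  unfolding dd_def by simp

lemma linear_dd: "f differentiable (at x) \<Longrightarrow> linear (\<lambda>v. dd v f x)"
  unfolding dd_def by (metis eta_contract_eq linear_frechet_derivative)

lemma dd_add:
  "f differentiable (at x) \<Longrightarrow> g differentiable (at x) \<Longrightarrow>
    dd v (\<lambda>x. f x + g x) x = dd v f x + dd v g x"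
  by (rule dd_eqI) (intro has_derivative_add has_derivative_dd)

lemma dd_diff:
  "f differentiable (at x) \<Longrightarrow> g differentiable (at x) \<Longrightarrow>
    dd v (\<lambda>x. f x - g x) x = dd v f x - dd v g x"
  by (rule dd_eqI) (intro has_derivative_diff has_derivative_dd)

lemma dd_bilinear:
  assumes "bounded_bilinear P" "f differentiable (at x)" "g differentiable (at x)"
  shows "dd v (\<lambda>x. P (f x) (g x)) x = P (f x) (dd v g x) + P (dd v f x) (g x)"
  using bounded_bilinear.FDERIV[OF assms(1) has_derivative_dd[OF assms(2)] has_derivative_dd[OF assms(3)]]
  by (rule dd_eqI)

lemma dd_mult:
  fixes f g :: "'a::real_normed_vector \<Rightarrow> real"
  shows "f differentiable (at x) \<Longrightarrow> g differentiable (at x) \<Longrightarrow>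
    dd v (\<lambda>x. f x * g x) x = f x * dd v g x + dd v f x * g x"
  by (rule dd_bilinear[OF bounded_bilinear_mult])

lemma dd_scaleR:
  "f differentiable (at x) \<Longrightarrow> g differentiable (at x) \<Longrightarrow>
    dd v (\<lambda>x. f x *\<^sub>R g x) x = f x *\<^sub>R dd v g x + dd v f x *\<^sub>R g x"
  by (rule dd_bilinear[OF bounded_bilinear_scaleR])

lemma dd_cmult:
  fixes f :: "'a::real_normed_vector \<Rightarrow> real"
  shows "f differentiable (at x) \<Longrightarrow> dd v (\<lambda>x. c * f x) x = c * dd v f x"
  by (subst dd_mult) auto

lemma dd_bounded_linear:
  assumes "bounded_linear h" "f differentiable (at x)"
  shows "dd v (\<lambda>x. h (f x)) x = h (dd v f x)"
  by (rule dd_eqI) (rule bounded_linear.has_derivative[OF assms(1) has_derivative_dd[OF assms(2)]])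

lemma dd_sum:
  assumes "\<And>i. i \<in> I \<Longrightarrow> f i differentiable (at x)"
  shows "dd v (\<lambda>x. \<Sum>i\<in>I. f i x) x = (\<Sum>i\<in>I. dd v (f i) x)"
  by (rule dd_eqI) (intro has_derivative_sum has_derivative_dd assms)

lemma dd_nth:
  "f differentiable (at x) \<Longrightarrow> dd v (\<lambda>x. f x $ i) x = dd v f x $ i"
  by (rule dd_bounded_linear[OF bounded_linear_vec_nth])

lemma dd_compose:
  assumes "f differentiable (at x)" "g differentiable (at (f x))"
  shows "dd v (\<lambda>x. g (f x)) x = dd (dd v f x) g (f x)"
  using diff_chain_at[OF has_derivative_dd[OF assms(1)] has_derivative_dd[OF assms(2)]]
  by (intro dd_eqI[where f' = "\<lambda>v. dd (dd v f x) g (f x)"]) (simp add: o_def)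

lemma dd_cong:
  assumes "open S" "x \<in> S" "\<And>y. y \<in> S \<Longrightarrow> f y = g y"
  shows "dd v f x = dd v g x"
proof -
  have "(f has_derivative f') (at x) \<longleftrightarrow> (g has_derivative f') (at x)" for f'
    using has_derivative_transform_within_open[OF _ assms(1,2), of f f' UNIV g]
      has_derivative_transform_within_open[OF _ assms(1,2), of g f' UNIV f] assms(3) by auto
  then show ?thesis
    unfolding dd_def frechet_derivative_def by simp
qed

lemma differentiable_cong:
  assumes "open S" "x \<in> S" "\<And>y. y \<in> S \<Longrightarrow> f y = g y"
  shows "f differentiable (at x) \<longleftrightarrow> g differentiable (at x)"
proof -
  have "(f has_derivative f') (at x) \<longleftrightarrow> (g has_derivative f') (at x)" for f'
    using has_derivative_transform_within_open[OF _ assms(1,2), of f f' UNIV g]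
      has_derivative_transform_within_open[OF _ assms(1,2), of g f' UNIV f] assms(3) by auto
  then show ?thesis
    unfolding differentiable_def by simp
qed

text \<open>In terms of directional derivatives this recursion equation
  makes the closure properties below direct inductions on \<open>k\<close>.\<close>

lemma Ck_on_Suc_dd:
  "Ck_on (Suc k) S f \<longleftrightarrow> (\<forall>x\<in>S. f differentiable (at x)) \<and> (\<forall>v. Ck_on k S (dd v f))"
  by (simp add: dd_def[abs_def])

declare Ck_on.simps(2) [simp del]

lemma Ck_on_cong:
  assumes "open S"
  shows "(\<And>y. y \<in> S \<Longrightarrow> f y = g y) \<Longrightarrow> Ck_on k S f \<longleftrightarrow> Ck_on k S g"
proof (induction k arbitrary: f g)
  case 0
  then show ?case by (simp cong: continuous_on_cong)
next
  case (Suc k)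
  have "(\<forall>x\<in>S. f differentiable (at x)) \<longleftrightarrow> (\<forall>x\<in>S. g differentiable (at x))"
    using differentiable_cong[OF assms _ Suc.prems(1)] by simp
  moreover have "Ck_on k S (dd v f) \<longleftrightarrow> Ck_on k S (dd v g)" for v
    by (rule Suc.IH) (rule dd_cong[OF assms _ Suc.prems])
  ultimately show ?case by (simp add: Ck_on_Suc_dd)
qed

lemma Ck_on_SucD: "Ck_on (Suc k) S f \<Longrightarrow> Ck_on k S f"
proof (induction k arbitrary: f)
  case 0
  then show ?case
    by (auto simp: Ck_on_Suc_dd intro!: continuous_at_imp_continuous_on differentiable_imp_continuous_within)
next
  case (Suc k)
  then show ?case by (metis Ck_on_Suc_dd)
qed

lemma Ck_on_subset: "Ck_on k S f \<Longrightarrow> T \<subseteq> S \<Longrightarrow> Ck_on k T f"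
  by (induction k arbitrary: f) (auto simp: Ck_on_Suc_dd intro: continuous_on_subset)

lemma Ck_on_const: "Ck_on k S (\<lambda>x. c)"
proof (induction k arbitrary: c)
  case (Suc k)
  have "dd v (\<lambda>x::'a. c) = (\<lambda>x. 0)" for v by (simp add: fun_eq_iff)
  with Suc show ?case by (simp add: Ck_on_Suc_dd)
qed simp

lemma Ck_on_ident: "Ck_on k S (\<lambda>x. x)"
proof (cases k)
  case (Suc m)
  have "dd v (\<lambda>x::'a. x) = (\<lambda>x. v)" for v by (simp add: fun_eq_iff)
  with Suc show ?thesis by (simp add: Ck_on_Suc_dd Ck_on_const)
qed simp

lemma Ck_on_add:
  assumes "open S"
  shows "Ck_on k S f \<Longrightarrow> Ck_on k S g \<Longrightarrow> Ck_on k S (\<lambda>x. f x + g x)"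
proof (induction k arbitrary: f g)
  case (Suc k)
  have "Ck_on k S (dd v (\<lambda>x. f x + g x))" for v
    using Suc by (subst Ck_on_cong[OF assms, of _ "\<lambda>x. dd v f x + dd v g x"])
      (auto simp: Ck_on_Suc_dd dd_add)
  with Suc.prems show ?case by (auto simp: Ck_on_Suc_dd)
qed (auto intro: continuous_intros)

lemma Ck_on_bounded_bilinear:
  assumes "open S" and P: "bounded_bilinear P"
  shows "Ck_on k S f \<Longrightarrow> Ck_on k S g \<Longrightarrow> Ck_on k S (\<lambda>x. P (f x) (g x))"
proof (induction k arbitrary: f g)
  case 0
  then show ?case by (auto intro: bounded_bilinear.continuous_on[OF P])
next
  case (Suc k)
  have "Ck_on k S (\<lambda>x. P (f x) (dd v g x) + P (dd v f x) (g x))" for v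
    using Suc.prems Ck_on_SucD[OF Suc.prems(1)] Ck_on_SucD[OF Suc.prems(2)]
    by (intro Ck_on_add[OF assms(1)] Suc.IH) (auto simp: Ck_on_Suc_dd)
  then have "Ck_on k S (dd v (\<lambda>x. P (f x) (g x)))" for v
    using Suc.prems
    by (subst Ck_on_cong[OF assms(1), of _ "\<lambda>x. P (f x) (dd v g x) + P (dd v f x) (g x)"])
      (auto simp: Ck_on_Suc_dd dd_bilinear[OF P])
  moreover have "(\<lambda>x. P (f x) (g x)) differentiable (at x)" if "x \<in> S" for x
  proof -
    have "f differentiable (at x)" "g differentiable (at x)" using that Suc.prems by (auto simp: Ck_on_Suc_dd)
    from bounded_bilinear.FDERIV[OF P this[THEN has_derivative_dd]] show ?thesis
      unfolding differentiable_def by blast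
  qed
  ultimately show ?case by (auto simp: Ck_on_Suc_dd)
qed

lemma Ck_on_sum:
  assumes "open S" "\<And>i. i \<in> I \<Longrightarrow> Ck_on k S (f i)"
  shows "Ck_on k S (\<lambda>x. \<Sum>i\<in>I. f i x)"
  using assms(2)
  by (induction I rule: infinite_finite_induct) (auto simp: Ck_on_const intro: Ck_on_add[OF assms(1)])

lemma Ck_on_bounded_linear:
  assumes "open S" "bounded_linear h" "Ck_on k S f"
  shows "Ck_on k S (\<lambda>x. h (f x))"
proof -
  interpret bounded_linear h by fact
  have "bounded_bilinear (\<lambda>(c::real) y. c *\<^sub>R h y)"
    by (rule bounded_bilinear.comp[OF bounded_bilinear_scaleR bounded_linear_ident assms(2)])
  from Ck_on_bounded_bilinear[OF assms(1) this Ck_on_const[of k S 1] assms(3)]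
  show ?thesis by simp
qed

lemma Ck_on_inverse:
  fixes f :: "'a::real_normed_vector \<Rightarrow> real"
  assumes "open S" "\<And>x. x \<in> S \<Longrightarrow> f x \<noteq> 0"
  shows "Ck_on k S f \<Longrightarrow> Ck_on k S (\<lambda>x. inverse (f x))"
proof (induction k)
  case 0
  then show ?case using assms(2) by (auto intro!: continuous_intros)
next
  case (Suc k)
  have C: "Ck_on k S (\<lambda>x. inverse (f x))" by (rule Suc.IH) (rule Ck_on_SucD[OF Suc.prems])
  have d: "((\<lambda>x. inverse (f x)) has_derivative (\<lambda>v. - 1 * (inverse (f x) * (dd v f x * inverse (f x))))) (at x)"
    if "x \<in> S" for x
    using Deriv.has_derivative_inverse[of f x "\<lambda>v. dd v f x" UNIV] assms(2)[OF that] that Suc.prems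
      has_derivative_dd[of f x]
    by (auto simp: Ck_on_Suc_dd mult.assoc)
  have "Ck_on k S (\<lambda>x. - 1 * (inverse (f x) * (dd v f x * inverse (f x))))" for v
    using Suc.prems by (intro Ck_on_bounded_bilinear[OF assms(1) bounded_bilinear_mult] Ck_on_const C)
      (auto simp: Ck_on_Suc_dd)
  then have "Ck_on k S (dd v (\<lambda>x. inverse (f x)))" for v
    by (subst Ck_on_cong[OF assms(1), of _ "\<lambda>x. - 1 * (inverse (f x) * (dd v f x * inverse (f x)))"])
      (rule dd_eqI[OF d])
  with d show ?case unfolding Ck_on_Suc_dd differentiable_def by blast
qed

lemma Ck_on_vec_lambda:
  fixes F :: "'n::finite \<Rightarrow> 'a::real_normed_vector \<Rightarrow> 'b::real_normed_vector"
  assumes "open S" "\<And>i. Ck_on k S (F i)"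
  shows "Ck_on k S (\<lambda>x. \<chi> i. F i x)"
proof -
  have bl: "bounded_linear (\<lambda>y::'b. axis i y)" for i :: 'n
  proof (rule bounded_linear_intro[where K = 1])
    show "axis i (x + y) = axis i x + axis i y" for x y :: 'b
      by (auto simp: axis_def vec_eq_iff)
    show "axis i (r *\<^sub>R x) = r *\<^sub>R axis i x" for r and x :: 'b
      by (auto simp: axis_def vec_eq_iff)
    show "norm (axis i x) \<le> norm x * 1" for x :: 'b
    proof -
      have "norm (axis i x) \<le> (\<Sum>j\<in>UNIV. norm ((axis i x :: 'b ^ 'n) $ j))"
        unfolding norm_vec_def by (rule L2_set_le_sum) simp
      also have "\<dots> = (\<Sum>j\<in>UNIV. if j = i then norm x else 0)"
        by (intro sum.cong) (auto simp: axis_def)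
      finally show ?thesis by simp
    qed
  qed
  have "(\<lambda>x. \<chi> i. F i x) = (\<lambda>x. \<Sum>i\<in>UNIV. axis i (F i x))"
    by (auto simp: fun_eq_iff vec_eq_iff axis_def if_distrib[of "\<lambda>v. v $ _"] cong: if_cong)
  then show ?thesis
    by (auto intro!: Ck_on_sum[OF assms(1)] Ck_on_bounded_linear[OF assms(1) bl] assms(2))
qed

lemma smooth_on_differentiable: "smooth_on S f \<Longrightarrow> x \<in> S \<Longrightarrow> f differentiable (at x)"
  unfolding smooth_on_def using Ck_on_Suc_dd by blast

lemma smooth_on_dd: "smooth_on S f \<Longrightarrow> smooth_on S (dd v f)"
  unfolding smooth_on_def using Ck_on_Suc_dd by blast

lemma smooth_on_continuous: "smooth_on S f \<Longrightarrow> continuous_on S f"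
  unfolding smooth_on_def using Ck_on.simps(1) by blast

lemma smooth_on_subset: "smooth_on S f \<Longrightarrow> T \<subseteq> S \<Longrightarrow> smooth_on T f"
  unfolding smooth_on_def using Ck_on_subset by blast

lemma smooth_on_cong:
  "open S \<Longrightarrow> (\<And>x. x \<in> S \<Longrightarrow> f x = g x) \<Longrightarrow> smooth_on S f \<longleftrightarrow> smooth_on S g"
  unfolding smooth_on_def using Ck_on_cong by blast

lemma smooth_on_const: "smooth_on S (\<lambda>x. c)"
  by (simp add: smooth_on_def Ck_on_const)

lemma smooth_on_ident: "smooth_on S (\<lambda>x. x)"
  by (simp add: smooth_on_def Ck_on_ident)

lemma smooth_on_bounded_linear:
  "open S \<Longrightarrow> bounded_linear h \<Longrightarrow> smooth_on S f \<Longrightarrow> smooth_on S (\<lambda>x. h (f x))"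
  by (simp add: smooth_on_def Ck_on_bounded_linear)

lemma smooth_on_add:
  "open S \<Longrightarrow> smooth_on S f \<Longrightarrow> smooth_on S g \<Longrightarrow> smooth_on S (\<lambda>x. f x + g x)"
  by (simp add: smooth_on_def Ck_on_add)

lemma smooth_on_minus: "open S \<Longrightarrow> smooth_on S f \<Longrightarrow> smooth_on S (\<lambda>x. - f x)"
  by (rule smooth_on_bounded_linear[OF _ bounded_linear_minus[OF bounded_linear_ident]])

lemma smooth_on_diff:
  "open S \<Longrightarrow> smooth_on S f \<Longrightarrow> smooth_on S g \<Longrightarrow> smooth_on S (\<lambda>x. f x - g x)"
  using smooth_on_add[OF _ _ smooth_on_minus, of S f g] by simp

lemma smooth_on_mult:
  fixes f g :: "'a::real_normed_vector \<Rightarrow> real"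
  shows "open S \<Longrightarrow> smooth_on S f \<Longrightarrow> smooth_on S g \<Longrightarrow> smooth_on S (\<lambda>x. f x * g x)"
  by (simp add: smooth_on_def Ck_on_bounded_bilinear[OF _ bounded_bilinear_mult])

lemma smooth_on_scaleR:
  "open S \<Longrightarrow> smooth_on S f \<Longrightarrow> smooth_on S g \<Longrightarrow> smooth_on S (\<lambda>x. f x *\<^sub>R g x)"
  by (simp add: smooth_on_def Ck_on_bounded_bilinear[OF _ bounded_bilinear_scaleR])

lemma smooth_on_inner:
  fixes f g :: "'a::real_normed_vector \<Rightarrow> 'b::real_inner"
  shows "open S \<Longrightarrow> smooth_on S f \<Longrightarrow> smooth_on S g \<Longrightarrow> smooth_on S (\<lambda>x. f x \<bullet> g x)"
  by (simp add: smooth_on_def Ck_on_bounded_bilinear[OF _ bounded_bilinear_inner])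

lemma smooth_on_sum:
  "open S \<Longrightarrow> (\<And>i. i \<in> I \<Longrightarrow> smooth_on S (f i)) \<Longrightarrow> smooth_on S (\<lambda>x. \<Sum>i\<in>I. f i x)"
  by (simp add: smooth_on_def Ck_on_sum)

lemma smooth_on_prod:
  fixes f :: "'i \<Rightarrow> 'a::real_normed_vector \<Rightarrow> real"
  shows "open S \<Longrightarrow> (\<And>i. i \<in> I \<Longrightarrow> smooth_on S (f i)) \<Longrightarrow> smooth_on S (\<lambda>x. \<Prod>i\<in>I. f i x)"
  by (induction I rule: infinite_finite_induct) (auto intro: smooth_on_const smooth_on_mult)

lemma smooth_on_divide:
  fixes f g :: "'a::real_normed_vector \<Rightarrow> real"
  shows "open S \<Longrightarrow> smooth_on S f \<Longrightarrow> smooth_on S g \<Longrightarrow> (\<And>x. x \<in> S \<Longrightarrow> g x \<noteq> 0)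
    \<Longrightarrow> smooth_on S (\<lambda>x. f x / g x)"
  unfolding divide_inverse
  by (rule smooth_on_mult) (auto simp: smooth_on_def Ck_on_inverse)

lemma smooth_on_vec_lambda:
  "open S \<Longrightarrow> (\<And>i. smooth_on S (F i)) \<Longrightarrow> smooth_on S (\<lambda>x. \<chi> i. F i x)"
  by (simp add: smooth_on_def Ck_on_vec_lambda)

lemma smooth_on_nth: "open S \<Longrightarrow> smooth_on S f \<Longrightarrow> smooth_on S (\<lambda>x. f x $ i)"
  by (rule smooth_on_bounded_linear[OF _ bounded_linear_vec_nth])

lemmas smooth_intros = smooth_on_const smooth_on_ident smooth_on_add smooth_on_minus smooth_on_diff
  smooth_on_mult smooth_on_scaleR smooth_on_inner smooth_on_sum smooth_on_prod smooth_on_vec_lambda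
  smooth_on_nth smooth_on_dd

lemma matrix_inv_right:
  fixes A :: "real ^ 'n ^ 'n"
  assumes "invertible A"
  shows "A ** matrix_inv A = mat 1"
proof -
  have "A ** matrix_inv A = mat 1 \<and> matrix_inv A ** A = mat 1"
    using assms unfolding invertible_def matrix_inv_def by (rule someI_ex)
  then show ?thesis by simp
qed

lemma smooth_on_det:
  fixes A :: "'a::real_normed_vector \<Rightarrow> real ^ 'n ^ 'n"
  assumes "open S" "\<And>i j. smooth_on S (\<lambda>x. A x $ i $ j)"
  shows "smooth_on S (\<lambda>x. det (A x))"
  unfolding det_def by (intro smooth_intros assms)

text \<open>By Cramer's rule the entries of the inverse are quotients of determinants.\<close>

lemma smooth_on_matrix_inv:
  fixes A :: "'a::real_normed_vector \<Rightarrow> real ^ 'n ^ 'n"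
  assumes S: "open S" and A: "smooth_on S A" and inv: "\<And>x. x \<in> S \<Longrightarrow> invertible (A x)"
  shows "smooth_on S (\<lambda>x. matrix_inv (A x))"
proof -
  have A': "smooth_on S (\<lambda>x. A x $ i $ j)" for i j by (intro smooth_on_nth S A)
  have d: "det (A x) \<noteq> 0" if "x \<in> S" for x using inv[OF that] by (simp add: invertible_det_nz)
  have eq: "matrix_inv (A x) = (\<chi> k l. det (\<chi> i j. if j = k then axis l 1 $ i else A x $ i $ j) / det (A x))"
    if "x \<in> S" for x
  proof -
    have "A x *v (matrix_inv (A x) *v axis l 1) = axis l 1" for l
      by (simp add: matrix_vector_mul_assoc matrix_inv_right[OF inv[OF that]])
    then have "matrix_inv (A x) *v axis l 1 = (\<chi> k. det (\<chi> i j. if j = k then axis l 1 $ i else A x $ i $ j) / det (A x))" for l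
      using cramer[OF d[OF that]] by blast
    then show ?thesis
      by (simp add: vec_eq_iff matrix_vector_mult_basis column_def)
  qed
  have "smooth_on S (\<lambda>x. \<chi> k l. det (\<chi> i j. if j = k then axis l 1 $ i else A x $ i $ j) / det (A x))"
  proof (intro smooth_on_vec_lambda S smooth_on_divide smooth_on_det d A')
    fix k l i j :: 'n
    show "smooth_on S (\<lambda>x. (\<chi> i j. if j = k then axis l 1 $ i else A x $ i $ j) $ i $ j)"
      by (cases "j = k") (simp_all add: smooth_on_const A')
  qed
  then show ?thesis
    by (subst smooth_on_cong[OF S eq])
qed

lemma axis_expansion:
  fixes v :: "real ^ 'n"
  shows "(\<Sum>i\<in>UNIV. (v $ i) *\<^sub>R axis i 1) = v"
  using basis_expansion[of v] by (simp add: scalar_mult_eq_scaleR)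

lemma linear_expansion:
  fixes h :: "real ^ 'n \<Rightarrow> 'b::real_vector"
  assumes "linear h"
  shows "h v = (\<Sum>i\<in>UNIV. (v $ i) *\<^sub>R h (axis i 1))"
  by (metis (no_types, lifting) axis_expansion assms linear_scale linear_sum sum.cong)

lemma smooth_on_compose:
  fixes p :: "'a::real_normed_vector \<Rightarrow> real ^ 'n" and f :: "real ^ 'n \<Rightarrow> 'b::real_normed_vector"
  assumes S: "open S" and T: "open T" and p: "smooth_on S p" and pT: "p ` S \<subseteq> T" and f: "smooth_on T f"
  shows "smooth_on S (\<lambda>x. f (p x))"
proof -
  have "Ck_on k S (\<lambda>x. f (p x))" if "smooth_on T f" for k and f :: "real ^ 'n \<Rightarrow> 'b"
    using that
  proof (induction k arbitrary: f)
    case 0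
    then show ?case
      using continuous_on_compose2[OF smooth_on_continuous smooth_on_continuous[OF p] pT] by simp
  next
    case (Suc k)
    have diff: "p differentiable (at x)" "f differentiable (at (p x))" if "x \<in> S" for x
      using smooth_on_differentiable p Suc.prems pT that by blast+
    have "(\<lambda>x. f (p x)) differentiable (at x)" if "x \<in> S" for x
      using differentiable_chain_at[OF diff[OF that]] by (simp add: o_def)
    moreover have "Ck_on k S (dd v (\<lambda>x. f (p x)))" for v
    proof -
      have "Ck_on k S (\<lambda>x. \<Sum>i\<in>UNIV. (dd v p x $ i) *\<^sub>R dd (axis i 1) f (p x))"
        using smooth_on_nth[OF S smooth_on_dd[OF p]] smooth_on_dd[OF Suc.prems]
        by (intro Ck_on_sum[OF S] Ck_on_bounded_bilinear[OF S bounded_bilinear_scaleR] Suc.IH)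
          (auto simp: smooth_on_def)
      moreover have "dd v (\<lambda>x. f (p x)) x = (\<Sum>i\<in>UNIV. (dd v p x $ i) *\<^sub>R dd (axis i 1) f (p x))" if "x \<in> S" for x
        using linear_expansion[OF linear_dd[OF diff(2)[OF that]]] dd_compose[OF diff[OF that]] by metis
      ultimately show ?thesis
        using Ck_on_cong[OF S] by (metis (no_types, lifting))
    qed
    ultimately show ?case by (simp add: Ck_on_Suc_dd)
  qed
  with f show ?thesis by (simp add: smooth_on_def)
qed

text \<open>Product rule for a field of linear maps applied to a vector field. Expanding the argument in the
  standard basis reduces it to the product rule for scalar multiples; the bilinear case below follows
  by treating one argument at a time.\<close>

lemma
  fixes L :: "'a::real_normed_vector \<Rightarrow> real ^ 'n \<Rightarrow> 'b::real_normed_vector"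
  assumes S: "open S" and lin: "\<And>x. x \<in> S \<Longrightarrow> linear (L x)"
    and L: "\<And>w. smooth_on S (\<lambda>x. L x w)" and U: "smooth_on S U"
  shows smooth_on_linear_field: "smooth_on S (\<lambda>x. L x (U x))"
    and dd_linear_field: "x \<in> S \<Longrightarrow> dd v (\<lambda>y. L y (U y)) x = dd v (\<lambda>y. L y (U x)) x + L x (dd v U x)"
proof -
  have eq: "L x w = (\<Sum>i\<in>UNIV. (w $ i) *\<^sub>R L x (axis i 1))" if "x \<in> S" for x w
    by (rule linear_expansion[OF lin[OF that]])
  have sm: "smooth_on S (\<lambda>x. \<Sum>i\<in>UNIV. (U x $ i) *\<^sub>R L x (axis i 1))"
    by (intro smooth_intros S L U)
  show "smooth_on S (\<lambda>x. L x (U x))"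
    by (subst smooth_on_cong[OF S eq]) (use sm in auto)
  assume x: "x \<in> S"
  note dU = smooth_on_differentiable[OF U x] and dL = smooth_on_differentiable[OF L x]
  have dUi: "(\<lambda>y. U y $ i) differentiable (at x)" for i
    by (rule smooth_on_differentiable[OF smooth_on_nth[OF S U] x])
  have dsc: "(\<lambda>y. U y $ i *\<^sub>R L y (axis i 1)) differentiable (at x)"
    "(\<lambda>y. U x $ i *\<^sub>R L y (axis i 1)) differentiable (at x)" for i
    by (intro smooth_on_differentiable[OF _ x] smooth_intros S L U)+
  have 1: "dd v (\<lambda>y. L y (U y)) x = dd v (\<lambda>y. \<Sum>i\<in>UNIV. (U y $ i) *\<^sub>R L y (axis i 1)) x"
    by (rule dd_cong[OF S x]) (rule eq)
  also have "\<dots> = (\<Sum>i\<in>UNIV. dd v (\<lambda>y. (U y $ i) *\<^sub>R L y (axis i 1)) x)"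
    by (rule dd_sum) (rule dsc)
  also have "\<dots> = (\<Sum>i\<in>UNIV. (U x $ i) *\<^sub>R dd v (\<lambda>y. L y (axis i 1)) x + (dd v U x $ i) *\<^sub>R L x (axis i 1))"
    by (simp add: dd_scaleR[OF dUi dL] dd_nth[OF dU])
  also have "\<dots> = (\<Sum>i\<in>UNIV. (U x $ i) *\<^sub>R dd v (\<lambda>y. L y (axis i 1)) x) + L x (dd v U x)"
    by (simp add: sum.distrib eq[OF x, symmetric])
  also have "(\<Sum>i\<in>UNIV. (U x $ i) *\<^sub>R dd v (\<lambda>y. L y (axis i 1)) x)
      = (\<Sum>i\<in>UNIV. dd v (\<lambda>y. (U x $ i) *\<^sub>R L y (axis i 1)) x)"
    by (simp add: dd_scaleR[OF differentiable_const dL])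
  also have "\<dots> = dd v (\<lambda>y. \<Sum>i\<in>UNIV. (U x $ i) *\<^sub>R L y (axis i 1)) x"
    by (rule dd_sum[symmetric]) (rule dsc)
  also have "\<dots> = dd v (\<lambda>y. L y (U x)) x"
    by (rule dd_cong[OF S x]) (rule eq[symmetric])
  finally show "dd v (\<lambda>y. L y (U y)) x = dd v (\<lambda>y. L y (U x)) x + L x (dd v U x)" .
qed

lemma
  fixes B :: "'a::real_normed_vector \<Rightarrow> real ^ 'n \<Rightarrow> real ^ 'm \<Rightarrow> 'b::real_normed_vector"
  assumes S: "open S" and lin1: "\<And>x w. x \<in> S \<Longrightarrow> linear (\<lambda>u. B x u w)"
    and lin2: "\<And>x u. x \<in> S \<Longrightarrow> linear (B x u)"
    and B: "\<And>u w. smooth_on S (\<lambda>x. B x u w)" and U: "smooth_on S U" and V: "smooth_on S V"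
  shows smooth_on_bilinear_field: "smooth_on S (\<lambda>x. B x (U x) (V x))"
    and dd_bilinear_field: "x \<in> S \<Longrightarrow> dd v (\<lambda>y. B y (U y) (V y)) x
      = dd v (\<lambda>y. B y (U x) (V x)) x + B x (dd v U x) (V x) + B x (U x) (dd v V x)"
proof -
  have BU: "smooth_on S (\<lambda>x. B x (U x) w)" for w
    by (rule smooth_on_linear_field[OF S lin1 B U])
  show "smooth_on S (\<lambda>x. B x (U x) (V x))"
    by (rule smooth_on_linear_field[OF S lin2 BU V])
  assume x: "x \<in> S"
  show "dd v (\<lambda>y. B y (U y) (V y)) x
      = dd v (\<lambda>y. B y (U x) (V x)) x + B x (dd v U x) (V x) + B x (U x) (dd v V x)"
    using dd_linear_field[OF S lin2 BU V x, of v] dd_linear_field[OF S lin1 B U x, of v "V x"]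
    by simp
qed

lemma linear_dd_field:
  fixes L :: "'a::real_normed_vector \<Rightarrow> 'c::real_vector \<Rightarrow> 'b::real_normed_vector"
  assumes S: "open S" and lin: "\<And>x. x \<in> S \<Longrightarrow> linear (L x)"
    and L: "\<And>w. smooth_on S (\<lambda>x. L x w)" and x: "x \<in> S"
  shows "linear (\<lambda>w. dd v (\<lambda>y. L y w) x)"
proof (rule linearI)
  note dL = smooth_on_differentiable[OF L x]
  fix a b :: 'c and r :: real
  have "dd v (\<lambda>y. L y (a + b)) x = dd v (\<lambda>y. L y a + L y b) x"
    by (rule dd_cong[OF S x]) (rule linear_add[OF lin])
  then show "dd v (\<lambda>y. L y (a + b)) x = dd v (\<lambda>y. L y a) x + dd v (\<lambda>y. L y b) x"
    by (simp add: dd_add[OF dL dL])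
  have "dd v (\<lambda>y. L y (r *\<^sub>R a)) x = dd v (\<lambda>y. r *\<^sub>R L y a) x"
    by (rule dd_cong[OF S x]) (rule linear_scale[OF lin])
  then show "dd v (\<lambda>y. L y (r *\<^sub>R a)) x = r *\<^sub>R dd v (\<lambda>y. L y a) x"
    by (simp add: dd_scaleR[OF differentiable_const dL])
qed

lemma dd_along_segment:
  fixes E :: "'a::real_normed_vector \<Rightarrow> real"
  assumes "E differentiable (at (p + s *\<^sub>R u))"
  shows "((\<lambda>s. E (p + s *\<^sub>R u)) has_real_derivative dd u E (p + s *\<^sub>R u)) (at s)"
proof -
  have 1: "((\<lambda>s. p + s *\<^sub>R u) has_derivative (\<lambda>h. h *\<^sub>R u)) (at s)"
    by (auto intro!: derivative_eq_intros)
  have "((\<lambda>s. E (p + s *\<^sub>R u)) has_derivative (\<lambda>h. dd (h *\<^sub>R u) E (p + s *\<^sub>R u))) (at s)"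
    using diff_chain_at[OF 1 has_derivative_dd[OF assms]] by (simp add: o_def)
  moreover have "dd (h *\<^sub>R u) E (p + s *\<^sub>R u) = dd u E (p + s *\<^sub>R u) * h" for h
    using linear_scale[OF linear_dd[OF assms], of h u] by simp
  ultimately show ?thesis by (simp add: has_field_derivative_def)
qed

lemma mean_value_dd:
  fixes f :: "'a::real_normed_vector \<Rightarrow> real"
  assumes "t > 0" "\<And>s. 0 \<le> s \<Longrightarrow> s \<le> t \<Longrightarrow> f differentiable (at (x + s *\<^sub>R u))"
  shows "\<exists>s. 0 < s \<and> s < t \<and> f (x + t *\<^sub>R u) - f x = t * dd u f (x + s *\<^sub>R u)"
  using MVT2[OF assms(1) dd_along_segment[OF assms(2)]] by auto

text \<open>The second difference of \<open>f\<close> over a small parallelogram is symmetric in its two sides, and two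
  applications of the mean value theorem identify it with a mixed derivative at a nearby point.
  Continuity of the mixed derivatives then gives their symmetry.\<close>

lemma mixed_difference:
  fixes f :: "'a::real_normed_vector \<Rightarrow> real"
  assumes t: "t > 0" and S: "ball x r \<subseteq> S" and f: "smooth_on S f"
    and r: "t * (norm u + norm v) < r"
  shows "\<exists>y. norm (y - x) \<le> t * (norm u + norm v) \<and>
    f (x + t *\<^sub>R u + t *\<^sub>R v) - f (x + t *\<^sub>R u) - (f (x + t *\<^sub>R v) - f x) = t * t * dd v (dd u f) y"
proof -
  have nb: "norm (a *\<^sub>R u + b *\<^sub>R v) \<le> t * (norm u + norm v)" if "0 \<le> a" "a \<le> t" "0 \<le> b" "b \<le> t" for a b
  proof -
    have "norm (a *\<^sub>R u + b *\<^sub>R v) \<le> a * norm u + b * norm v"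
      using norm_triangle_ineq[of "a *\<^sub>R u" "b *\<^sub>R v"] that by simp
    also have "\<dots> \<le> t * norm u + t * norm v"
      using that by (intro add_mono mult_right_mono) auto
    finally show ?thesis by (simp add: algebra_simps)
  qed
  have inS: "x + (a *\<^sub>R u + b *\<^sub>R v) \<in> S" if "0 \<le> a" "a \<le> t" "0 \<le> b" "b \<le> t" for a b
  proof (rule subsetD[OF S])
    have "dist x (x + (a *\<^sub>R u + b *\<^sub>R v)) = norm (a *\<^sub>R u + b *\<^sub>R v)"
      by (metis add_diff_cancel_left' dist_commute dist_norm)
    with nb[OF that] r show "x + (a *\<^sub>R u + b *\<^sub>R v) \<in> ball x r" by simp
  qed
  have df: "f differentiable (at (x + (a *\<^sub>R u + b *\<^sub>R v)))" if "0 \<le> a" "a \<le> t" "0 \<le> b" "b \<le> t" for a b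
    by (rule smooth_on_differentiable[OF f inS[OF that]])
  have dF: "(\<lambda>y. f (y + t *\<^sub>R v)) differentiable (at (x + s *\<^sub>R u))" "f differentiable (at (x + s *\<^sub>R u))"
    "dd u (\<lambda>y. f (y + t *\<^sub>R v)) (x + s *\<^sub>R u) = dd u f (x + s *\<^sub>R u + t *\<^sub>R v)"
    if "0 \<le> s" "s \<le> t" for s
  proof -
    have id: "(\<lambda>y. y + t *\<^sub>R v) differentiable (at (x + s *\<^sub>R u))" by simp
    have fd: "f differentiable (at (x + s *\<^sub>R u + t *\<^sub>R v))" using df[of s t] that t by (simp add: add.assoc)
    show "(\<lambda>y. f (y + t *\<^sub>R v)) differentiable (at (x + s *\<^sub>R u))"
      using differentiable_chain_at[OF id fd] by (simp add: o_def)
    show "f differentiable (at (x + s *\<^sub>R u))" using df[of s 0] that t by simp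
    show "dd u (\<lambda>y. f (y + t *\<^sub>R v)) (x + s *\<^sub>R u) = dd u f (x + s *\<^sub>R u + t *\<^sub>R v)"
      using dd_compose[OF id fd, of u] by (subst (asm) dd_add) auto
  qed
  have "\<exists>s>0. s < t \<and> (f (x + t *\<^sub>R u + t *\<^sub>R v) - f (x + t *\<^sub>R u)) - (f (x + t *\<^sub>R v) - f x)
      = t * dd u (\<lambda>y. f (y + t *\<^sub>R v) - f y) (x + s *\<^sub>R u)"
    by (rule mean_value_dd[OF t, of "\<lambda>y. f (y + t *\<^sub>R v) - f y" x u]) (intro differentiable_diff dF)
  then obtain s where s: "0 < s" "s < t"
    and 1: "(f (x + t *\<^sub>R u + t *\<^sub>R v) - f (x + t *\<^sub>R u)) - (f (x + t *\<^sub>R v) - f x)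
      = t * (dd u f (x + s *\<^sub>R u + t *\<^sub>R v) - dd u f (x + s *\<^sub>R u))"
    using dd_diff[OF dF(1,2)] dF(3) by auto
  have "\<exists>s'>0. s' < t \<and> dd u f (x + s *\<^sub>R u + t *\<^sub>R v) - dd u f (x + s *\<^sub>R u)
      = t * dd v (dd u f) (x + s *\<^sub>R u + s' *\<^sub>R v)"
    using inS[of s] s
    by (intro mean_value_dd[OF t]) (auto intro!: smooth_on_differentiable[OF smooth_on_dd[OF f]] simp: add.assoc)
  then obtain s' where s': "0 < s'" "s' < t"
    and 2: "dd u f (x + s *\<^sub>R u + t *\<^sub>R v) - dd u f (x + s *\<^sub>R u) = t * dd v (dd u f) (x + s *\<^sub>R u + s' *\<^sub>R v)"
    by blast
  show ?thesis
    using 1 2 nb[of s s'] s s' by (intro exI[of _ "x + s *\<^sub>R u + s' *\<^sub>R v"]) (simp add: add.assoc)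
qed

lemma dd_commute_real:
  fixes f :: "'a::real_normed_vector \<Rightarrow> real"
  assumes S: "open S" and f: "smooth_on S f" and x: "x \<in> S"
  shows "dd u (dd v f) x = dd v (dd u f) x"
proof (rule ccontr)
  assume ne: "dd u (dd v f) x \<noteq> dd v (dd u f) x"
  define e where "e = \<bar>dd u (dd v f) x - dd v (dd u f) x\<bar> / 2"
  have e: "e > 0" using ne by (simp add: e_def)
  obtain r where r: "r > 0" "ball x r \<subseteq> S" using S x open_contains_ball by blast
  have c: "isCont (dd u (dd v f)) x" "isCont (dd v (dd u f)) x"
    using smooth_on_continuous[OF smooth_on_dd[OF smooth_on_dd[OF f]]] S x
    by (auto simp: continuous_on_eq_continuous_at)
  obtain d1 where d1: "d1 > 0" "\<And>y. norm (y - x) < d1 \<Longrightarrow> \<bar>dd u (dd v f) y - dd u (dd v f) x\<bar> < e"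
    using c(1) e unfolding continuous_at_eps_delta dist_norm real_norm_def by blast
  obtain d2 where d2: "d2 > 0" "\<And>y. norm (y - x) < d2 \<Longrightarrow> \<bar>dd v (dd u f) y - dd v (dd u f) x\<bar> < e"
    using c(2) e unfolding continuous_at_eps_delta dist_norm real_norm_def by blast
  define m where "m = min r (min d1 d2)"
  have m: "m > 0" using r d1 d2 by (simp add: m_def)
  define t where "t = m / (2 * (norm u + norm v + 1))"
  have k: "norm u + norm v + 1 > 0" by (smt (verit) norm_ge_zero)
  have t: "t > 0" using m k by (simp add: t_def)
  have "t * (norm u + norm v) \<le> t * (norm u + norm v + 1)" using t by (intro mult_left_mono) auto
  also have "\<dots> = m / 2" using k by (simp add: t_def field_simps)
  also have "\<dots> < m" using m by simp
  finally have tm: "t * (norm u + norm v) < m" .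
  obtain y where y: "norm (y - x) \<le> t * (norm u + norm v)"
    "f (x + t *\<^sub>R u + t *\<^sub>R v) - f (x + t *\<^sub>R u) - (f (x + t *\<^sub>R v) - f x) = t * t * dd v (dd u f) y"
    using mixed_difference[OF t r(2) f, of u v] tm by (auto simp: m_def)
  obtain z where z: "norm (z - x) \<le> t * (norm u + norm v)"
    "f (x + t *\<^sub>R v + t *\<^sub>R u) - f (x + t *\<^sub>R v) - (f (x + t *\<^sub>R u) - f x) = t * t * dd u (dd v f) z"
    using mixed_difference[OF t r(2) f, of v u] tm by (auto simp: m_def add.commute)
  have "t * t * dd v (dd u f) y = t * t * dd u (dd v f) z"
    using y(2) z(2) by (simp add: algebra_simps)
  then have "dd v (dd u f) y = dd u (dd v f) z" using t by simp
  moreover have "\<bar>dd v (dd u f) y - dd v (dd u f) x\<bar> < e" using y(1) tm by (intro d2) (simp add: m_def)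
  moreover have "\<bar>dd u (dd v f) z - dd u (dd v f) x\<bar> < e" using z(1) tm by (intro d1) (simp add: m_def)
  ultimately show False unfolding e_def by (simp add: abs_if split: if_splits)
qed

lemma dd_commute:
  fixes f :: "'a::real_normed_vector \<Rightarrow> 'b::real_inner"
  assumes S: "open S" and f: "smooth_on S f" and x: "x \<in> S"
  shows "dd u (dd v f) x = dd v (dd u f) x"
proof -
  have 1: "dd u (dd v (\<lambda>y. f y \<bullet> b)) x = dd u (dd v f) x \<bullet> b" for u v b
  proof -
    note bl = bounded_linear_inner_left[of b]
    have "dd u (dd v (\<lambda>y. f y \<bullet> b)) x = dd u (\<lambda>y. dd v f y \<bullet> b) x"
      by (rule dd_cong[OF S x]) (rule dd_bounded_linear[OF bl smooth_on_differentiable[OF f]])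
    also have "\<dots> = dd u (dd v f) x \<bullet> b"
      by (rule dd_bounded_linear[OF bl smooth_on_differentiable[OF smooth_on_dd[OF f] x]])
    finally show ?thesis .
  qed
  have "dd u (dd v f) x \<bullet> b = dd v (dd u f) x \<bullet> b" for b
    using dd_commute_real[OF S smooth_on_inner[OF S f smooth_on_const[of S b]] x, of u v]
    unfolding 1 .
  then show ?thesis by (metis vector_eq_rdot)
qed

section \<open>The metric and its curvature in a chart\<close>

text \<open>A metric is given in a chart by a matrix field \<open>G\<close>. The components \<open>g\<^sub>i\<^sub>j\<close>, \<open>\<Gamma>\<^sup>k\<^sub>i\<^sub>j\<close> and
  \<open>R\<^sub>j\<^sub>k\<close> are assembled into multilinear maps of vectors, so that identities between them need no
  summation over indices.\<close>

definition gm :: "(real ^ 'n \<Rightarrow> real ^ 'n ^ 'n) \<Rightarrow> real ^ 'n \<Rightarrow> real ^ 'n \<Rightarrow> real ^ 'n \<Rightarrow> real" where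
  "gm G x u v = u \<bullet> (G x *v v)"

definition christ :: "(real ^ 'n \<Rightarrow> real ^ 'n ^ 'n) \<Rightarrow> real ^ 'n \<Rightarrow> real ^ 'n \<Rightarrow> real ^ 'n \<Rightarrow> real ^ 'n::finite" where
  "christ G x u v = (\<chi> k. \<Sum>i\<in>UNIV. \<Sum>j\<in>UNIV. u $ i * (v $ j * christoffel G k i j x))"

text \<open>The derivatives \<open>(D\<^sub>w g)(u, v)\<close> and, below, \<open>(D\<^sub>w \<Gamma>)(u, v)\<close>, taken with \<open>u\<close> and \<open>v\<close> constant.\<close>

definition dg :: "(real ^ 'n \<Rightarrow> real ^ 'n ^ 'n) \<Rightarrow> real ^ 'n \<Rightarrow> real ^ 'n \<Rightarrow> real ^ 'n \<Rightarrow> real ^ 'n \<Rightarrow> real" where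
  "dg G x w u v = dd w (\<lambda>y. gm G y u v) x"

definition dchrist ::
    "(real ^ 'n \<Rightarrow> real ^ 'n ^ 'n) \<Rightarrow> real ^ 'n \<Rightarrow> real ^ 'n \<Rightarrow> real ^ 'n \<Rightarrow> real ^ 'n \<Rightarrow> real ^ 'n::finite" where
  "dchrist G x w u v = dd w (\<lambda>y. christ G y u v) x"

definition riem ::
    "(real ^ 'n \<Rightarrow> real ^ 'n ^ 'n) \<Rightarrow> real ^ 'n \<Rightarrow> real ^ 'n \<Rightarrow> real ^ 'n \<Rightarrow> real ^ 'n \<Rightarrow> real ^ 'n::finite" where
  "riem G x u v w = dchrist G x u v w - dchrist G x v u w
     + christ G x u (christ G x v w) - christ G x v (christ G x u w)"

definition ltrace :: "(real ^ 'n \<Rightarrow> real ^ 'n::finite) \<Rightarrow> real" where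
  "ltrace T = (\<Sum>i\<in>UNIV. T (axis i 1) $ i)"

definition ric :: "(real ^ 'n \<Rightarrow> real ^ 'n ^ 'n) \<Rightarrow> real ^ 'n \<Rightarrow> real ^ 'n \<Rightarrow> real ^ 'n::finite \<Rightarrow> real" where
  "ric G x v w = ltrace (\<lambda>u. riem G x u v w)"

definition bmat :: "(real ^ 'n \<Rightarrow> real ^ 'n \<Rightarrow> real) \<Rightarrow> real ^ 'n ^ 'n::finite" where
  "bmat B = (\<chi> i j. B (axis i 1) (axis j 1))"

text \<open>The Ricci tensor with one index raised. Its trace is the scalar curvature, and traces of
  endomorphisms are invariant under conjugation, which keeps the inverse metric out of later
  computations.\<close>

definition ricop :: "(real ^ 'n \<Rightarrow> real ^ 'n ^ 'n) \<Rightarrow> real ^ 'n \<Rightarrow> real ^ 'n \<Rightarrow> real ^ 'n::finite" where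
  "ricop G x v = matrix_inv (G x) *v (bmat (ric G x) *v v)"

lemma linear_ricop: "linear (ricop G x)"
  unfolding ricop_def[abs_def] matrix_vector_mul_assoc by simp

lemma bilinear_expansion:
  fixes B :: "real ^ 'n \<Rightarrow> real ^ 'n \<Rightarrow> real"
  assumes "\<And>w. linear (\<lambda>u. B u w)" "\<And>u. linear (B u)"
  shows "B u v = (\<Sum>i\<in>UNIV. u $ i * (\<Sum>j\<in>UNIV. v $ j * B (axis i 1) (axis j 1)))"
proof -
  have "B u v = (\<Sum>i\<in>UNIV. u $ i * B (axis i 1) v)"
    using linear_expansion[OF assms(1), of u v] by simp
  moreover have "B (axis i 1) v = (\<Sum>j\<in>UNIV. v $ j * B (axis i 1) (axis j 1))" for i
    using linear_expansion[OF assms(2), of "axis i 1" v] by simp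
  ultimately show ?thesis by (simp only:)
qed

lemma bmat_mult:
  assumes "\<And>w. linear (\<lambda>u. B u w)" "\<And>u. linear (B u)"
  shows "u \<bullet> (bmat B *v v) = B u v"
proof -
  have "u \<bullet> (bmat B *v v) = (\<Sum>i\<in>UNIV. u $ i * (\<Sum>j\<in>UNIV. v $ j * B (axis i 1) (axis j 1)))"
    by (simp add: bmat_def inner_vec_def matrix_vector_mult_def mult.commute)
  then show ?thesis by (simp only: bilinear_expansion[OF assms, symmetric])
qed

lemma matrix_eqI_inner:
  fixes A B :: "real ^ 'n ^ 'n"
  shows "(\<And>u v. u \<bullet> (A *v v) = u \<bullet> (B *v v)) \<Longrightarrow> A = B"
  by (metis matrix_eq vector_eq_ldot)

lemma ltrace_matrix: "linear T \<Longrightarrow> ltrace T = trace (matrix T)"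
  by (simp add: ltrace_def trace_def matrix_def)

text \<open>This is what makes traces of curvature natural: \<open>tr (P \<circ> T \<circ> P\<inverse>) = tr T\<close>, and its infinitesimal
  form \<open>tr (a \<circ> T - T \<circ> a) = 0\<close>.\<close>

lemma ltrace_comp:
  assumes "linear T" "linear U"
  shows "ltrace (\<lambda>u. T (U u)) = ltrace (\<lambda>u. U (T u))"
proof -
  have "ltrace (T \<circ> U) = trace (matrix T ** matrix U)"
    by (simp only: ltrace_matrix[OF linear_compose[OF assms(2,1)]] matrix_compose[OF assms(2,1)])
  moreover have "ltrace (U \<circ> T) = trace (matrix U ** matrix T)"
    by (simp only: ltrace_matrix[OF linear_compose[OF assms]] matrix_compose[OF assms])
  ultimately show ?thesis
    using trace_mul_sym[of "matrix T" "matrix U"] by (simp add: o_def)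
qed

lemma ltrace_add: "ltrace (\<lambda>u. T u + U u) = ltrace T + ltrace U"
  by (simp add: ltrace_def sum.distrib)

lemma ltrace_diff: "ltrace (\<lambda>u. T u - U u) = ltrace T - ltrace U"
  by (simp add: ltrace_def sum_subtractf)

lemma ltrace_scale: "ltrace (\<lambda>u. c *\<^sub>R T u) = c * ltrace T"
  by (simp add: ltrace_def sum_distrib_left)

lemma ltrace_id: "ltrace (\<lambda>u :: real ^ 'n. u) = real CARD('n)"
  by (simp add: ltrace_def)

lemma ltrace_rank1: "linear h \<Longrightarrow> ltrace (\<lambda>u. h u *\<^sub>R v) = h v"
  using linear_expansion[of h v] by (simp add: ltrace_def mult.commute)

lemma linear_gm1: "linear (\<lambda>u. gm G x u v)"
  by (simp add: gm_def linear_iff inner_left_distrib)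

lemma linear_gm2: "linear (gm G x u)"
  by (simp add: gm_def linear_iff inner_right_distrib matrix_vector_right_distrib matrix_vector_mult_scaleR)

lemma linear_christ1: "linear (\<lambda>u. christ G x u v)"
  by (rule linearI)
    (simp_all add: christ_def vec_eq_iff sum.distrib distrib_right sum_distrib_left mult.assoc)

lemma linear_christ2: "linear (christ G x u)"
  by (rule linearI)
    (simp_all add: christ_def vec_eq_iff sum.distrib distrib_left distrib_right sum_distrib_left mult.assoc mult.left_commute)

lemma christ_axis: "christ G x (axis i 1) (axis j 1) $ k = christoffel G k i j x"
proof -
  have "christ G x (axis i 1) (axis j 1) $ k
      = (\<Sum>a\<in>UNIV. if a = i then \<Sum>b\<in>UNIV. (if b = j then christoffel G k a b x else 0) else 0)"
    unfolding christ_def axis_def vec_lambda_beta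
    by (intro sum.cong refl) (auto simp: if_distrib[of "\<lambda>z. z * _"] cong: if_cong)
  then show ?thesis by simp
qed

lemma partial_deriv_dd: "partial_deriv i f x = dd (axis i 1) f x"
  by (simp add: partial_deriv_def dd_def)

locale riemannian_chart =
  fixes S :: "(real ^ 'n::finite) set" and G :: "real ^ 'n \<Rightarrow> real ^ 'n ^ 'n"
  assumes S: "open S" and smooth_G: "smooth_on S G"
    and G_sym: "\<And>x u v. x \<in> S \<Longrightarrow> gm G x u v = gm G x v u"
    and G_pos: "\<And>x u. x \<in> S \<Longrightarrow> u \<noteq> 0 \<Longrightarrow> gm G x u u > 0"
begin

lemma gm_nondegenerate:
  assumes "x \<in> S" "\<And>w. gm G x a w = gm G x b w"
  shows "a = b"
proof (rule ccontr)
  assume "a \<noteq> b"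
  then have "gm G x (a - b) (a - b) > 0" using G_pos assms(1) by simp
  moreover have "gm G x (a - b) (a - b) = 0"
    using assms(2) by (simp add: linear_diff[OF linear_gm1])
  ultimately show False by simp
qed

lemma G_invertible: "x \<in> S \<Longrightarrow> invertible (G x)"
  unfolding invertible_left_inverse matrix_left_invertible_ker
  using G_pos by (fastforce simp: gm_def)

lemma smooth_gm: "smooth_on S (\<lambda>x. gm G x u v)"
  unfolding gm_def matrix_vector_mult_def by (intro smooth_intros S smooth_G)

lemma smooth_inv: "smooth_on S (\<lambda>x. matrix_inv (G x))"
  by (rule smooth_on_matrix_inv[OF S smooth_G G_invertible])

lemma smooth_christoffel: "smooth_on S (christoffel G k i j)"
proof -
  have "smooth_on S (partial_deriv a (\<lambda>y. G y $ b $ c))" for a b c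
    using smooth_on_dd[OF smooth_on_nth[OF S smooth_on_nth[OF S smooth_G]]]
    by (simp add: partial_deriv_dd[abs_def])
  then show ?thesis
    unfolding christoffel_def[abs_def] by (intro smooth_intros S smooth_inv)
qed

lemma smooth_christ: "smooth_on S (\<lambda>x. christ G x u v)"
  unfolding christ_def by (intro smooth_intros S smooth_christoffel)

lemma smooth_dg: "smooth_on S (\<lambda>x. dg G x w u v)"
  unfolding dg_def using smooth_on_dd[OF smooth_gm] .

lemma linear_dg:
  assumes "x \<in> S"
  shows "linear (\<lambda>w. dg G x w u v)" "linear (\<lambda>u. dg G x w u v)" "linear (\<lambda>v. dg G x w u v)"
  unfolding dg_def
  by (rule linear_dd[OF smooth_on_differentiable[OF smooth_gm assms]]
      linear_dd_field[OF S linear_gm1 smooth_gm assms]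
      linear_dd_field[OF S linear_gm2 smooth_gm assms])+

lemma linear_dchrist:
  assumes "x \<in> S"
  shows "linear (\<lambda>w. dchrist G x w u v)" "linear (\<lambda>u. dchrist G x w u v)" "linear (\<lambda>v. dchrist G x w u v)"
  unfolding dchrist_def
  by (rule linear_dd[OF smooth_on_differentiable[OF smooth_christ assms]]
      linear_dd_field[OF S linear_christ1 smooth_christ assms]
      linear_dd_field[OF S linear_christ2 smooth_christ assms])+

text \<open>Both sides are linear in each argument, so it suffices to compare them on basis vectors, where this
  is the definition of the Christoffel symbols multiplied by \<open>G\<close>.\<close>

lemma koszul:
  assumes x: "x \<in> S"
  shows "2 * gm G x (christ G x u v) w = dg G x u v w + dg G x v u w - dg G x w u v"
proof -
  define K where "K u v w = dg G x u v w + dg G x v u w - dg G x w u v" for u v w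
  have lin: "linear (\<lambda>u. K u v w)" "linear (\<lambda>v. K u v w)" "linear (\<lambda>w. K u v w)" for u v w
    unfolding K_def by (intro linear_compose_add linear_compose_sub linear_dg x)+
  have ex: "(\<Sum>i\<in>UNIV. u $ i * (\<Sum>j\<in>UNIV. v $ j * K (axis i 1) (axis j 1) w)) = K u v w" for u v w
    by (simp only: bilinear_expansion[of "\<lambda>u v. K u v w", OF lin(1,2), of u v])
  have Gg: "G y $ a $ b = gm G y (axis a 1) (axis b 1)" for y a b
    by (simp add: gm_def matrix_vector_mult_basis column_def inner_axis')
  define k where "k = (\<chi> l. K u v (axis l 1))"
  have ch: "christoffel G m i j x = (1/2) * (\<Sum>l\<in>UNIV. matrix_inv (G x) $ m $ l * K (axis i 1) (axis j 1) (axis l 1))"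
    for m i j
    unfolding christoffel_def K_def dg_def partial_deriv_dd Gg ..
  have "2 *\<^sub>R christ G x u v = matrix_inv (G x) *v k"
  proof (subst vec_eq_iff, rule allI)
    fix m
    have "(2 *\<^sub>R christ G x u v) $ m
        = (\<Sum>i\<in>UNIV. \<Sum>j\<in>UNIV. \<Sum>l\<in>UNIV. matrix_inv (G x) $ m $ l * (u $ i * (v $ j * K (axis i 1) (axis j 1) (axis l 1))))"
      by (simp add: christ_def ch sum_distrib_left mult_ac)
    also have "\<dots> = (\<Sum>i\<in>UNIV. \<Sum>l\<in>UNIV. \<Sum>j\<in>UNIV. matrix_inv (G x) $ m $ l * (u $ i * (v $ j * K (axis i 1) (axis j 1) (axis l 1))))"
      by (intro sum.cong refl sum.swap)
    also have "\<dots> = (\<Sum>l\<in>UNIV. \<Sum>i\<in>UNIV. \<Sum>j\<in>UNIV. matrix_inv (G x) $ m $ l * (u $ i * (v $ j * K (axis i 1) (axis j 1) (axis l 1))))"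
      by (rule sum.swap)
    also have "\<dots> = (matrix_inv (G x) *v k) $ m"
      by (simp add: matrix_vector_mult_def k_def sum_distrib_left[symmetric] ex)
    finally show "(2 *\<^sub>R christ G x u v) $ m = (matrix_inv (G x) *v k) $ m" .
  qed
  then have "G x *v (2 *\<^sub>R christ G x u v) = k"
    by (simp add: matrix_vector_mul_assoc matrix_inv_right[OF G_invertible[OF x]])
  then have "gm G x w (2 *\<^sub>R christ G x u v) = w \<bullet> k"
    by (simp add: gm_def)
  also have "w \<bullet> k = K u v w"
    using linear_expansion[OF lin(3), of u v w] by (simp add: k_def inner_vec_def)
  finally show ?thesis
    using G_sym[OF x] by (simp add: linear_scale[OF linear_gm2] K_def)
qed

lemma dg_sym: "x \<in> S \<Longrightarrow> dg G x w u v = dg G x w v u"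
  unfolding dg_def by (rule dd_cong[OF S]) (auto intro: G_sym)

lemma christ_sym: "x \<in> S \<Longrightarrow> christ G x u v = christ G x v u"
proof (rule gm_nondegenerate)
  fix w assume "x \<in> S"
  then show "gm G x (christ G x u v) w = gm G x (christ G x v u) w"
    using koszul[of x u v w] koszul[of x v u w] dg_sym[of x w u v] by linarith
qed

text \<open>Two Koszul formulas add up to the vanishing of the covariant derivative of \<open>g\<close>.\<close>

lemma metric_compatible:
  assumes x: "x \<in> S"
  shows "dg G x w u v = gm G x (christ G x w u) v + gm G x u (christ G x w v)"
  using koszul[OF x, of w u v] koszul[OF x, of w v u] G_sym[OF x, of u "christ G x w v"]
    dg_sym[OF x, of w u v] dg_sym[OF x, of u w v] dg_sym[OF x, of v w u] by linarith

lemma dd_gm: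
  assumes x: "x \<in> S" and "smooth_on S U" "smooth_on S V"
  shows "dd w (\<lambda>y. gm G y (U y) (V y)) x
    = dg G x w (U x) (V x) + gm G x (dd w U x) (V x) + gm G x (U x) (dd w V x)"
  unfolding dg_def by (rule dd_bilinear_field[OF S linear_gm1 linear_gm2 smooth_gm assms(2,3) x])

lemma dd_christ:
  assumes x: "x \<in> S" and "smooth_on S U" "smooth_on S V"
  shows "dd w (\<lambda>y. christ G y (U y) (V y)) x
    = dchrist G x w (U x) (V x) + christ G x (dd w U x) (V x) + christ G x (U x) (dd w V x)"
  unfolding dchrist_def by (rule dd_bilinear_field[OF S linear_christ1 linear_christ2 smooth_christ assms(2,3) x])

lemma smooth_gm_field: "smooth_on S U \<Longrightarrow> smooth_on S V \<Longrightarrow> smooth_on S (\<lambda>x. gm G x (U x) (V x))"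
  by (rule smooth_on_bilinear_field[OF S linear_gm1 linear_gm2 smooth_gm])

lemma smooth_christ_field: "smooth_on S U \<Longrightarrow> smooth_on S V \<Longrightarrow> smooth_on S (\<lambda>x. christ G x (U x) (V x))"
  by (rule smooth_on_bilinear_field[OF S linear_christ1 linear_christ2 smooth_christ])

lemma smooth_dchrist: "smooth_on S (\<lambda>x. dchrist G x w u v)"
  unfolding dchrist_def using smooth_on_dd[OF smooth_christ] .

lemma smooth_riem: "smooth_on S (\<lambda>x. riem G x u v w)"
  unfolding riem_def by (intro smooth_intros S smooth_dchrist smooth_christ_field smooth_christ)

lemma smooth_ric: "smooth_on S (\<lambda>x. ric G x v w)"
  unfolding ric_def ltrace_def by (intro smooth_intros S smooth_riem)

lemma linear_riem:
  assumes "x \<in> S"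
  shows "linear (\<lambda>u. riem G x u v w)" "linear (\<lambda>v. riem G x u v w)" "linear (\<lambda>w. riem G x u v w)"
  unfolding riem_def
  by (intro linear_compose_add linear_compose_sub linear_dchrist assms linear_christ1 linear_christ2
      linear_compose[OF linear_christ1 linear_christ2, unfolded o_def]
      linear_compose[OF linear_christ2 linear_christ2, unfolded o_def])+

lemma linear_ric:
  assumes "x \<in> S"
  shows "linear (\<lambda>v. ric G x v w)" "linear (ric G x v)"
  unfolding ric_def ltrace_def
  by (rule linearI, simp_all add: linear_add[OF linear_riem(2)[OF assms]] linear_add[OF linear_riem(3)[OF assms]]
    linear_scale[OF linear_riem(2)[OF assms]] linear_scale[OF linear_riem(3)[OF assms]] sum.distrib sum_distrib_left)+

lemma ricci_ric:
  assumes x: "x \<in> S"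
  shows "ricci G j k x = ric G x (axis j 1) (axis k 1)"
proof -
  have d: "dchrist G x (axis a 1) (axis b 1) (axis c 1) $ m = partial_deriv a (christoffel G m b c) x" for a b c m
    using dd_nth[OF smooth_on_differentiable[OF smooth_christ x], of "axis a 1" "axis b 1" "axis c 1" m]
    by (simp add: dchrist_def partial_deriv_dd christ_axis)
  have c: "christ G x (axis a 1) w $ m = (\<Sum>l\<in>UNIV. w $ l * christoffel G m a l x)" for a w m
    using linear_expansion[OF linear_christ2, of G x "axis a 1" w] by (simp add: christ_axis)
  show ?thesis
    by (simp add: ricci_def ric_def ltrace_def riem_def d c christ_axis sum_subtractf mult.commute algebra_simps)
qed

lemma inv_sym:
  assumes x: "x \<in> S"
  shows "transpose (matrix_inv (G x)) = matrix_inv (G x)"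
proof -
  have t: "transpose (G x) = G x"
  proof (rule matrix_eqI_inner)
    fix u v
    have "u \<bullet> (transpose (G x) *v v) = gm G x v u"
      by (simp only: transpose_matrix_vector inner_commute[of u] dot_lmul_matrix gm_def)
    then show "u \<bullet> (transpose (G x) *v v) = u \<bullet> (G x *v v)"
      using G_sym[OF x, of v u] by (simp add: gm_def)
  qed
  let ?H = "matrix_inv (G x)"
  have 1: "transpose ?H ** G x = mat 1"
    using arg_cong[OF matrix_inv_right[OF G_invertible[OF x]], of transpose]
    by (simp add: matrix_transpose_mul t transpose_mat)
  have "transpose ?H = transpose ?H ** (G x ** ?H)"
    by (simp add: matrix_inv_right[OF G_invertible[OF x]])
  also have "\<dots> = ?H"
    by (simp add: matrix_mul_assoc 1)
  finally show ?thesis .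
qed

lemma scalar_curvature_coord_trace:
  assumes x: "x \<in> S"
  shows "scalar_curvature_coord G x = trace (matrix_inv (G x) ** bmat (ric G x))"
proof -
  have s: "matrix_inv (G x) $ a $ b = matrix_inv (G x) $ b $ a" for a b
    using arg_cong[OF inv_sym[OF x], of "\<lambda>A. A $ a $ b"] by (simp add: transpose_def)
  have "scalar_curvature_coord G x = (\<Sum>j\<in>UNIV. \<Sum>k\<in>UNIV. matrix_inv (G x) $ k $ j * ric G x (axis j 1) (axis k 1))"
    unfolding scalar_curvature_coord_def using s by (simp add: ricci_ric[OF x])
  also have "\<dots> = (\<Sum>k\<in>UNIV. \<Sum>j\<in>UNIV. matrix_inv (G x) $ k $ j * ric G x (axis j 1) (axis k 1))"
    by (rule sum.swap)
  finally show ?thesis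
    by (simp add: trace_def matrix_matrix_mult_def bmat_def)
qed

lemma gm_ricop:
  assumes x: "x \<in> S"
  shows "gm G x u (ricop G x v) = ric G x u v"
proof -
  have "gm G x u (ricop G x v) = u \<bullet> (bmat (ric G x) *v v)"
    by (simp add: gm_def ricop_def matrix_vector_mul_assoc matrix_mul_assoc matrix_inv_right[OF G_invertible[OF x]])
  then show ?thesis
    by (simp only: bmat_mult[OF linear_ric[OF x]])
qed

lemma scalar_curvature_coord_ricop:
  assumes x: "x \<in> S"
  shows "scalar_curvature_coord G x = ltrace (ricop G x)"
proof -
  have "linear (ricop G x)" "matrix (ricop G x) = matrix_inv (G x) ** bmat (ric G x)"
    unfolding ricop_def matrix_vector_mul_assoc by simp_all
  then show ?thesis
    by (simp add: ltrace_matrix scalar_curvature_coord_trace[OF x])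
qed

lemma smooth_ricop: "smooth_on S (\<lambda>x. ricop G x v)"
  unfolding ricop_def bmat_def matrix_vector_mult_def
  by (simp, intro smooth_intros S smooth_inv smooth_ric)

lemma smooth_scalar_curvature: "smooth_on S (scalar_curvature_coord G)"
proof -
  have "smooth_on S (\<lambda>x. trace (matrix_inv (G x) ** bmat (ric G x)))"
    unfolding trace_def matrix_matrix_mult_def bmat_def
    by (simp, intro smooth_intros S smooth_inv smooth_ric)
  then show ?thesis
    by (subst smooth_on_cong[OF S scalar_curvature_coord_trace])
qed

end

section \<open>Invariance of the scalar curvature under isometries\<close>

lemmas gm_lin = linear_add[OF linear_gm1] linear_add[OF linear_gm2] linear_diff[OF linear_gm1]
  linear_diff[OF linear_gm2] linear_scale[OF linear_gm1] linear_scale[OF linear_gm2]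
lemmas christ_lin = linear_add[OF linear_christ1] linear_add[OF linear_christ2] linear_diff[OF linear_christ1]
  linear_diff[OF linear_christ2] linear_scale[OF linear_christ1] linear_scale[OF linear_christ2]

text \<open>Injectivity of the derivative of \<open>\<psi>\<close> follows from positivity of \<open>G\<close>, so \<open>\<psi>\<close> is a local
  diffeomorphism.\<close>

locale isometric_chart = A: riemannian_chart S G + B: riemannian_chart T H
  for S :: "(real ^ 'n::finite) set" and G and T :: "(real ^ 'n) set" and H +
  fixes \<psi> :: "real ^ 'n \<Rightarrow> real ^ 'n"
  assumes smooth: "smooth_on S \<psi>" and into: "\<psi> ` S \<subseteq> T"
    and isom: "\<And>x u v. x \<in> S \<Longrightarrow> gm G x u v = gm H (\<psi> x) (dd u \<psi> x) (dd v \<psi> x)"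
begin

lemma mapsto: "x \<in> S \<Longrightarrow> \<psi> x \<in> T"
  using into by blast

lemma linear_D: "x \<in> S \<Longrightarrow> linear (\<lambda>u. dd u \<psi> x)"
  by (rule linear_dd[OF smooth_on_differentiable[OF smooth]])

lemma surj_D:
  assumes x: "x \<in> S"
  shows "surj (\<lambda>u. dd u \<psi> x)"
proof (rule linear_injective_imp_surjective[OF linear_D[OF x] _ refl])
  have "u = 0" if "dd u \<psi> x = 0" for u
  proof (rule ccontr)
    assume "u \<noteq> 0"
    then have "gm G x u u > 0" by (rule A.G_pos[OF x])
    then show False using isom[OF x, of u u] that by (simp add: linear_0[OF linear_gm1])
  qed
  then show "inj (\<lambda>u. dd u \<psi> x)"
    by (simp add: linear_injective_0[OF linear_D[OF x]])
qed

lemma dd_pull: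
  assumes "x \<in> S" "smooth_on T F"
  shows "dd u (\<lambda>y. F (\<psi> y)) x = dd (dd u \<psi> x) F (\<psi> x)"
  by (rule dd_compose[OF smooth_on_differentiable[OF smooth assms(1)] smooth_on_differentiable[OF assms(2) mapsto[OF assms(1)]]])

lemma dg_pull:
  assumes x: "x \<in> S"
  shows "dg G x w u v = dg H (\<psi> x) (dd w \<psi> x) (dd u \<psi> x) (dd v \<psi> x)
    + gm H (\<psi> x) (dd w (dd u \<psi>) x) (dd v \<psi> x) + gm H (\<psi> x) (dd u \<psi> x) (dd w (dd v \<psi>) x)"
proof -
  have "dg G x w u v = dd w (\<lambda>y. gm H (\<psi> y) (dd u \<psi> y) (dd v \<psi> y)) x"
    unfolding dg_def by (rule dd_cong[OF A.S x]) (rule isom)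
  also have "\<dots> = dd w (\<lambda>y. gm H (\<psi> y) (dd u \<psi> x) (dd v \<psi> x)) x
    + gm H (\<psi> x) (dd w (dd u \<psi>) x) (dd v \<psi> x) + gm H (\<psi> x) (dd u \<psi> x) (dd w (dd v \<psi>) x)"
    by (rule dd_bilinear_field[where B = "\<lambda>y. gm H (\<psi> y)" and U = "dd u \<psi>" and V = "dd v \<psi>", OF A.S linear_gm1 linear_gm2 smooth_on_compose[OF A.S B.S smooth into B.smooth_gm]
        smooth_on_dd[OF smooth] smooth_on_dd[OF smooth] x])
  also have "dd w (\<lambda>y. gm H (\<psi> y) (dd u \<psi> x) (dd v \<psi> x)) x = dg H (\<psi> x) (dd w \<psi> x) (dd u \<psi> x) (dd v \<psi> x)"
    unfolding dg_def by (rule dd_pull[OF x B.smooth_gm])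
  finally show ?thesis .
qed

text \<open>The Christoffel symbols are not a tensor: differentiating the pullback formula for the metric brings
  in the second derivative of \<open>\<psi>\<close>. Its contributions to the Koszul formula collapse to a single
  term because it is symmetric.\<close>

lemma christ_pull:
  assumes x: "x \<in> S"
  shows "dd (christ G x u v) \<psi> x = christ H (\<psi> x) (dd u \<psi> x) (dd v \<psi> x) + dd u (dd v \<psi>) x"
proof (rule B.gm_nondegenerate[OF mapsto[OF x]])
  fix w'
  obtain w where w: "w' = dd w \<psi> x" by (rule surjE[OF surj_D[OF x]])
  have sy: "dd a (dd b \<psi>) x = dd b (dd a \<psi>) x" for a b
    by (rule dd_commute[OF A.S smooth x])
  have "2 * gm H (\<psi> x) (dd (christ G x u v) \<psi> x) w' = 2 * gm G x (christ G x u v) w"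
    by (simp add: w isom[OF x])
  also have "\<dots> = 2 * gm H (\<psi> x) (christ H (\<psi> x) (dd u \<psi> x) (dd v \<psi> x) + dd u (dd v \<psi>) x) w'"
    using A.koszul[OF x, of u v w] B.koszul[OF mapsto[OF x], of "dd u \<psi> x" "dd v \<psi> x" "dd w \<psi> x"]
      dg_pull[OF x, of u v w] dg_pull[OF x, of v u w] dg_pull[OF x, of w u v]
      sy[of u v] sy[of w u] sy[of w v] B.G_sym[OF mapsto[OF x], of "dd v \<psi> x" "dd u (dd w \<psi>) x"]
      B.G_sym[OF mapsto[OF x], of "dd u \<psi> x" "dd v (dd w \<psi>) x"]
    by (simp add: gm_lin w)
  finally show "gm H (\<psi> x) (dd (christ G x u v) \<psi> x) w'
      = gm H (\<psi> x) (christ H (\<psi> x) (dd u \<psi> x) (dd v \<psi> x) + dd u (dd v \<psi>) x) w'" by simp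
qed

lemma dchrist_pull:
  assumes x: "x \<in> S"
  shows "dd (dchrist G x w u v) \<psi> x =
    dchrist H (\<psi> x) (dd w \<psi> x) (dd u \<psi> x) (dd v \<psi> x)
    + christ H (\<psi> x) (dd w (dd u \<psi>) x) (dd v \<psi> x) + christ H (\<psi> x) (dd u \<psi> x) (dd w (dd v \<psi>) x)
    + dd w (dd u (dd v \<psi>)) x - dd w (dd (christ G x u v) \<psi>) x"
proof -
  note sm = smooth_on_dd[OF smooth]
  have "dd w (\<lambda>y. dd (christ G y u v) \<psi> y) x
      = dd w (\<lambda>y. christ H (\<psi> y) (dd u \<psi> y) (dd v \<psi> y) + dd u (dd v \<psi>) y) x"
    by (rule dd_cong[OF A.S x]) (rule christ_pull)
  also have "\<dots> = dd w (\<lambda>y. christ H (\<psi> y) (dd u \<psi> y) (dd v \<psi> y)) x + dd w (dd u (dd v \<psi>)) x"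
    by (rule dd_add[OF smooth_on_differentiable[OF smooth_on_bilinear_field x] smooth_on_differentiable[OF smooth_on_dd[OF sm] x]])
      (rule A.S linear_christ1 linear_christ2 smooth_on_compose[OF A.S B.S smooth into B.smooth_christ] sm)+
  also have "dd w (\<lambda>y. christ H (\<psi> y) (dd u \<psi> y) (dd v \<psi> y)) x
     = dd w (\<lambda>y. christ H (\<psi> y) (dd u \<psi> x) (dd v \<psi> x)) x
      + christ H (\<psi> x) (dd w (dd u \<psi>) x) (dd v \<psi> x) + christ H (\<psi> x) (dd u \<psi> x) (dd w (dd v \<psi>) x)"
    by (rule dd_bilinear_field[where B = "\<lambda>y. christ H (\<psi> y)" and U = "dd u \<psi>" and V = "dd v \<psi>", OF A.S linear_christ1 linear_christ2 smooth_on_compose[OF A.S B.S smooth into B.smooth_christ]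
        sm sm x])
  also have "dd w (\<lambda>y. christ H (\<psi> y) (dd u \<psi> x) (dd v \<psi> x)) x = dchrist H (\<psi> x) (dd w \<psi> x) (dd u \<psi> x) (dd v \<psi> x)"
    unfolding dchrist_def by (rule dd_pull[OF x B.smooth_christ])
  also have "dd w (\<lambda>y. dd (christ G y u v) \<psi> y) x = dd w (dd (christ G x u v) \<psi>) x + dd (dchrist G x w u v) \<psi> x"
    unfolding dchrist_def
    by (rule dd_linear_field[OF A.S linear_D smooth_on_dd[OF smooth] A.smooth_christ x])
  finally show ?thesis by (simp add: algebra_simps)
qed

text \<open>The second and third derivatives of \<open>\<psi>\<close> cancel by antisymmetry in \<open>u\<close> and \<open>v\<close>.\<close>

lemma riem_pull:
  assumes x: "x \<in> S"
  shows "dd (riem G x u v w) \<psi> x = riem H (\<psi> x) (dd u \<psi> x) (dd v \<psi> x) (dd w \<psi> x)"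
proof -
  have sy: "dd a (dd b \<psi>) x = dd b (dd a \<psi>) x" for a b
    by (rule dd_commute[OF A.S smooth x])
  have sy3: "dd u (dd v (dd w \<psi>)) x = dd v (dd u (dd w \<psi>)) x"
    by (rule dd_commute[OF A.S smooth_on_dd[OF smooth] x])
  have l: "dd (a + b) \<psi> x = dd a \<psi> x + dd b \<psi> x" "dd (a - b) \<psi> x = dd a \<psi> x - dd b \<psi> x" for a b
    by (rule linear_add[OF linear_D[OF x]] linear_diff[OF linear_D[OF x]])+
  show ?thesis
    by (simp add: riem_def l dchrist_pull[OF x] christ_pull[OF x] christ_lin sy[of v u] sy3)
qed

lemma D_inverse:
  assumes x: "x \<in> S"
  obtains Q where "linear Q" "\<And>u. Q (dd u \<psi> x) = u" "\<And>u. dd (Q u) \<psi> x = u"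
proof -
  note lin = linear_D[OF x] and surj = surj_D[OF x]
  obtain Q where Q: "linear Q" "(\<lambda>u. dd u \<psi> x) \<circ> Q = id"
    using linear_surjective_right_inverse[OF lin surj] by blast
  moreover have "inj (\<lambda>u. dd u \<psi> x)"
    by (rule linear_surjective_imp_injective[OF lin surj refl])
  ultimately show ?thesis
    by (intro that[of Q]) (auto simp: fun_eq_iff dest: injD)
qed

lemma ric_pull:
  assumes x: "x \<in> S"
  shows "ric G x v w = ric H (\<psi> x) (dd v \<psi> x) (dd w \<psi> x)"
proof -
  let ?P = "\<lambda>u. dd u \<psi> x"
  obtain Q where Q: "linear Q" "\<And>u. Q (?P u) = u" "\<And>u. ?P (Q u) = u"
    using D_inverse[OF x] by blast
  have "ric G x v w = ltrace (\<lambda>u. Q (riem H (\<psi> x) (?P u) (?P v) (?P w)))"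
    using Q(2) by (simp add: ric_def riem_pull[OF x, symmetric])
  also have "\<dots> = ltrace (\<lambda>u. riem H (\<psi> x) (?P (Q u)) (?P v) (?P w))"
    by (rule ltrace_comp[OF Q(1) linear_compose[OF linear_D[OF x] B.linear_riem(1)[OF mapsto[OF x]], unfolded o_def]])
  finally show ?thesis by (simp add: Q ric_def)
qed

text \<open>Only the nondegenerate pairing of both sides with an arbitrary vector is compared, which reduces the
  claim to the pullback of the Ricci form.\<close>

lemma ricop_pull:
  assumes x: "x \<in> S"
  shows "dd (ricop G x v) \<psi> x = ricop H (\<psi> x) (dd v \<psi> x)"
proof (rule B.gm_nondegenerate[OF mapsto[OF x]])
  fix w'
  obtain w where w: "w' = dd w \<psi> x" by (rule surjE[OF surj_D[OF x]])
  have "gm H (\<psi> x) w' (dd (ricop G x v) \<psi> x) = gm H (\<psi> x) w' (ricop H (\<psi> x) (dd v \<psi> x))"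
    by (simp add: w isom[OF x, symmetric] A.gm_ricop[OF x] B.gm_ricop[OF mapsto[OF x]] ric_pull[OF x])
  then show "gm H (\<psi> x) (dd (ricop G x v) \<psi> x) w' = gm H (\<psi> x) (ricop H (\<psi> x) (dd v \<psi> x)) w'"
    by (simp only: B.G_sym[OF mapsto[OF x]])
qed

lemma scalar_curvature_pull:
  assumes x: "x \<in> S"
  shows "scalar_curvature_coord G x = scalar_curvature_coord H (\<psi> x)"
proof -
  let ?P = "\<lambda>u. dd u \<psi> x"
  obtain Q where Q: "linear Q" "\<And>u. Q (?P u) = u" "\<And>u. ?P (Q u) = u"
    using D_inverse[OF x] by blast
  have "scalar_curvature_coord G x = ltrace (\<lambda>u. Q (ricop H (\<psi> x) (?P u)))"
    using Q(2) by (simp add: A.scalar_curvature_coord_ricop[OF x] ricop_pull[OF x, symmetric] eta_contract_eq)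
  also have "\<dots> = ltrace (\<lambda>u. ricop H (\<psi> x) (?P (Q u)))"
    by (rule ltrace_comp[OF Q(1) linear_compose[OF linear_D[OF x] linear_ricop, unfolded o_def]])
  finally show ?thesis
    by (simp add: Q B.scalar_curvature_coord_ricop[OF mapsto[OF x]] eta_contract_eq)
qed

end

section \<open>The scalar curvature along a conformal vector field\<close>

text \<open>The assumption is \<open>\<L>\<^sub>\<xi> g = 2 f g\<close> evaluated on constant vector fields \<open>u\<close> and \<open>v\<close>, for which
  \<open>[\<xi>, u] = - D\<^sub>u \<xi>\<close>.\<close>

locale conformal_chart = riemannian_chart S G for S :: "(real ^ 'n::finite) set" and G +
  fixes \<xi> :: "real ^ 'n \<Rightarrow> real ^ 'n" and f :: "real ^ 'n \<Rightarrow> real"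
  assumes smooth_xi: "smooth_on S \<xi>" and smooth_f: "smooth_on S f"
    and conformal: "\<And>x u v. x \<in> S \<Longrightarrow>
      dg G x (\<xi> x) u v + gm G x (dd u \<xi> x) v + gm G x u (dd v \<xi> x) = 2 * f x * gm G x u v"
begin

definition grad :: "real ^ 'n \<Rightarrow> real ^ 'n" where
  "grad x = matrix_inv (G x) *v (\<chi> i. dd (axis i 1) f x)"

text \<open>The variation of the Christoffel symbols under the variation \<open>2 f g\<close> of the metric.\<close>

definition cvar :: "real ^ 'n \<Rightarrow> real ^ 'n \<Rightarrow> real ^ 'n \<Rightarrow> real ^ 'n" where
  "cvar x u v = dd u f x *\<^sub>R v + dd v f x *\<^sub>R u - gm G x u v *\<^sub>R grad x"

definition hess :: "real ^ 'n \<Rightarrow> real ^ 'n \<Rightarrow> real ^ 'n \<Rightarrow> real" where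
  "hess x u v = dd u (dd v f) x - dd (christ G x u v) f x"

definition nabla_grad :: "real ^ 'n \<Rightarrow> real ^ 'n \<Rightarrow> real ^ 'n" where
  "nabla_grad x u = dd u grad x + christ G x u (grad x)"

lemma smooth_grad: "smooth_on S grad"
  unfolding grad_def[abs_def] matrix_vector_mult_def
  by (simp, intro smooth_intros S smooth_inv smooth_f)

lemma linear_df: "x \<in> S \<Longrightarrow> linear (\<lambda>u. dd u f x)"
  by (rule linear_dd[OF smooth_on_differentiable[OF smooth_f]])

lemma linear_dxi: "x \<in> S \<Longrightarrow> linear (\<lambda>u. dd u \<xi> x)"
  by (rule linear_dd[OF smooth_on_differentiable[OF smooth_xi]])

lemma gm_grad:
  assumes x: "x \<in> S"
  shows "gm G x (grad x) w = dd w f x"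
proof -
  have "gm G x w (grad x) = w \<bullet> (\<chi> i. dd (axis i 1) f x)"
    by (simp add: gm_def grad_def matrix_vector_mul_assoc matrix_inv_right[OF G_invertible[OF x]])
  also have "\<dots> = dd w f x"
    using linear_expansion[OF linear_df[OF x], of w] by (simp add: inner_vec_def)
  finally show ?thesis by (simp add: G_sym[OF x])
qed

lemma smooth_cvar: "smooth_on S (\<lambda>x. cvar x u v)"
  unfolding cvar_def by (intro smooth_intros S smooth_f smooth_gm smooth_grad)

lemma linear_hess: 
  assumes x: "x \<in> S" shows "linear (\<lambda>u. hess x u v)"
  unfolding hess_def using linear_compose[OF linear_christ1 linear_df[OF x]]
  by (intro linear_compose_sub linear_dd[OF smooth_on_differentiable[OF smooth_on_dd[OF smooth_f] x]])
   (simp add: o_def)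

lemma gm_nabla_grad:
  assumes x: "x \<in> S"
  shows "gm G x (nabla_grad x v) w = hess x v w"
proof -
  have "dd v (\<lambda>y. gm G y (grad y) w) x = dd v (dd w f) x"
    by (rule dd_cong[OF S x]) (rule gm_grad)
  moreover have "dd v (\<lambda>y. gm G y (grad y) w) x = dg G x v (grad x) w + gm G x (dd v grad x) w"
    using dd_gm[OF x smooth_grad smooth_on_const[of S w], of v] by (simp add: linear_0[OF linear_gm2])
  ultimately show ?thesis
    using metric_compatible[OF x, of v "grad x" w] gm_grad[OF x, of "christ G x v w"]
    by (simp add: nabla_grad_def hess_def gm_lin)
qed

text \<open>The conformal equation differentiated in direction \<open>u\<close>, with the derivative along \<open>\<xi>\<close> moved
  outside by the symmetry of second derivatives.\<close>

lemma conformal_deriv: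
  assumes x: "x \<in> S"
  shows "dd (\<xi> x) (\<lambda>y. dg G y u v w) x + dg G x (dd u \<xi> x) v w
     + dg G x u (dd v \<xi> x) w + gm G x (dd u (dd v \<xi>) x) w
     + dg G x u v (dd w \<xi> x) + gm G x v (dd u (dd w \<xi>) x)
   = 2 * (dd u f x * gm G x v w + f x * dg G x u v w)"
proof -
  note sx = smooth_on_dd[OF smooth_xi] and sd = smooth_on_differentiable[OF _ x]
  have s0: "smooth_on S (\<lambda>y. dg G y (\<xi> y) v w)"
    by (rule smooth_on_linear_field[where L = "\<lambda>y z. dg G y z v w", OF S linear_dg(1) smooth_dg smooth_xi])
  have s1: "smooth_on S (\<lambda>y. gm G y (dd v \<xi> y) w)" "smooth_on S (\<lambda>y. gm G y v (dd w \<xi> y))"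
    by (intro smooth_gm_field sx smooth_on_const)+
  have "dd u (\<lambda>y. dg G y (\<xi> y) v w + gm G y (dd v \<xi> y) w + gm G y v (dd w \<xi> y)) x
      = dd u (\<lambda>y. (2 * f y) * gm G y v w) x"
    by (rule dd_cong[OF S x]) (rule conformal)
  moreover have "dd u (\<lambda>y. dg G y (\<xi> y) v w + gm G y (dd v \<xi> y) w + gm G y v (dd w \<xi> y)) x
      = dd u (\<lambda>y. dg G y (\<xi> y) v w) x + dd u (\<lambda>y. gm G y (dd v \<xi> y) w) x + dd u (\<lambda>y. gm G y v (dd w \<xi> y)) x"
    by (subst dd_add, (intro sd smooth_on_add S s0 s1)+, subst dd_add, (intro sd s0 s1)+, rule refl)
  moreover have "dd u (\<lambda>y. dg G y (\<xi> y) v w) x = dd u (\<lambda>y. dg G y (\<xi> x) v w) x + dg G x (dd u \<xi> x) v w"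
    by (rule dd_linear_field[where L = "\<lambda>y z. dg G y z v w", OF S linear_dg(1) smooth_dg smooth_xi x])
  moreover have "dd u (\<lambda>y. dg G y (\<xi> x) v w) x = dd (\<xi> x) (\<lambda>y. dg G y u v w) x"
    using dd_commute[OF S smooth_gm x, of u "\<xi> x" v w] by (simp add: dg_def[abs_def])
  moreover have "dd u (\<lambda>y. gm G y (dd v \<xi> y) w) x = dg G x u (dd v \<xi> x) w + gm G x (dd u (dd v \<xi>) x) w"
    using dd_gm[OF x sx smooth_on_const[of S w]] by (simp add: linear_0[OF linear_gm2])
  moreover have "dd u (\<lambda>y. gm G y v (dd w \<xi> y)) x = dg G x u v (dd w \<xi> x) + gm G x v (dd u (dd w \<xi>) x)"
    using dd_gm[OF x smooth_on_const[of S v] sx] by (simp add: linear_0[OF linear_gm1])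
  moreover have "dd u (\<lambda>y. (2 * f y) * gm G y v w) x = 2 * (dd u f x * gm G x v w + f x * dg G x u v w)"
  proof -
    have "dd u (\<lambda>y. 2 * (f y * gm G y v w)) x = 2 * dd u (\<lambda>y. f y * gm G y v w) x"
      by (rule dd_cmult) (intro sd smooth_on_mult S smooth_f smooth_gm)
    also have "dd u (\<lambda>y. f y * gm G y v w) x = f x * dg G x u v w + dd u f x * gm G x v w"
      unfolding dg_def by (rule dd_mult) (intro sd smooth_f smooth_gm)+
    finally show ?thesis by (simp add: mult.assoc)
  qed
  ultimately show ?thesis by linarith
qed

text \<open>The formula for \<open>\<L>\<^sub>\<xi> \<Gamma>\<close>. The Koszul formula is differentiated along \<open>\<xi>\<close>, and the resulting second
  derivatives of \<open>g\<close> are replaced using the differentiated conformal equation for the three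
  permutations of \<open>u, v, w\<close>.\<close>

lemma lie_christ:
  assumes x: "x \<in> S"
  shows "dchrist G x (\<xi> x) u v = dd (christ G x u v) \<xi> x - christ G x (dd u \<xi> x) v
    - christ G x u (dd v \<xi> x) - dd u (dd v \<xi>) x + cvar x u v"
proof (rule gm_nondegenerate[OF x])
  fix w
  have dk: "2 * (dg G x z (christ G x u v) w + gm G x (dchrist G x z u v) w)
      = dd z (\<lambda>y. dg G y u v w) x + dd z (\<lambda>y. dg G y v u w) x - dd z (\<lambda>y. dg G y w u v) x" for z
  proof -
    note sd = smooth_on_differentiable[OF _ x]
    have "dd z (\<lambda>y. 2 * gm G y (christ G y u v) w) x
        = dd z (\<lambda>y. dg G y u v w + dg G y v u w - dg G y w u v) x"
      by (rule dd_cong[OF S x]) (rule koszul)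
    moreover have "dd z (\<lambda>y. dg G y u v w + dg G y v u w - dg G y w u v) x
      = dd z (\<lambda>y. dg G y u v w) x + dd z (\<lambda>y. dg G y v u w) x - dd z (\<lambda>y. dg G y w u v) x"
      by (subst dd_diff, (intro sd smooth_on_add S smooth_dg)+, subst dd_add, (intro sd smooth_dg)+, rule refl)
    moreover have "dd z (\<lambda>y. 2 * gm G y (christ G y u v) w) x = 2 * dd z (\<lambda>y. gm G y (christ G y u v) w) x"
      by (rule dd_cmult) (intro sd smooth_gm_field smooth_christ smooth_on_const)
    moreover have "dd z (\<lambda>y. gm G y (christ G y u v) w) x = dg G x z (christ G x u v) w + gm G x (dchrist G x z u v) w"
      using dd_gm[OF x smooth_christ smooth_on_const[of S w]] by (simp add: linear_0[OF linear_gm2] dchrist_def)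
    ultimately show ?thesis by simp
  qed
  have sy: "dd a (dd b \<xi>) x = dd b (dd a \<xi>) x" for a b
    by (rule dd_commute[OF S smooth_xi x])
  note g = G_sym[OF x]
  have C: "gm G x (cvar x u v) w = dd u f x * gm G x v w + dd v f x * gm G x u w - gm G x u v * dd w f x"
    by (simp add: cvar_def gm_lin gm_grad[OF x])
  \<comment> \<open>The Koszul formula multiplied by \<open>f\<close>, as the closing step is linear in the listed products.\<close>
  have fK: "f x * (2 * gm G x (christ G x u v) w) = f x * dg G x u v w + f x * dg G x v u w - f x * dg G x w u v"
    unfolding koszul[OF x] by (simp add: algebra_simps)
  show "gm G x (dchrist G x (\<xi> x) u v) w = gm G x (dd (christ G x u v) \<xi> x - christ G x (dd u \<xi> x) v
    - christ G x u (dd v \<xi> x) - dd u (dd v \<xi>) x + cvar x u v) w"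
    using dk[of "\<xi> x"] conformal_deriv[OF x, of u v w] conformal_deriv[OF x, of v u w] conformal_deriv[OF x, of w u v]
      koszul[OF x, of "dd u \<xi> x" v w] koszul[OF x, of u "dd v \<xi> x" w] koszul[OF x, of u v "dd w \<xi> x"]
      conformal[OF x, of "christ G x u v" w] fK
      sy[of v u] sy[of w u] sy[of w v] g[of v "dd u (dd w \<xi>) x"] g[of "dd v (dd w \<xi>) x" u]
      g[of u v] dg_sym[OF x, of w v u] dg_sym[OF x, of _ v "dd u \<xi> x"] dg_sym[OF x, of _ u "dd v \<xi> x"]
    by (simp add: gm_lin C algebra_simps)
qed

text \<open>The previous formula differentiated in direction \<open>u\<close>.\<close>

lemma lie_dchrist:
  assumes x: "x \<in> S"
  shows "dd (\<xi> x) (\<lambda>y. dchrist G y u v w) x =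
    dd u (dd (christ G x v w) \<xi>) x + dd (dchrist G x u v w) \<xi> x - dchrist G x (dd u \<xi> x) v w
    - dchrist G x u (dd v \<xi> x) w - christ G x (dd u (dd v \<xi>) x) w
    - dchrist G x u v (dd w \<xi> x) - christ G x v (dd u (dd w \<xi>) x)
    - dd u (dd v (dd w \<xi>)) x + dd u (\<lambda>y. cvar y v w) x"
proof -
  note sx = smooth_on_dd[OF smooth_xi] and sd = smooth_on_differentiable[OF _ x]
  let ?A = "\<lambda>y. dd (christ G y v w) \<xi> y"
  let ?B = "\<lambda>y. christ G y (dd v \<xi> y) w"
  let ?C = "\<lambda>y. christ G y v (dd w \<xi> y)"
  have s1: "smooth_on S ?A"
    by (rule smooth_on_linear_field[where L = "\<lambda>y z. dd z \<xi> y", OF S linear_dxi sx smooth_christ])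
  have s2: "smooth_on S ?B" and s3: "smooth_on S ?C"
    by (intro smooth_christ_field sx smooth_on_const)+
  have s4: "smooth_on S (dd v (dd w \<xi>))" by (intro smooth_on_dd sx)
  have "dd u (\<lambda>y. dchrist G y (\<xi> y) v w) x
      = dd u (\<lambda>y. ?A y - ?B y - ?C y - dd v (dd w \<xi>) y + cvar y v w) x"
    by (rule dd_cong[OF S x]) (rule lie_christ)
  also have "\<dots> = dd u ?A x - dd u ?B x - dd u ?C x - dd u (dd v (dd w \<xi>)) x + dd u (\<lambda>y. cvar y v w) x"
    by (subst dd_add, (intro sd smooth_on_diff S smooth_cvar s1 s2 s3 s4)+)
      (subst dd_diff, (intro sd smooth_on_diff S s1 s2 s3 s4)+,
       subst dd_diff, (intro sd smooth_on_diff S s1 s2 s3 s4)+,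
       subst dd_diff, (intro sd smooth_on_diff S s1 s2 s3 s4)+, rule refl)
  also have "dd u (\<lambda>y. dchrist G y (\<xi> y) v w) x = dd u (\<lambda>y. dchrist G y (\<xi> x) v w) x + dchrist G x (dd u \<xi> x) v w"
    by (rule dd_linear_field[where L = "\<lambda>y z. dchrist G y z v w", OF S linear_dchrist(1) smooth_dchrist smooth_xi x])
  also have "dd u (\<lambda>y. dchrist G y (\<xi> x) v w) x = dd (\<xi> x) (\<lambda>y. dchrist G y u v w) x"
    using dd_commute[OF S smooth_christ x, of u "\<xi> x" v w] by (simp add: dchrist_def[abs_def])
  also have "dd u ?A x = dd u (dd (christ G x v w) \<xi>) x + dd (dchrist G x u v w) \<xi> x"
    unfolding dchrist_def
    by (rule dd_linear_field[where L = "\<lambda>y z. dd z \<xi> y", OF S linear_dxi sx smooth_christ x])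
  also have "dd u ?B x = dchrist G x u (dd v \<xi> x) w + christ G x (dd u (dd v \<xi>) x) w"
    using dd_christ[OF x sx smooth_on_const[of S w]] by (simp add: linear_0[OF linear_christ2])
  also have "dd u ?C x = dchrist G x u v (dd w \<xi> x) + christ G x v (dd u (dd w \<xi>) x)"
    using dd_christ[OF x smooth_on_const[of S v] sx] by (simp add: linear_0[OF linear_christ1])
  finally show ?thesis by (simp add: algebra_simps)
qed

lemma d_cvar:
  assumes x: "x \<in> S"
  shows "dd u (\<lambda>y. cvar y v w) x = dd u (dd v f) x *\<^sub>R w + dd u (dd w f) x *\<^sub>R v
    - dg G x u v w *\<^sub>R grad x - gm G x v w *\<^sub>R dd u grad x"
proof -
  note sd = smooth_on_differentiable[OF _ x]
  note s = smooth_on_scaleR[OF S smooth_on_dd[OF smooth_f] smooth_on_const] smooth_on_scaleR[OF S smooth_gm smooth_grad]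
  have c: "dd u (\<lambda>y. dd v f y *\<^sub>R w) x = dd u (dd v f) x *\<^sub>R w" for v w
    by (subst dd_scaleR) (simp_all add: sd[OF smooth_on_dd[OF smooth_f]])
  have "dd u (\<lambda>y. cvar y v w) x = dd u (\<lambda>y. dd v f y *\<^sub>R w) x + dd u (\<lambda>y. dd w f y *\<^sub>R v) x
      - dd u (\<lambda>y. gm G y v w *\<^sub>R grad y) x"
    unfolding cvar_def
    by (subst dd_diff, (intro sd smooth_on_add S s)+, subst dd_add, (intro sd s)+, rule refl)
  also have "dd u (\<lambda>y. gm G y v w *\<^sub>R grad y) x = gm G x v w *\<^sub>R dd u grad x + dg G x u v w *\<^sub>R grad x"
    unfolding dg_def by (rule dd_scaleR) (intro sd smooth_gm smooth_grad)+
  finally show ?thesis by (simp add: c algebra_simps)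
qed

text \<open>Substituting the derivatives of the Christoffel symbols into the definition of the curvature, the
  derivatives of \<open>\<xi>\<close> of second and third order cancel, and what remains beyond the tensorial terms is
  the antisymmetrised covariant derivative of \<open>cvar\<close>.\<close>

lemma lie_riem:
  assumes x: "x \<in> S"
  shows "dd (\<xi> x) (\<lambda>y. riem G y u v w) x = dd (riem G x u v w) \<xi> x
    - riem G x (dd u \<xi> x) v w - riem G x u (dd v \<xi> x) w - riem G x u v (dd w \<xi> x)
    + hess x u w *\<^sub>R v - hess x v w *\<^sub>R u - gm G x v w *\<^sub>R nabla_grad x u + gm G x u w *\<^sub>R nabla_grad x v"
proof -
  note sx = smooth_on_dd[OF smooth_xi] and sd = smooth_on_differentiable[OF _ x]
  have dC: "dd z (\<lambda>y. christ G y u (christ G y v w)) x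
      = dchrist G x z u (christ G x v w) + christ G x u (dchrist G x z v w)" for z u v w
    using dd_christ[OF x smooth_on_const[of S u] smooth_christ]
    by (simp add: linear_0[OF linear_christ1] dchrist_def)
  have "dd z (\<lambda>y. riem G y u v w) x = dd z (\<lambda>y. dchrist G y u v w) x - dd z (\<lambda>y. dchrist G y v u w) x
      + dd z (\<lambda>y. christ G y u (christ G y v w)) x - dd z (\<lambda>y. christ G y v (christ G y u w)) x" for z
    unfolding riem_def
    by (subst dd_diff, (intro sd smooth_on_add smooth_on_diff S smooth_dchrist smooth_christ_field smooth_on_const smooth_christ)+,
       subst dd_add, (intro sd smooth_on_diff S smooth_dchrist smooth_christ_field smooth_on_const smooth_christ)+,
       subst dd_diff, (intro sd smooth_dchrist)+, rule refl)
  note 1 = this[of "\<xi> x", unfolded dC lie_dchrist[OF x] lie_christ[OF x] d_cvar[OF x]]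
  have l: "dd (a + b) \<xi> x = dd a \<xi> x + dd b \<xi> x" "dd (a - b) \<xi> x = dd a \<xi> x - dd b \<xi> x" for a b
    by (rule linear_add[OF linear_dxi[OF x]] linear_diff[OF linear_dxi[OF x]])+
  have sy: "dd a (dd b \<xi>) x = dd b (dd a \<xi>) x" "dd a (dd b f) x = dd b (dd a f) x" for a b
    by (rule dd_commute[OF S smooth_xi x] dd_commute[OF S smooth_f x])+
  have sy3: "dd u (dd v (dd w \<xi>)) x = dd v (dd u (dd w \<xi>)) x"
    by (rule dd_commute[OF S sx x])
  have m: "dg G x u v w = gm G x (christ G x u v) w + gm G x v (christ G x u w)"
    "dg G x v u w = gm G x (christ G x u v) w + gm G x u (christ G x v w)"
    using metric_compatible[OF x] christ_sym[OF x] by simp_all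
  show ?thesis
    unfolding 1
    by (simp add: riem_def l christ_lin cvar_def hess_def nabla_grad_def m sy3 christ_sym[OF x, of v u] sy(1)[of v u] sy(2)[of v u]
        algebra_simps)
qed

lemma lie_ric:
  assumes x: "x \<in> S"
  shows "dd (\<xi> x) (\<lambda>y. ric G y v w) x = - ric G x (dd v \<xi> x) w - ric G x v (dd w \<xi> x)
    + (2 - real CARD('n)) * hess x v w - gm G x v w * ltrace (nabla_grad x)"
proof -
  have "dd (\<xi> x) (\<lambda>y. ric G y v w) x = ltrace (\<lambda>u. dd (\<xi> x) (\<lambda>y. riem G y u v w) x)"
    unfolding ric_def ltrace_def
    by (subst dd_sum) (auto simp: dd_nth[OF smooth_on_differentiable[OF smooth_riem x]]
        intro!: smooth_on_differentiable[OF smooth_on_nth[OF S smooth_riem] x])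
  also have "\<dots> = ltrace (\<lambda>u. dd (riem G x u v w) \<xi> x)
    - ltrace (\<lambda>u. riem G x (dd u \<xi> x) v w) - ric G x (dd v \<xi> x) w - ric G x v (dd w \<xi> x)
    + ltrace (\<lambda>u. hess x u w *\<^sub>R v) - hess x v w * real CARD('n)
    - gm G x v w * ltrace (nabla_grad x) + ltrace (\<lambda>u. gm G x u w *\<^sub>R nabla_grad x v)"
    by (simp only: lie_riem[OF x] ltrace_add ltrace_diff ltrace_scale ltrace_id ric_def)
  also have "ltrace (\<lambda>u. dd (riem G x u v w) \<xi> x) = ltrace (\<lambda>u. riem G x (dd u \<xi> x) v w)"
    by (rule ltrace_comp[OF linear_dxi[OF x] linear_riem(1)[OF x]])
  also have "ltrace (\<lambda>u. hess x u w *\<^sub>R v) = hess x v w"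
    by (rule ltrace_rank1[OF linear_hess[OF x]])
  also have "ltrace (\<lambda>u. gm G x u w *\<^sub>R nabla_grad x v) = hess x v w"
    by (simp add: ltrace_rank1[OF linear_gm1] gm_nabla_grad[OF x])
  finally show ?thesis by (simp add: algebra_simps)
qed

text \<open>Raising an index costs \<open>- 2 f\<close> times the Ricci operator, because the inverse metric varies by
  \<open>- 2 f\<close> times itself. The first two terms on the right form a commutator and disappear in the
  trace.\<close>

lemma lie_ricop:
  assumes x: "x \<in> S"
  shows "dd (\<xi> x) (\<lambda>y. ricop G y v) x = dd (ricop G x v) \<xi> x - ricop G x (dd v \<xi> x)
    + (2 - real CARD('n)) *\<^sub>R nabla_grad x v - ltrace (nabla_grad x) *\<^sub>R v - (2 * f x) *\<^sub>R ricop G x v"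
proof (rule gm_nondegenerate[OF x])
  fix u
  have h: "gm G x u (nabla_grad x v) = hess x u v"
  proof -
    have "gm G x u (nabla_grad x v) = hess x v u"
      by (simp add: G_sym[OF x, of u] gm_nabla_grad[OF x])
    then show ?thesis
      using dd_commute[OF S smooth_f x, of u v] christ_sym[OF x, of u v] by (simp add: hess_def)
  qed
  have "dd (\<xi> x) (\<lambda>y. gm G y u (ricop G y v)) x = dd (\<xi> x) (\<lambda>y. ric G y u v) x"
    by (rule dd_cong[OF S x]) (rule gm_ricop)
  moreover have "dd (\<xi> x) (\<lambda>y. gm G y u (ricop G y v)) x
      = dg G x (\<xi> x) u (ricop G x v) + gm G x u (dd (\<xi> x) (\<lambda>y. ricop G y v) x)"
    using dd_gm[OF x smooth_on_const[of S u] smooth_ricop] by (simp add: linear_0[OF linear_gm1])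
  ultimately have "gm G x u (dd (\<xi> x) (\<lambda>y. ricop G y v) x) = gm G x u (dd (ricop G x v) \<xi> x - ricop G x (dd v \<xi> x)
    + (2 - real CARD('n)) *\<^sub>R nabla_grad x v - ltrace (nabla_grad x) *\<^sub>R v - (2 * f x) *\<^sub>R ricop G x v)"
    using conformal[OF x, of u "ricop G x v"]
    unfolding lie_ric[OF x] gm_lin gm_ricop[OF x] h by (simp add: algebra_simps)
  then show "gm G x (dd (\<xi> x) (\<lambda>y. ricop G y v) x) u = gm G x (dd (ricop G x v) \<xi> x - ricop G x (dd v \<xi> x)
    + (2 - real CARD('n)) *\<^sub>R nabla_grad x v - ltrace (nabla_grad x) *\<^sub>R v - (2 * f x) *\<^sub>R ricop G x v) u"
    by (simp only: G_sym[OF x, of _ u])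
qed

text \<open>The formula \<open>\<xi>(R) = - 2 f R - 2 (n - 1) \<Delta>f\<close>, where the trace of \<open>X \<mapsto> \<nabla>\<^sub>X grad f\<close> is \<open>\<Delta>f\<close>.\<close>

lemma lie_scalar_curvature:
  assumes x: "x \<in> S"
  shows "dd (\<xi> x) (scalar_curvature_coord G) x
    = - 2 * f x * scalar_curvature_coord G x - 2 * (real CARD('n) - 1) * ltrace (nabla_grad x)"
proof -
  have "dd (\<xi> x) (scalar_curvature_coord G) x = dd (\<xi> x) (\<lambda>y. ltrace (ricop G y)) x"
    by (rule dd_cong[OF S x]) (rule scalar_curvature_coord_ricop)
  also have "\<dots> = ltrace (\<lambda>v. dd (\<xi> x) (\<lambda>y. ricop G y v) x)"
    unfolding ltrace_def
    by (subst dd_sum) (auto simp: dd_nth[OF smooth_on_differentiable[OF smooth_ricop x]]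
        intro!: smooth_on_differentiable[OF smooth_on_nth[OF S smooth_ricop] x])
  also have "\<dots> = ltrace (\<lambda>v. dd (ricop G x v) \<xi> x) - ltrace (\<lambda>v. ricop G x (dd v \<xi> x))
      + (2 - real CARD('n)) * ltrace (nabla_grad x) - ltrace (nabla_grad x) * real CARD('n)
      - (2 * f x) * ltrace (ricop G x)"
    by (simp only: lie_ricop[OF x] ltrace_add ltrace_diff ltrace_scale ltrace_id)
  also have "ltrace (\<lambda>v. dd (ricop G x v) \<xi> x) = ltrace (\<lambda>v. ricop G x (dd v \<xi> x))"
    by (rule ltrace_comp[OF linear_dxi[OF x] linear_ricop])
  finally show ?thesis
    by (simp add: scalar_curvature_coord_ricop[OF x] algebra_simps)
qed

end

section \<open>Conformal fields annihilating their associated operator\<close>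

text \<open>Along the segment from \<open>p\<close> to \<open>y\<close> the product of \<open>E\<close> with a decaying exponential is nonincreasing,
  and it starts at zero.\<close>

lemma vanishing_by_gronwall:
  fixes E :: "'a::real_normed_vector \<Rightarrow> real"
  assumes diff: "\<And>y. y \<in> ball p r \<Longrightarrow> E differentiable (at y)"
    and nonneg: "\<And>y. y \<in> ball p r \<Longrightarrow> E y \<ge> 0"
    and bound: "\<And>y u. y \<in> ball p r \<Longrightarrow> dd u E y \<le> K * norm u * E y"
    and p: "E p = 0" and y: "y \<in> ball p r"
  shows "E y = 0"
proof -
  define u where "u = y - p"
  define h where "h s = E (p + s *\<^sub>R u) * exp (- K * norm u * s)" for s
  have inb: "p + s *\<^sub>R u \<in> ball p r" if "0 \<le> s" "s \<le> 1" for s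
  proof -
    have "dist p (p + s *\<^sub>R u) = s * norm u" using that by (simp add: dist_norm)
    also have "\<dots> \<le> norm u" using that by (simp add: mult_left_le_one_le)
    also have "\<dots> < r" using y by (simp add: u_def dist_norm norm_minus_commute)
    finally show ?thesis by simp
  qed
  have "h 1 \<le> h 0"
  proof (rule DERIV_nonpos_imp_nonincreasing[of 0 1 h])
    fix s :: real assume s: "0 \<le> s" "s \<le> 1"
    let ?d = "(dd u E (p + s *\<^sub>R u) - K * norm u * E (p + s *\<^sub>R u)) * exp (- K * norm u * s)"
    have "(h has_real_derivative ?d) (at s)"
      unfolding h_def
      by (rule derivative_eq_intros dd_along_segment diff inb s refl)+ (simp add: algebra_simps)
    moreover have "?d \<le> 0"
      using bound[OF inb[OF s], of u] by (intro mult_nonpos_nonneg) auto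
    ultimately show "\<exists>d. (h has_real_derivative d) (at s) \<and> d \<le> 0" by blast
  qed simp
  then have "E y * exp (- K * norm u) \<le> 0"
    by (simp add: h_def p u_def)
  then have "E y \<le> 0"
    by (simp add: mult_le_0_iff)
  with nonneg[OF y] show ?thesis by simp
qed

context conformal_chart
begin

definition eta :: "real ^ 'n \<Rightarrow> real ^ 'n \<Rightarrow> real" where
  "eta x v = gm G x v (\<xi> x)"

definition deta :: "real ^ 'n \<Rightarrow> real ^ 'n \<Rightarrow> real ^ 'n \<Rightarrow> real" where
  "deta x u v = dd u (\<lambda>y. eta y v) x - dd v (\<lambda>y. eta y u) x"

definition sqn :: "real ^ 'n \<Rightarrow> real" where
  "sqn x = gm G x (\<xi> x) (\<xi> x)"

lemma sqn_eta: "sqn x = eta x (\<xi> x)"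
  by (simp add: sqn_def eta_def)

lemma smooth_eta: "smooth_on S (\<lambda>x. eta x v)"
  unfolding eta_def by (intro smooth_gm_field smooth_on_const smooth_xi)

lemma smooth_sqn: "smooth_on S sqn"
  unfolding sqn_def[abs_def] by (intro smooth_gm_field smooth_xi)

lemma smooth_deta: "smooth_on S (\<lambda>x. deta x u v)"
  unfolding deta_def by (intro smooth_on_diff S smooth_on_dd[OF smooth_eta])

lemma linear_eta: "linear (eta x)"
  unfolding eta_def[abs_def] by (rule linear_gm1)

lemma dd_eta:
  assumes x: "x \<in> S"
  shows "dd u (\<lambda>y. eta y v) x = dg G x u v (\<xi> x) + gm G x v (dd u \<xi> x)"
  unfolding eta_def using dd_gm[OF x smooth_on_const[of S v] smooth_xi] by (simp add: linear_0[OF linear_gm1])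

lemma sqn_pos_iff:
  assumes x: "x \<in> S"
  shows "sqn x > 0 \<longleftrightarrow> \<xi> x \<noteq> 0"
  using G_pos[OF x, of "\<xi> x"] by (auto simp: sqn_def linear_0[OF linear_gm1])

end

locale annihilating_chart = conformal_chart S G \<xi> f for S :: "(real ^ 'n::finite) set" and G \<xi> f +
  assumes annihilates: "\<And>x v. x \<in> S \<Longrightarrow> deta x (\<xi> x) v = 0"
begin

text \<open>Contracting \<open>d\<eta>\<close> with \<open>\<xi>\<close> expresses \<open>\<eta>(D\<^sub>u \<xi>)\<close> by terms that occur in the conformal equation for
  \<open>u\<close> and \<open>\<xi>\<close>; adding the two relations gives \<open>d|\<xi>|\<^sup>2 = 2 f \<eta>\<close>.\<close>

lemma dd_sqn:
  assumes x: "x \<in> S"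
  shows "dd u sqn x = 2 * (f x * eta x u)"
proof -
  have "dd u sqn x = dg G x u (\<xi> x) (\<xi> x) + gm G x (dd u \<xi> x) (\<xi> x) + gm G x (\<xi> x) (dd u \<xi> x)"
    unfolding sqn_def[abs_def] by (rule dd_gm[OF x smooth_xi smooth_xi])
  then show ?thesis
    using annihilates[OF x, of u] conformal[OF x, of u "\<xi> x"] G_sym[OF x, of "\<xi> x" "dd u \<xi> x"]
    unfolding deta_def dd_eta[OF x] by (simp add: eta_def)
qed

text \<open>This is \<open>d(f \<eta>) = 0\<close>, the symmetry of the second derivative of \<open>|\<xi>|\<^sup>2\<close>.\<close>

lemma df_wedge_eta:
  assumes x: "x \<in> S"
  shows "dd u f x * eta x v - dd v f x * eta x u + f x * deta x u v = 0"
proof -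
  note sd = smooth_on_differentiable[OF _ x]
  have "dd u (dd v sqn) x = 2 * (f x * dd u (\<lambda>y. eta y v) x + dd u f x * eta x v)" for u v
  proof -
    have "dd u (dd v sqn) x = dd u (\<lambda>y. 2 * (f y * eta y v)) x"
      by (rule dd_cong[OF S x]) (rule dd_sqn)
    also have "\<dots> = 2 * dd u (\<lambda>y. f y * eta y v) x"
      by (rule dd_cmult) (intro sd smooth_on_mult S smooth_f smooth_eta)
    also have "dd u (\<lambda>y. f y * eta y v) x = f x * dd u (\<lambda>y. eta y v) x + dd u f x * eta x v"
      by (rule dd_mult) (intro sd smooth_f smooth_eta)+
    finally show ?thesis .
  qed
  from this[of u v] this[of v u] dd_commute[OF S smooth_sqn x, of u v]
  show ?thesis by (simp add: deta_def algebra_simps)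
qed

lemma df_eta:
  assumes x: "x \<in> S"
  shows "dd v f x * sqn x = dd (\<xi> x) f x * eta x v"
  using df_wedge_eta[OF x, of "\<xi> x" v] annihilates[OF x, of v] by (simp add: sqn_eta)

lemma f_deta:
  assumes x: "x \<in> S" and pos: "sqn x > 0"
  shows "f x * deta x u v = 0"
proof -
  have "sqn x * (dd u f x * eta x v - dd v f x * eta x u) = 0"
  proof -
    have "sqn x * (dd u f x * eta x v - dd v f x * eta x u)
        = (dd u f x * sqn x) * eta x v - (dd v f x * sqn x) * eta x u"
      by (simp add: algebra_simps)
    then show ?thesis unfolding df_eta[OF x] by simp
  qed
  with pos df_wedge_eta[OF x, of u v] show ?thesis by simp
qed

text \<open>Only meant where \<open>\<xi> \<noteq> 0\<close>: there \<open>df = \<mu> \<eta>\<close> and \<open>d\<mu> = \<nu> \<eta>\<close>.\<close>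

definition mu :: "real ^ 'n \<Rightarrow> real" where
  "mu x = dd (\<xi> x) f x / sqn x"

definition nu :: "real ^ 'n \<Rightarrow> real" where
  "nu x = dd (\<xi> x) mu x / sqn x"

definition nonvanishing where "nonvanishing = {x \<in> S. sqn x > 0}"

lemma nonvanishing_subset: "nonvanishing \<subseteq> S" and nonvanishing_S: "x \<in> nonvanishing \<Longrightarrow> x \<in> S" and nonvanishing_pos: "x \<in> nonvanishing \<Longrightarrow> sqn x > 0"
  by (auto simp: nonvanishing_def)

lemma open_nonvanishing: "open nonvanishing"
proof -
  have "nonvanishing = S \<inter> sqn -` {0<..}" by (auto simp: nonvanishing_def)
  then show ?thesis
    using continuous_open_preimage[OF smooth_on_continuous[OF smooth_sqn] S open_greaterThan] by simp
qed

lemma smooth_mu: "smooth_on nonvanishing mu"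
proof -
  have "smooth_on S (\<lambda>x. dd (\<xi> x) f x)"
    by (rule smooth_on_linear_field[where L = "\<lambda>y z. dd z f y", OF S linear_df smooth_on_dd[OF smooth_f] smooth_xi])
  then show ?thesis
    unfolding mu_def[abs_def]
    by (intro smooth_on_divide open_nonvanishing smooth_on_subset[OF _ nonvanishing_subset] smooth_sqn) (auto simp: nonvanishing_def)
qed

lemma df_mu:
  assumes "x \<in> nonvanishing"
  shows "dd v f x = mu x * eta x v"
  using df_eta[OF nonvanishing_S[OF assms], of v] nonvanishing_pos[OF assms] by (simp add: mu_def field_simps)

text \<open>Where \<open>f = 0\<close>, this is the derivative of \<open>f d\<eta> = 0\<close> along \<open>\<xi>\<close>, divided by \<open>|\<xi>|\<^sup>2\<close>.\<close>

lemma mu_deta: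
  assumes x: "x \<in> nonvanishing"
  shows "mu x * deta x u v = 0"
proof (cases "f x = 0")
  case False
  then show ?thesis using f_deta[OF nonvanishing_S[OF x] nonvanishing_pos[OF x], of u v] by simp
next
  case True
  note sd = smooth_on_differentiable[OF _ nonvanishing_S[OF x]]
  have "dd (\<xi> x) (\<lambda>y. f y * deta y u v) x = dd (\<xi> x) (\<lambda>y. 0) x"
    by (rule dd_cong[OF open_nonvanishing x]) (rule f_deta[OF nonvanishing_S nonvanishing_pos])
  moreover have "dd (\<xi> x) (\<lambda>y. f y * deta y u v) x
      = f x * dd (\<xi> x) (\<lambda>y. deta y u v) x + dd (\<xi> x) f x * deta x u v"
    by (rule dd_mult) (intro sd smooth_f smooth_deta)+
  ultimately show ?thesis using True by (simp add: mu_def)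
qed

lemma ddf_mu:
  assumes x: "x \<in> nonvanishing"
  shows "dd u (dd v f) x = mu x * dd u (\<lambda>y. eta y v) x + dd u mu x * eta x v"
proof -
  have "dd u (dd v f) x = dd u (\<lambda>y. mu y * eta y v) x"
    by (rule dd_cong[OF open_nonvanishing x]) (rule df_mu)
  also have "\<dots> = mu x * dd u (\<lambda>y. eta y v) x + dd u mu x * eta x v"
    by (rule dd_mult[OF smooth_on_differentiable[OF smooth_mu x] smooth_on_differentiable[OF smooth_eta nonvanishing_S[OF x]]])
  finally show ?thesis .
qed

lemma dmu_nu:
  assumes x: "x \<in> nonvanishing"
  shows "dd v mu x = nu x * eta x v"
proof -
  have "dd u mu x * eta x v = dd v mu x * eta x u" for u v
    using ddf_mu[OF x, of u v] ddf_mu[OF x, of v u] dd_commute[OF S smooth_f nonvanishing_S[OF x], of u v]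
      mu_deta[OF x, of u v, unfolded deta_def right_diff_distrib]
    by linarith
  from this[of "\<xi> x" v] nonvanishing_pos[OF x] show ?thesis
    by (simp add: nu_def sqn_eta field_simps)
qed

text \<open>Differentiating \<open>grad f = \<mu> \<xi>\<close> covariantly leaves \<open>\<mu> \<nabla>\<^sub>u \<xi> = \<mu> f u + \<mu> \<phi> u\<close>, and \<open>\<mu> \<phi> = 0\<close> by
  \<open>mu_deta\<close>.\<close>

lemma nabla_grad_eq:
  assumes x: "x \<in> nonvanishing"
  shows "nabla_grad x u = (nu x * eta x u) *\<^sub>R \<xi> x + (mu x * f x) *\<^sub>R u"
proof (rule gm_nondegenerate[OF nonvanishing_S[OF x]])
  fix v
  note xS = nonvanishing_S[OF x]
  note g = G_sym[OF xS]
  define A where "A u = dd u \<xi> x + christ G x u (\<xi> x)" for u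
  have e: "dd u (\<lambda>y. eta y v) x = eta x (christ G x u v) + gm G x v (A u)" for u v
    unfolding dd_eta[OF xS] using metric_compatible[OF xS, of u v "\<xi> x"] by (simp add: eta_def A_def gm_lin)
  have "gm G x v (A u) + gm G x u (A v) = 2 * f x * gm G x u v"
    using conformal[OF xS, of u v] metric_compatible[OF xS, of "\<xi> x" u v] christ_sym[OF xS, of "\<xi> x"]
      g[of "A u" v]
    by (simp add: A_def gm_lin g[of "dd u \<xi> x" v] g[of "christ G x u (\<xi> x)" v])
  then have "mu x * gm G x v (A u) + mu x * gm G x u (A v) = 2 * (mu x * f x * gm G x u v)"
    by (simp add: distrib_left[symmetric])
  moreover have "mu x * gm G x v (A u) - mu x * gm G x u (A v) = 0"
    using mu_deta[OF x, of u v] e[of u v] e[of v u] christ_sym[OF xS, of u v]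
    by (simp add: deta_def right_diff_distrib)
  ultimately have m: "mu x * gm G x v (A u) = mu x * f x * gm G x u v" by linarith
  have "gm G x (nabla_grad x u) v = dd u (dd v f) x - dd (christ G x u v) f x"
    by (simp add: gm_nabla_grad[OF xS] hess_def)
  also have "\<dots> = mu x * f x * gm G x u v + nu x * eta x u * eta x v"
    unfolding ddf_mu[OF x] dmu_nu[OF x] df_mu[OF x] e using m by (simp add: distrib_left)
  finally show "gm G x (nabla_grad x u) v = gm G x ((nu x * eta x u) *\<^sub>R \<xi> x + (mu x * f x) *\<^sub>R u) v"
    by (simp add: gm_lin eta_def g[of "\<xi> x" v])
qed

lemma laplacian_eq:
  assumes x: "x \<in> nonvanishing"
  shows "ltrace (nabla_grad x) = nu x * sqn x + real CARD('n) * (mu x * f x)"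
proof -
  have "ltrace (nabla_grad x) = nu x * ltrace (\<lambda>u. eta x u *\<^sub>R \<xi> x) + (mu x * f x) * ltrace (\<lambda>u :: real ^ 'n. u)"
    by (simp only: ltrace_add[symmetric] ltrace_scale[symmetric] nabla_grad_eq[OF x, abs_def] scaleR_scaleR)
  then show ?thesis
    by (simp add: ltrace_rank1[OF linear_eta] ltrace_id sqn_eta)
qed

text \<open>If \<open>\<xi>\<close> vanished on the whole neighbourhood where \<open>d\<eta> \<noteq> 0\<close>, then so would \<open>\<eta>\<close> and \<open>d\<eta>\<close>.\<close>

lemma not_closed_point:
  assumes x: "x \<in> S" and ne: "deta x u v \<noteq> 0"
  obtains y where "y \<in> nonvanishing" "deta y u v \<noteq> 0"
proof -
  define N where "N = S \<inter> (\<lambda>y. deta y u v) -` (- {0})"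
  have N: "open N" "x \<in> N" "N \<subseteq> S"
    unfolding N_def using x ne continuous_open_preimage[OF smooth_on_continuous[OF smooth_deta] S]
    by (auto simp: open_Compl)
  have "\<exists>y\<in>N. \<xi> y \<noteq> 0"
  proof (rule ccontr)
    assume "\<not> (\<exists>y\<in>N. \<xi> y \<noteq> 0)"
    then have "eta y w = 0" if "y \<in> N" for y w
      using that by (simp add: eta_def linear_0[OF linear_gm2])
    then have "dd w (\<lambda>y. eta y w') x = 0" for w w'
      using dd_cong[OF N(1,2), of "\<lambda>y. eta y w'" "\<lambda>y. 0" w] by simp
    then show False using ne by (simp add: deta_def)
  qed
  then obtain y where "y \<in> N" "\<xi> y \<noteq> 0" by blast
  then show ?thesis
    using N(3) sqn_pos_iff[of y] by (intro that[of y]) (auto simp: nonvanishing_def N_def)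
qed

text \<open>In dimension one every vector is a multiple of \<open>\<xi>\<close>, which \<open>d\<eta>\<close> annihilates.\<close>

lemma dimension_ge_2:
  assumes x: "x \<in> nonvanishing" and ne: "deta x u v \<noteq> 0"
  shows "CARD('n) \<ge> 2"
proof (rule ccontr)
  assume "\<not> CARD('n) \<ge> 2"
  then have "CARD('n) = 1" by (metis One_nat_def Suc_1 Suc_leI le_antisym not_less_eq_eq zero_less_card_finite)
  then obtain i :: 'n where i: "UNIV = {i}" by (metis card_1_singletonE)
  then have all: "j = i" for j by (metis UNIV_I singletonD)
  note xS = nonvanishing_S[OF x]
  have "\<xi> x \<noteq> 0" using sqn_pos_iff[OF xS] nonvanishing_pos[OF x] by simp
  then have "\<xi> x $ i \<noteq> 0" by (metis all vec_eq_iff zero_index)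
  then have u: "u = (u $ i / \<xi> x $ i) *\<^sub>R \<xi> x"
    by (intro vec_eq_iff[THEN iffD2] allI) (subst (1 2) all, simp)
  have "linear (\<lambda>u. deta x u v)"
    unfolding deta_def
    by (intro linear_compose_sub linear_dd[OF smooth_on_differentiable[OF smooth_eta xS]]
        linear_dd_field[OF S linear_eta smooth_eta xS])
  from linear_scale[OF this, of "u $ i / \<xi> x $ i" "\<xi> x"] annihilates[OF xS, of v] ne u
  show False by simp
qed

end

section \<open>Unique continuation for the soliton function\<close>

locale yamabe_chart =
  annihilating_chart S G \<xi> "\<lambda>x. scalar_curvature_coord G x - lam"
  for S :: "(real ^ 'n::finite) set" and G \<xi> and lam :: real
begin

abbreviation f where "f x \<equiv> scalar_curvature_coord G x - lam"

text \<open>The formula for \<open>\<xi>(R)\<close> solved for \<open>\<nu>\<close>. The coefficients of \<open>\<mu>\<close> and \<open>f\<close> are continuous where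
  \<open>\<xi> \<noteq> 0\<close>; dividing by \<open>n - 1\<close> is where dimension one is excluded.\<close>

lemma nu_linear:
  assumes x: "x \<in> nonvanishing" and n: "CARD('n) \<ge> 2"
  shows "nu x = (- (sqn x + 2 * (real CARD('n) - 1) * real CARD('n) * f x) / (2 * (real CARD('n) - 1) * sqn x)) * mu x
    + (- (f x + lam) / ((real CARD('n) - 1) * sqn x)) * f x"
proof -
  have pos: "sqn x > 0" "real CARD('n) - 1 > 0" using nonvanishing_pos[OF x] n by auto
  have "dd (\<xi> x) f x = dd (\<xi> x) (scalar_curvature_coord G) x"
    by (subst dd_diff[OF smooth_on_differentiable[OF smooth_scalar_curvature nonvanishing_S[OF x]]]) simp_all
  then have "mu x * sqn x = - 2 * f x * (f x + lam)
     - 2 * (real CARD('n) - 1) * (nu x * sqn x + real CARD('n) * (mu x * f x))"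
    using lie_scalar_curvature[OF nonvanishing_S[OF x]] df_mu[OF x, of "\<xi> x"] laplacian_eq[OF x] by (simp add: sqn_eta)
  then have "nu x * (2 * (real CARD('n) - 1) * sqn x)
      = - (sqn x + 2 * (real CARD('n) - 1) * real CARD('n) * f x) * mu x - 2 * (f x + lam) * f x"
    by (simp add: algebra_simps)
  then have "nu x = (- (sqn x + 2 * (real CARD('n) - 1) * real CARD('n) * f x) * mu x - 2 * (f x + lam) * f x)
      / (2 * (real CARD('n) - 1) * sqn x)"
    using pos by (simp only: eq_divide_eq) simp
  also have "\<dots> = (- (sqn x + 2 * (real CARD('n) - 1) * real CARD('n) * f x)) * mu x / (2 * ((real CARD('n) - 1) * sqn x))
     - (f x + lam) * f x / ((real CARD('n) - 1) * sqn x)"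
    by (simp only: diff_divide_distrib mult.assoc mult_divide_mult_cancel_left_if) simp
  finally show ?thesis by (simp add: mult.assoc)
qed

text \<open>By \<open>df = \<mu> \<eta>\<close>, \<open>d\<mu> = \<nu> \<eta>\<close> and the previous lemma, the derivative of \<open>f\<^sup>2 + \<mu>\<^sup>2\<close> is bounded by a
  multiple of \<open>f\<^sup>2 + \<mu>\<^sup>2\<close> on a compact ball, so that Gronwall applies.\<close>

lemma f_vanishes_locally:
  assumes p: "p \<in> nonvanishing" and fp: "f p = 0" and dfp: "dd (\<xi> p) f p = 0" and n: "CARD('n) \<ge> 2"
  obtains r where "r > 0" "ball p r \<subseteq> nonvanishing" "\<And>y. y \<in> ball p r \<Longrightarrow> f y = 0"
proof -
  obtain r where r: "r > 0" "cball p r \<subseteq> nonvanishing"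
    using open_nonvanishing p open_contains_cball by blast
  define al where "al x = - (sqn x + 2 * (real CARD('n) - 1) * real CARD('n) * f x) / (2 * (real CARD('n) - 1) * sqn x)" for x
  define be where "be x = - (f x + lam) / ((real CARD('n) - 1) * sqn x)" for x
  define et where "et x = G x *v \<xi> x" for x
  note sc = smooth_on_continuous[OF smooth_on_subset[OF _ nonvanishing_subset]]
  have cont: "continuous_on nonvanishing al" "continuous_on nonvanishing be" "continuous_on nonvanishing et"
  proof -
    have 0: "continuous_on nonvanishing sqn" "continuous_on nonvanishing f"
      by (rule sc smooth_sqn smooth_f)+
    have "real CARD('n) - 1 > 0" using n by simp
    then have "sqn x \<noteq> 0" "2 * (real CARD('n) - 1) * sqn x \<noteq> 0" "(real CARD('n) - 1) * sqn x \<noteq> 0" if "x \<in> nonvanishing" for x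
      using nonvanishing_pos[OF that] by auto
    then show "continuous_on nonvanishing al" "continuous_on nonvanishing be"
      unfolding al_def be_def by (intro continuous_intros 0, blast)+
    have "smooth_on S et"
      unfolding et_def[abs_def] matrix_vector_mult_def by (intro smooth_intros S smooth_G smooth_xi)
    then show "continuous_on nonvanishing et" by (rule sc)
  qed
  have bdd: "\<exists>B>0. \<forall>y\<in>cball p r. norm (h y) \<le> B" if "continuous_on nonvanishing h" for h :: "real ^ 'n \<Rightarrow> 'b::real_normed_vector"
    using compact_imp_bounded[OF compact_continuous_image[OF continuous_on_subset[OF that r(2)] compact_cball]]
    unfolding bounded_pos by auto
  obtain B1 where B1: "\<And>y. y \<in> cball p r \<Longrightarrow> norm (al y) \<le> B1" "B1 > 0" using bdd[OF cont(1)] by blast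
  obtain B2 where B2: "\<And>y. y \<in> cball p r \<Longrightarrow> norm (be y) \<le> B2" "B2 > 0" using bdd[OF cont(2)] by blast
  obtain B3 where B3: "\<And>y. y \<in> cball p r \<Longrightarrow> norm (et y) \<le> B3" "B3 > 0" using bdd[OF cont(3)] by blast
  define E where "E y = f y * f y + mu y * mu y" for y
  have in_nonvanishing: "y \<in> nonvanishing" and inc: "y \<in> cball p r" if "y \<in> ball p r" for y
    using that r(2) by (auto intro: less_imp_le)
  have "E y = 0" if "y \<in> ball p r" for y
  proof (rule vanishing_by_gronwall[OF _ _ _ _ that])
    fix y assume y: "y \<in> ball p r"
    note y_nonvanishing = in_nonvanishing[OF y]
    note df = smooth_on_differentiable[OF smooth_f nonvanishing_S[OF y_nonvanishing]] and dm = smooth_on_differentiable[OF smooth_mu y_nonvanishing]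
    have dE: "E differentiable (at y)"
      unfolding E_def[abs_def] by (intro differentiable_add differentiable_mult df dm)
    show "E differentiable (at y)" by (rule dE)
    show "E y \<ge> 0" by (simp add: E_def)
    fix u
    have 1: "dd u E y = 2 * (f y * mu y + mu y * nu y) * eta y u"
      unfolding E_def[abs_def]
      by (subst dd_add, (intro differentiable_mult df dm)+, subst dd_mult, (intro df dm)+, subst dd_mult, (intro df dm)+)
        (simp add: df_mu[OF y_nonvanishing] dmu_nu[OF y_nonvanishing] algebra_simps)
    have 2: "\<bar>2 * (f y * mu y + mu y * nu y)\<bar> \<le> (1 + 2 * B1 + B2) * E y"
    proof -
      have nu: "nu y = al y * mu y + be y * f y"
        using nu_linear[OF y_nonvanishing n] by (simp add: al_def be_def)
      \<comment> \<open>By \<open>2|ab| \<le> a\<^sup>2 + b\<^sup>2\<close>, each term of the derivative is at most a constant times \<open>E\<close>.\<close>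
      have fm: "2 * \<bar>f y * mu y\<bar> \<le> E y"
        using sum_squares_bound[of "\<bar>f y\<bar>" "\<bar>mu y\<bar>"] by (simp add: E_def abs_mult power2_eq_square mult.assoc)
      have mm: "\<bar>mu y * mu y\<bar> \<le> E y" by (simp add: E_def)
      have eq: "2 * (f y * mu y + mu y * nu y) = 2 * (f y * mu y) + 2 * al y * (mu y * mu y) + be y * (2 * (f y * mu y))"
        unfolding nu by (simp only: algebra_simps)
      have "\<bar>2 * (f y * mu y) + 2 * al y * (mu y * mu y) + be y * (2 * (f y * mu y))\<bar> \<le> \<bar>2 * (f y * mu y)\<bar> + \<bar>2 * al y * (mu y * mu y)\<bar> + \<bar>be y * (2 * (f y * mu y))\<bar>"
        by linarith
      also have "\<dots> \<le> E y + 2 * B1 * E y + B2 * E y"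
      proof (intro add_mono)
        show "\<bar>2 * (f y * mu y)\<bar> \<le> E y" using fm by (simp add: abs_mult)
        have "\<bar>al y\<bar> * \<bar>mu y * mu y\<bar> \<le> B1 * E y"
          using B1 inc[OF y] mm by (intro mult_mono) auto
        then show "\<bar>2 * al y * (mu y * mu y)\<bar> \<le> 2 * B1 * E y" by (simp add: abs_mult)
        have "\<bar>be y\<bar> * (2 * \<bar>f y * mu y\<bar>) \<le> B2 * E y"
          using B2 inc[OF y] fm by (intro mult_mono) auto
        then show "\<bar>be y * (2 * (f y * mu y))\<bar> \<le> B2 * E y" by (simp add: abs_mult)
      qed
      finally show ?thesis unfolding eq by (simp only: distrib_right mult_1_left)
    qed
    have 3: "\<bar>eta y u\<bar> \<le> norm u * B3"
    proof -
      have "\<bar>eta y u\<bar> \<le> norm u * norm (et y)"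
        unfolding eta_def gm_def et_def by (rule Cauchy_Schwarz_ineq2)
      also have "\<dots> \<le> norm u * B3" using B3 inc[OF y] by (intro mult_left_mono) auto
      finally show ?thesis .
    qed
    have "dd u E y \<le> \<bar>2 * (f y * mu y + mu y * nu y)\<bar> * \<bar>eta y u\<bar>"
      unfolding 1 abs_mult[symmetric] by (rule abs_ge_self)
    also have "\<dots> \<le> ((1 + 2 * B1 + B2) * E y) * (norm u * B3)"
      by (rule mult_mono[OF 2 3]) (use B1(2) B2(2) in \<open>simp_all add: E_def\<close>)
    finally show "dd u E y \<le> ((1 + 2 * B1 + B2) * B3) * norm u * E y"
      by (simp only: ac_simps)
  next
    have "mu p = 0" using dfp by (simp add: mu_def)
    then show "E p = 0" using fp by (simp add: E_def)
  qed
  then have "f y = 0" if "y \<in> ball p r" for y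
    using that sum_squares_eq_zero_iff[of "f y" "mu y"] unfolding E_def by blast
  moreover have "ball p r \<subseteq> nonvanishing" using r(2) ball_subset_cball by blast
  ultimately show ?thesis using that r(1) by blast
qed

lemma sqn_constant_where_f_vanishes:
  assumes "ball p r \<subseteq> S" "\<And>y. y \<in> ball p r \<Longrightarrow> f y = 0" "y \<in> ball p r"
  shows "sqn y = sqn p"
proof -
  have "r > 0" using assms(3) by (metis ball_eq_empty empty_iff not_le)
  have "((sqn) has_derivative (\<lambda>h. 0)) (at z within ball p r)" if "z \<in> ball p r" for z
  proof -
    have z: "z \<in> S" using that assms(1) by blast
    have "(sqn has_derivative (\<lambda>u. dd u sqn z)) (at z)"
      by (rule has_derivative_dd[OF smooth_on_differentiable[OF smooth_sqn z]])
    then show ?thesis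
      using dd_sqn[OF z] assms(2)[OF that] by (simp add: has_derivative_at_withinI)
  qed
  from has_derivative_zero_constant[OF convex_ball this]
  obtain c where "\<And>z. z \<in> ball p r \<Longrightarrow> sqn z = c" by blast
  with assms(3) \<open>r > 0\<close> show ?thesis by simp
qed

end

section \<open>Charts and tangent vectors of a manifold\<close>

lemma riemannian_chart_subset:
  "riemannian_chart S G \<Longrightarrow> open T \<Longrightarrow> T \<subseteq> S \<Longrightarrow> riemannian_chart T G"
  unfolding riemannian_chart_def using smooth_on_subset by blast

abbreviation transition :: "('a, 'n::finite) chart \<Rightarrow> ('a, 'n) chart \<Rightarrow> real ^ 'n \<Rightarrow> real ^ 'n" where
  "transition c d \<equiv> snd d \<circ> chart_inv c"

abbreviation coord_field :: "('a, 'n::finite) charted_space \<Rightarrow> ('a, 'n) chart \<Rightarrow> real ^ 'n \<Rightarrow> ('a, 'n) vfield" where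
  "coord_field M c u \<equiv> \<lambda>q. coord_tvec M c q u"

abbreviation chart_vfield :: "('a, 'n::finite) vfield \<Rightarrow> ('a, 'n) chart \<Rightarrow> real ^ 'n \<Rightarrow> real ^ 'n" where
  "chart_vfield X c \<equiv> \<lambda>x. X (chart_inv c x) c"

locale manifold =
  fixes M :: "('a, 'n::finite) charted_space"
  assumes M: "smooth_manifold M"
begin

lemma chart:
  assumes "c \<in> Atlas M"
  shows openin_chart: "openin (Top M) (fst c)"
    and homeo_chart: "homeomorphic_map (subtopology (Top M) (fst c)) (top_of_set (snd c ` fst c)) (snd c)"
    and open_chart: "open (snd c ` fst c)"
  using M assms unfolding smooth_manifold_def by blast+

lemma inj_chart: "c \<in> Atlas M \<Longrightarrow> inj_on (snd c) (fst c)"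
  using homeomorphic_imp_injective_map[OF homeo_chart] openin_subset[OF openin_chart]
  by (simp add: Int_absorb1)

lemma chart_inv_snd [simp]: "c \<in> Atlas M \<Longrightarrow> p \<in> fst c \<Longrightarrow> chart_inv c (snd c p) = p"
  by (rule inv_into_f_f[OF inj_chart])

lemma snd_chart_inv: "x \<in> snd c ` fst c \<Longrightarrow> snd c (chart_inv c x) = x"
  by (rule f_inv_into_f)

lemma open_chart_image:
  assumes c: "c \<in> Atlas M" and W: "openin (Top M) W"
  shows "open (snd c ` (W \<inter> fst c))"
proof -
  have "openin (subtopology (Top M) (fst c)) (W \<inter> fst c)"
    using W by (rule openin_subtopology_Int)
  then have "openin (top_of_set (snd c ` fst c)) (snd c ` (W \<inter> fst c))"
    using homeomorphic_imp_open_map[OF homeo_chart[OF c]] unfolding open_map_def by blast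
  then show ?thesis using open_chart[OF c] openin_open_trans by blast
qed

lemma openin_chart_preimage:
  assumes c: "c \<in> Atlas M" and V: "open V" "V \<subseteq> snd c ` fst c"
  shows "openin (Top M) (chart_inv c ` V)"
proof -
  have cont: "continuous_map (subtopology (Top M) (fst c)) (top_of_set (snd c ` fst c)) (snd c)"
    by (rule homeomorphic_imp_continuous_map[OF homeo_chart[OF c]])
  have "openin (top_of_set (snd c ` fst c)) V" using V by (simp add: openin_open_eq open_chart[OF c])
  from openin_continuous_map_preimage[OF cont this]
  have "openin (subtopology (Top M) (fst c)) {p \<in> fst c. snd c p \<in> V}"
    using openin_subset[OF openin_chart[OF c]] by (simp add: Int_absorb1)
  moreover have "{p \<in> fst c. snd c p \<in> V} = chart_inv c ` V"
  proof
    show "{p \<in> fst c. snd c p \<in> V} \<subseteq> chart_inv c ` V"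
      using chart_inv_snd[OF c] by (metis (mono_tags, lifting) imageI mem_Collect_eq subsetI)
    show "chart_inv c ` V \<subseteq> {p \<in> fst c. snd c p \<in> V}"
      using V(2) by (auto simp: f_inv_into_f inv_into_into dest: subsetD)
  qed
  ultimately show ?thesis using openin_trans_full[OF _ openin_chart[OF c]] by simp
qed

lemma point_chart:
  assumes "p \<in> points M"
  obtains c where "c \<in> charts_at M p"
proof -
  have "p \<in> (\<Union>c\<in>Atlas M. fst c)" using M assms unfolding smooth_manifold_def by blast
  then show ?thesis using that by (auto simp: charts_at_def)
qed

lemma charts_atD: "c \<in> charts_at M p \<Longrightarrow> c \<in> Atlas M" "c \<in> charts_at M p \<Longrightarrow> p \<in> fst c"
  by (auto simp: charts_at_def)

lemma charts_at_points: "c \<in> charts_at M p \<Longrightarrow> p \<in> points M"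
  using openin_subset[OF openin_chart[OF charts_atD(1)]] charts_atD(2) by blast

lemma smooth_transition:
  "c \<in> Atlas M \<Longrightarrow> d \<in> Atlas M \<Longrightarrow> smooth_on (snd c ` (fst c \<inter> fst d)) (transition c d)"
  using M unfolding smooth_manifold_def by blast

lemma open_overlap: "c \<in> Atlas M \<Longrightarrow> d \<in> Atlas M \<Longrightarrow> open (snd c ` (fst c \<inter> fst d))"
  using open_chart_image[of c "fst d"] openin_chart[of d] by (simp add: Int_commute)

lemma transition_differentiable:
  assumes "c \<in> charts_at M p" "d \<in> charts_at M p"
  shows "transition c d differentiable (at (snd c p))"
  using assms by (intro smooth_on_differentiable[OF smooth_transition]) (auto simp: charts_at_def)

lemma transition_snd [simp]: "c \<in> Atlas M \<Longrightarrow> p \<in> fst c \<Longrightarrow> transition c d (snd c p) = snd d p"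
  by simp

text \<open>Functions on \<open>M\<close> are differentiated in one chart and transferred to another by the chain rule. With
  \<open>f\<close> a coordinate map this is the cocycle property of the Jacobians.\<close>

lemma coord_transfer:
  fixes f :: "'a \<Rightarrow> 'b::real_normed_vector"
  assumes c: "c \<in> charts_at M p" and d: "d \<in> charts_at M p"
    and f: "(\<lambda>x. f (chart_inv d x)) differentiable (at (snd d p))"
  shows "dd u (\<lambda>x. f (chart_inv c x)) (snd c p)
    = dd (dd u (transition c d) (snd c p)) (\<lambda>x. f (chart_inv d x)) (snd d p)"
proof -
  note cA = charts_atD[OF c] and dA = charts_atD[OF d]
  have "dd u (\<lambda>x. f (chart_inv c x)) (snd c p) = dd u (\<lambda>x. f (chart_inv d (transition c d x))) (snd c p)"
    by (rule dd_cong[OF open_overlap[OF cA(1) dA(1)]]) (use cA dA in auto)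
  also have "\<dots> = dd (dd u (transition c d) (snd c p)) (\<lambda>x. f (chart_inv d x)) (transition c d (snd c p))"
    by (rule dd_compose[OF transition_differentiable[OF c d]]) (use f cA in simp)
  finally show ?thesis using cA by simp
qed

lemma transition_chain:
  assumes c: "c \<in> charts_at M p" and d: "d \<in> charts_at M p" and e: "e \<in> charts_at M p"
  shows "dd (dd u (transition c d) (snd c p)) (transition d e) (snd d p) = dd u (transition c e) (snd c p)"
proof -
  have "(\<lambda>x. snd e (chart_inv d x)) differentiable (at (snd d p))"
    using transition_differentiable[OF d e] by (simp add: comp_def)
  from coord_transfer[OF c d this, of u] show ?thesis
    by (simp only: comp_def)
qed

lemma transition_self:
  assumes c: "c \<in> charts_at M p"
  shows "dd u (transition c c) (snd c p) = u"
proof -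
  note cA = charts_atD[OF c]
  have "dd u (transition c c) (snd c p) = dd u (\<lambda>x. x) (snd c p)"
    by (rule dd_cong[OF open_chart[OF cA(1)]]) (use cA in \<open>auto simp: snd_chart_inv\<close>)
  then show ?thesis by simp
qed

lemma tangent_transition:
  assumes "v \<in> tangent_space M p" "c \<in> charts_at M p" "d \<in> charts_at M p"
  shows "v d = dd (v c) (transition c d) (snd c p)"
  using assms unfolding tangent_space_def dd_def by blast

lemma tangent_spaceI:
  assumes "\<And>c. c \<notin> charts_at M p \<Longrightarrow> v c = 0"
    and "\<And>c d. c \<in> charts_at M p \<Longrightarrow> d \<in> charts_at M p \<Longrightarrow> v d = dd (v c) (transition c d) (snd c p)"
  shows "v \<in> tangent_space M p"
  using assms unfolding tangent_space_def dd_def by blast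

lemma coord_tvec_dd:
  "d \<in> charts_at M p \<Longrightarrow> coord_tvec M c p w d = dd w (transition c d) (snd c p)"
  by (simp add: coord_tvec_def dd_def)

lemma coord_tvec_self: "c \<in> charts_at M p \<Longrightarrow> coord_tvec M c p w c = w"
  by (simp add: coord_tvec_dd transition_self)

lemma coord_tvec_tangent:
  assumes c: "c \<in> charts_at M p"
  shows "coord_tvec M c p w \<in> tangent_space M p"
proof (rule tangent_spaceI)
  show "coord_tvec M c p w e = dd (coord_tvec M c p w d) (transition d e) (snd d p)"
    if "d \<in> charts_at M p" "e \<in> charts_at M p" for d e
    by (simp only: coord_tvec_dd[OF that(1)] coord_tvec_dd[OF that(2)] transition_chain[OF c that])
qed (simp add: coord_tvec_def)

lemma tangent_coord_tvec:
  assumes v: "v \<in> tangent_space M p" and c: "c \<in> charts_at M p"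
  shows "v = coord_tvec M c p (v c)"
proof
  fix d
  show "v d = coord_tvec M c p (v c) d"
  proof (cases "d \<in> charts_at M p")
    case True
    then show ?thesis by (simp only: coord_tvec_dd tangent_transition[OF v c True])
  next
    case False
    moreover from v False have "v d = 0" unfolding tangent_space_def by blast
    ultimately show ?thesis by (simp add: coord_tvec_def)
  qed
qed

lemma coord_tvec_lincomb:
  assumes c: "c \<in> charts_at M p"
  shows "coord_tvec M c p (a *\<^sub>R u + b *\<^sub>R v) = lincomb a (coord_tvec M c p u) b (coord_tvec M c p v)"
proof
  fix d
  show "coord_tvec M c p (a *\<^sub>R u + b *\<^sub>R v) d = lincomb a (coord_tvec M c p u) b (coord_tvec M c p v) d"
  proof (cases "d \<in> charts_at M p")
    case True
    note l = linear_dd[OF transition_differentiable[OF c True]]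
    show ?thesis using True by (simp only: lincomb_def coord_tvec_dd linear_add[OF l] linear_scale[OF l])
  next
    case False
    then show ?thesis by (simp add: lincomb_def coord_tvec_def)
  qed
qed

lemma deriv_along_chart:
  assumes c: "c \<in> charts_at M p" and X: "X p \<in> tangent_space M p"
    and f: "(\<lambda>x. f (chart_inv c x)) differentiable (at (snd c p))"
  shows "deriv_along M X f p = dd (X p c) (\<lambda>x. f (chart_inv c x)) (snd c p)"
proof -
  let ?d = "chart_at M p"
  have d: "?d \<in> charts_at M p" unfolding chart_at_def by (rule someI) (rule c)
  have "deriv_along M X f p = dd (X p ?d) (\<lambda>x. f (chart_inv ?d x)) (snd ?d p)"
    by (simp add: deriv_along_def Let_def dd_def o_def)
  also have "\<dots> = dd (dd (X p ?d) (transition ?d c) (snd ?d p)) (\<lambda>x. f (chart_inv c x)) (snd c p)"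
    by (rule coord_transfer[OF d c f])
  finally show ?thesis by (simp only: tangent_transition[OF X d c])
qed

text \<open>The coordinate fields of a chart are the fields on which the tensor identities of a soliton are
  tested; in the chart itself they are constant.\<close>

lemma smooth_coord_field:
  assumes c: "c \<in> Atlas M"
  shows "smooth_vfield M (fst c) (coord_field M c u)"
  unfolding smooth_vfield_def
proof (intro conjI ballI)
  fix p assume "p \<in> fst c"
  then show "coord_tvec M c p u \<in> tangent_space M p"
    using c by (intro coord_tvec_tangent) (simp add: charts_at_def)
next
  fix d assume d: "d \<in> Atlas M"
  have o: "open (snd d ` (fst c \<inter> fst d))" "open (snd c ` (fst c \<inter> fst d))"
    using open_overlap[OF c d] open_overlap[OF d c] by (simp_all add: Int_commute)
  have "smooth_on (snd d ` (fst c \<inter> fst d)) (\<lambda>x. dd u (transition c d) (transition d c x))"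
  proof (rule smooth_on_compose[where p = "transition d c" and f = "dd u (transition c d)", OF o])
    show "smooth_on (snd d ` (fst c \<inter> fst d)) (transition d c)"
      using smooth_transition[OF d c] by (simp add: Int_commute)
    show "smooth_on (snd c ` (fst c \<inter> fst d)) (dd u (transition c d))"
      by (rule smooth_on_dd[OF smooth_transition[OF c d]])
    show "transition d c ` snd d ` (fst c \<inter> fst d) \<subseteq> snd c ` (fst c \<inter> fst d)"
      using d by auto
  qed
  then show "smooth_on (snd d ` (fst c \<inter> fst d)) (\<lambda>x. coord_tvec M c (chart_inv d x) u d)"
    by (rule smooth_on_cong[OF o(1), THEN iffD1, rotated])
      (use c d in \<open>auto simp: coord_tvec_dd charts_at_def\<close>)
qed

lemma vfield_chart:
  assumes X: "smooth_vfield M W X" and c: "c \<in> charts_at M p" and p: "p \<in> W" and W: "openin (Top M) W"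
  shows "smooth_on (snd c ` (W \<inter> fst c)) (chart_vfield X c)" "open (snd c ` (W \<inter> fst c))"
    "snd c p \<in> snd c ` (W \<inter> fst c)" "X p \<in> tangent_space M p"
  using X p charts_atD[OF c] open_chart_image[OF _ W] unfolding smooth_vfield_def by auto

lemma lie_bracket_dd:
  assumes c: "c \<in> charts_at M p"
  shows "lie_bracket M X Y p c = dd (X p c) (chart_vfield Y c) (snd c p) - dd (Y p c) (chart_vfield X c) (snd c p)"
  using c by (simp add: lie_bracket_def dd_def)

lemma vfield_transition_derivative:
  assumes W: "openin (Top M) W" and Y: "smooth_vfield M W Y" and p: "p \<in> W"
    and c: "c \<in> charts_at M p" and d: "d \<in> charts_at M p"
  shows "dd (dd u (transition c d) (snd c p)) (chart_vfield Y d) (snd d p)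
    = dd u (dd (Y p c) (transition c d)) (snd c p) + dd (dd u (chart_vfield Y c) (snd c p)) (transition c d) (snd c p)"
proof -
  note cA = charts_atD[OF c] and dA = charts_atD[OF d]
  note Yc = vfield_chart[OF Y c p W] and Yd = vfield_chart[OF Y d p W]
  let ?N = "snd c ` (W \<inter> fst c) \<inter> snd c ` (fst c \<inter> fst d)"
  have N: "open ?N" "snd c p \<in> ?N"
    using Yc(2) open_overlap[OF cA(1) dA(1)] p cA dA by auto
  have "dd (dd u (transition c d) (snd c p)) (chart_vfield Y d) (snd d p)
      = dd u (\<lambda>x. Y (chart_inv c x) d) (snd c p)"
    by (rule coord_transfer[OF c d smooth_on_differentiable[OF Yd(1,3)], symmetric])
  also have "\<dots> = dd u (\<lambda>x. dd (chart_vfield Y c x) (transition c d) x) (snd c p)"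
  proof (rule dd_cong[OF N])
    fix x assume "x \<in> ?N"
    then obtain q where q: "x = snd c q" "q \<in> W" "q \<in> fst c" "q \<in> fst d"
      using inj_onD[OF inj_chart[OF cA(1)]] by blast
    then have qc: "c \<in> charts_at M q" "d \<in> charts_at M q" using cA dA by (auto simp: charts_at_def)
    have "Y q \<in> tangent_space M q" using Y q(2) by (simp add: smooth_vfield_def)
    from tangent_transition[OF this qc] show "Y (chart_inv c x) d = dd (chart_vfield Y c x) (transition c d) x"
      using q cA by simp
  qed
  also have "\<dots> = dd u (dd (chart_vfield Y c (snd c p)) (transition c d)) (snd c p)
     + dd (dd u (chart_vfield Y c) (snd c p)) (transition c d) (snd c p)"
  proof (rule dd_linear_field[where L = "\<lambda>y z. dd z (transition c d) y" and S = ?N])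
    show "linear (\<lambda>z. dd z (transition c d) x)" if "x \<in> ?N" for x
      using that by (intro linear_dd smooth_on_differentiable[OF smooth_transition[OF cA(1) dA(1)]]) blast
    show "smooth_on ?N (dd w (transition c d))" for w
      by (rule smooth_on_subset[OF smooth_on_dd[OF smooth_transition[OF cA(1) dA(1)]]]) blast
    show "smooth_on ?N (chart_vfield Y c)"
      by (rule smooth_on_subset[OF Yc(1)]) blast
  qed (use N in auto)
  finally show ?thesis using cA by simp
qed

text \<open>The second derivatives of the change of charts in the two halves of the bracket agree by symmetry and
  cancel.\<close>

lemma lie_bracket_tangent:
  assumes W: "openin (Top M) W" and X: "smooth_vfield M W X" and Y: "smooth_vfield M W Y" and p: "p \<in> W"
  shows "lie_bracket M X Y p \<in> tangent_space M p"
proof (rule tangent_spaceI)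
  show "lie_bracket M X Y p d = dd (lie_bracket M X Y p c) (transition c d) (snd c p)"
    if c: "c \<in> charts_at M p" and d: "d \<in> charts_at M p" for c d
  proof -
    note cA = charts_atD[OF c] and dA = charts_atD[OF d]
    have Xt: "X p \<in> tangent_space M p" and Yt: "Y p \<in> tangent_space M p"
      using X Y p by (simp_all add: smooth_vfield_def)
    have "lie_bracket M X Y p d
      = dd (dd (X p c) (transition c d) (snd c p)) (chart_vfield Y d) (snd d p)
        - dd (dd (Y p c) (transition c d) (snd c p)) (chart_vfield X d) (snd d p)"
      by (simp only: lie_bracket_dd[OF d] tangent_transition[OF Xt c d] tangent_transition[OF Yt c d])
    also have "\<dots> = dd (dd (X p c) (chart_vfield Y c) (snd c p)) (transition c d) (snd c p)
        - dd (dd (Y p c) (chart_vfield X c) (snd c p)) (transition c d) (snd c p)"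
      using vfield_transition_derivative[OF W Y p c d, of "X p c"] vfield_transition_derivative[OF W X p c d, of "Y p c"]
        dd_commute[OF open_overlap[OF cA(1) dA(1)] smooth_transition[OF cA(1) dA(1)], of "snd c p" "X p c" "Y p c"] cA dA
      by simp
    also have "\<dots> = dd (lie_bracket M X Y p c) (transition c d) (snd c p)"
      by (simp only: lie_bracket_dd[OF c] linear_diff[OF linear_dd[OF transition_differentiable[OF c d]]])
    finally show ?thesis .
  qed
qed (simp add: lie_bracket_def)

end

locale riemannian_manifold = manifold M for M :: "('a, 'n::finite) charted_space" +
  fixes g :: "('a, 'n) metric"
  assumes g: "riemannian_metric M g"
begin

lemma g_coord_linear:
  assumes c: "c \<in> charts_at M p"
  shows "linear (\<lambda>a. g p (coord_tvec M c p a) (coord_tvec M c p b))"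
    and "linear (\<lambda>b. g p (coord_tvec M c p a) (coord_tvec M c p b))"
proof -
  note t = coord_tvec_tangent[OF c] and pM = charts_at_points[OF c]
  have lin: "g p (coord_tvec M c p (r *\<^sub>R a + s *\<^sub>R a')) (coord_tvec M c p b)
    = r * g p (coord_tvec M c p a) (coord_tvec M c p b) + s * g p (coord_tvec M c p a') (coord_tvec M c p b)" for r s a a' b
    using g pM t unfolding riemannian_metric_def coord_tvec_lincomb[OF c] by blast
  have sym: "g p (coord_tvec M c p a) (coord_tvec M c p b) = g p (coord_tvec M c p b) (coord_tvec M c p a)" for a b
    using g pM t unfolding riemannian_metric_def by blast
  show l: "linear (\<lambda>a. g p (coord_tvec M c p a) (coord_tvec M c p b))" for b
    using lin[of 1 _ 1] lin[of _ _ 0] by (intro linearI) simp_all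
  show "linear (\<lambda>b. g p (coord_tvec M c p a) (coord_tvec M c p b))"
    by (subst sym) (rule l)
qed

lemma gm_metric_matrix:
  assumes c: "c \<in> charts_at M p"
  shows "gm (metric_matrix M g c) (snd c p) a b = g p (coord_tvec M c p a) (coord_tvec M c p b)"
proof -
  have "metric_matrix M g c (snd c p) = bmat (\<lambda>a b. g p (coord_tvec M c p a) (coord_tvec M c p b))"
    using charts_atD[OF c] by (simp add: metric_matrix_def bmat_def Let_def)
  then show ?thesis
    unfolding gm_def by (simp only: bmat_mult[OF g_coord_linear[OF c]])
qed

lemma g_chart:
  assumes c: "c \<in> charts_at M p" and "u \<in> tangent_space M p" "v \<in> tangent_space M p"
  shows "g p u v = gm (metric_matrix M g c) (snd c p) (u c) (v c)"
  using tangent_coord_tvec[OF assms(2) c] tangent_coord_tvec[OF assms(3) c] by (simp only: gm_metric_matrix[OF c])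

lemma riemannian_chart_metric:
  assumes c: "c \<in> Atlas M"
  shows "riemannian_chart (snd c ` fst c) (metric_matrix M g c)"
proof
  show "open (snd c ` fst c)" by (rule open_chart[OF c])
  show "smooth_on (snd c ` fst c) (metric_matrix M g c)"
    using g c unfolding riemannian_metric_def by blast
  fix x u v assume "x \<in> snd c ` fst c"
  then obtain p where p: "x = snd c p" "c \<in> charts_at M p" using c by (auto simp: charts_at_def)
  note t = coord_tvec_tangent[OF p(2)] and pM = charts_at_points[OF p(2)]
  show "gm (metric_matrix M g c) x u v = gm (metric_matrix M g c) x v u"
    unfolding p(1) gm_metric_matrix[OF p(2)] using g pM t unfolding riemannian_metric_def by blast
  assume "u \<noteq> 0"
  then have "coord_tvec M c p u c \<noteq> 0" by (simp add: coord_tvec_self[OF p(2)])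
  then have "coord_tvec M c p u \<noteq> zero_tvec" by (auto simp: zero_tvec_def)
  then show "gm (metric_matrix M g c) x u u > 0"
    unfolding p(1) gm_metric_matrix[OF p(2)] using g pM t unfolding riemannian_metric_def by blast
qed

text \<open>On overlaps, changes of charts are isometries between the two coordinate expressions of \<open>g\<close>.\<close>

lemma scalar_curvature_chart:
  assumes d: "d \<in> charts_at M p"
  shows "scalar_curvature M g p = scalar_curvature_coord (metric_matrix M g d) (snd d p)"
proof -
  let ?c = "chart_at M p"
  have c: "?c \<in> charts_at M p" unfolding chart_at_def by (rule someI) (rule d)
  note cA = charts_atD[OF c] and dA = charts_atD[OF d]
  interpret isometric_chart "snd ?c ` (fst ?c \<inter> fst d)" "metric_matrix M g ?c"
    "snd d ` (fst d \<inter> fst ?c)" "metric_matrix M g d" "transition ?c d"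
  proof (intro isometric_chart.intro isometric_chart_axioms.intro)
    show "riemannian_chart (snd ?c ` (fst ?c \<inter> fst d)) (metric_matrix M g ?c)"
      by (rule riemannian_chart_subset[OF riemannian_chart_metric open_overlap]) (use cA dA in auto)
    show "riemannian_chart (snd d ` (fst d \<inter> fst ?c)) (metric_matrix M g d)"
      by (rule riemannian_chart_subset[OF riemannian_chart_metric open_overlap]) (use cA dA in auto)
    show "smooth_on (snd ?c ` (fst ?c \<inter> fst d)) (transition ?c d)"
      by (rule smooth_transition[OF cA(1) dA(1)])
    show "transition ?c d ` snd ?c ` (fst ?c \<inter> fst d) \<subseteq> snd d ` (fst d \<inter> fst ?c)"
      using cA by auto
    fix x u v assume "x \<in> snd ?c ` (fst ?c \<inter> fst d)"
    then obtain q where q: "x = snd ?c q" "q \<in> fst ?c" "q \<in> fst d" by blast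
    have qc: "?c \<in> charts_at M q" "d \<in> charts_at M q" using q cA dA by (auto simp: charts_at_def)
    have "gm (metric_matrix M g ?c) (snd ?c q) u v
        = gm (metric_matrix M g d) (snd d q) (coord_tvec M ?c q u d) (coord_tvec M ?c q v d)"
      by (simp only: gm_metric_matrix[OF qc(1)] g_chart[OF qc(2) coord_tvec_tangent[OF qc(1)] coord_tvec_tangent[OF qc(1)]])
    then show "gm (metric_matrix M g ?c) x u v
        = gm (metric_matrix M g d) (transition ?c d x) (dd u (transition ?c d) x) (dd v (transition ?c d) x)"
      using q cA(1) by (simp only: coord_tvec_dd[OF qc(2)] transition_snd)
  qed
  have "scalar_curvature_coord (metric_matrix M g ?c) (snd ?c p)
      = scalar_curvature_coord (metric_matrix M g d) (transition ?c d (snd ?c p))"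
    by (rule scalar_curvature_pull) (use cA dA in auto)
  then show ?thesis using cA by (simp add: scalar_curvature_def Let_def)
qed

end

section \<open>Solitons whose field annihilates its operator\<close>

locale annihilating_soliton =
  fixes M :: "('a, 'n::finite) charted_space"
    and g :: "('a, 'n) metric"
    and \<xi> :: "('a, 'n) vfield"
    and lam :: real
    and \<phi> :: "'a \<Rightarrow> ('a, 'n) tvec \<Rightarrow> ('a, 'n) tvec"
  assumes soliton: "yamabe_soliton M g \<xi> lam"
    and operator: "associated_operator M g \<xi> \<phi>"
    and annihilates: "\<forall>p\<in>points M. \<phi> p (\<xi> p) = zero_tvec"

sublocale annihilating_soliton \<subseteq> riemannian_manifold M g
  by unfold_locales (use soliton in \<open>simp_all add: yamabe_soliton_def\<close>)

context annihilating_soliton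
begin

lemma xi_smooth: "smooth_vfield M (points M) \<xi>"
  using soliton by (simp add: yamabe_soliton_def)

lemma xi_smooth_on_chart:
  assumes c: "c \<in> Atlas M"
  shows "smooth_vfield M (fst c) \<xi>"
proof -
  have sub: "fst c \<subseteq> points M" by (rule openin_subset[OF openin_chart[OF c]])
  show ?thesis
    unfolding smooth_vfield_def
  proof (intro conjI ballI)
    show "\<xi> p \<in> tangent_space M p" if "p \<in> fst c" for p
      using sub that xi_smooth unfolding smooth_vfield_def by blast
    fix d assume "d \<in> Atlas M"
    then have "smooth_on (snd d ` (points M \<inter> fst d)) (chart_vfield \<xi> d)"
      using xi_smooth unfolding smooth_vfield_def by blast
    then show "smooth_on (snd d ` (fst c \<inter> fst d)) (chart_vfield \<xi> d)"
      by (rule smooth_on_subset) (use sub in blast)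
  qed
qed

lemma xi_tangent: "p \<in> points M \<Longrightarrow> \<xi> p \<in> tangent_space M p"
  using xi_smooth by (simp add: smooth_vfield_def)

lemma chart_vfield_coord:
  assumes c: "c \<in> Atlas M" and x: "x \<in> snd c ` fst c"
  shows "chart_vfield (coord_field M c u) c x = u"
  using c x by (auto simp: coord_tvec_self charts_at_def)

lemma dd_chart_vfield_coord:
  assumes c: "c \<in> charts_at M p"
  shows "dd w (chart_vfield (coord_field M c u) c) (snd c p) = 0"
proof -
  note cA = charts_atD[OF c]
  have "dd w (chart_vfield (coord_field M c u) c) (snd c p) = dd w (\<lambda>x. u) (snd c p)"
    by (rule dd_cong[OF open_chart[OF cA(1)]]) (use cA chart_vfield_coord in auto)
  then show ?thesis by simp
qed

lemma deriv_along_g: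
  assumes c: "c \<in> charts_at M p" and X: "X p \<in> tangent_space M p"
    and Y: "\<And>q. q \<in> fst c \<Longrightarrow> Y q \<in> tangent_space M q" and Z: "\<And>q. q \<in> fst c \<Longrightarrow> Z q \<in> tangent_space M q"
    and sm: "smooth_on (snd c ` fst c) (\<lambda>x. gm (metric_matrix M g c) x (chart_vfield Y c x) (chart_vfield Z c x))"
  shows "deriv_along M X (\<lambda>q. g q (Y q) (Z q)) p
    = dd (X p c) (\<lambda>x. gm (metric_matrix M g c) x (chart_vfield Y c x) (chart_vfield Z c x)) (snd c p)"
proof -
  note cA = charts_atD[OF c]
  have x: "snd c p \<in> snd c ` fst c" using cA by simp
  note op = open_chart[OF cA(1)]
  have eq: "g (chart_inv c x) (Y (chart_inv c x)) (Z (chart_inv c x))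
     = gm (metric_matrix M g c) x (chart_vfield Y c x) (chart_vfield Z c x)" if x: "x \<in> snd c ` fst c" for x
  proof -
    obtain q where q: "x = snd c q" "q \<in> fst c" using x by blast
    then have "c \<in> charts_at M q" using cA by (simp add: charts_at_def)
    from g_chart[OF this Y[OF q(2)] Z[OF q(2)]] show ?thesis using q cA by simp
  qed
  let ?h = "\<lambda>x. g (chart_inv c x) (Y (chart_inv c x)) (Z (chart_inv c x))"
  let ?k = "\<lambda>x. gm (metric_matrix M g c) x (chart_vfield Y c x) (chart_vfield Z c x)"
  have "?h differentiable (at (snd c p)) \<longleftrightarrow> ?k differentiable (at (snd c p))"
    by (rule differentiable_cong[OF op x]) (rule eq)
  then have "?h differentiable (at (snd c p))"
    using smooth_on_differentiable[OF sm x] by blast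
  then have "deriv_along M X (\<lambda>q. g q (Y q) (Z q)) p = dd (X p c) ?h (snd c p)"
    by (rule deriv_along_chart[where X = X and f = "\<lambda>q. g q (Y q) (Z q)", OF c X])
  also have "\<dots> = dd (X p c) ?k (snd c p)"
    by (rule dd_cong[OF op x]) (rule eq)
  finally show ?thesis .
qed

lemma conformal_chart_soliton:
  assumes c: "c \<in> Atlas M"
  shows "conformal_chart (snd c ` fst c) (metric_matrix M g c) (chart_vfield \<xi> c)
    (\<lambda>x. scalar_curvature_coord (metric_matrix M g c) x - lam)"
proof -
  let ?S = "snd c ` fst c" and ?G = "metric_matrix M g c"
  interpret R: riemannian_chart ?S ?G by (rule riemannian_chart_metric[OF c])
  have sx: "smooth_on ?S (chart_vfield \<xi> c)"
    using xi_smooth_on_chart[OF c] c unfolding smooth_vfield_def by fastforce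
  show ?thesis
  proof unfold_locales
    show "smooth_on ?S (chart_vfield \<xi> c)" by (rule sx)
    show "smooth_on ?S (\<lambda>x. scalar_curvature_coord ?G x - lam)"
      by (rule smooth_on_diff[OF R.S R.smooth_scalar_curvature smooth_on_const])
    fix x u v assume "x \<in> ?S"
    then obtain p where p: "x = snd c p" "p \<in> fst c" by blast
    have pc: "c \<in> charts_at M p" using p c by (simp add: charts_at_def)
    have pM: "p \<in> points M" by (rule charts_at_points[OF pc])
    let ?X = "coord_field M c"
    have X: "smooth_vfield M (fst c) (?X u)" for u by (rule smooth_coord_field[OF c])
    have Xt: "?X u q \<in> tangent_space M q" if "q \<in> fst c" for u q
      using X that by (simp add: smooth_vfield_def)
    have br: "lie_bracket M \<xi> (?X u) p \<in> tangent_space M p" for u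
      by (rule lie_bracket_tangent[OF openin_chart[OF c] xi_smooth_on_chart[OF c] X p(2)])
    have brc: "lie_bracket M \<xi> (?X u) p c = - dd u (chart_vfield \<xi> c) x" for u
      by (simp add: lie_bracket_dd[OF pc] dd_chart_vfield_coord[OF pc] coord_tvec_self[OF pc] p(1))
    have eq: "gm ?G y (chart_vfield (?X u) c y) (chart_vfield (?X v) c y) = gm ?G y u v" if "y \<in> ?S" for y
      by (simp only: chart_vfield_coord[OF c that])
    have "deriv_along M \<xi> (\<lambda>q. g q (?X u q) (?X v q)) p
      = dd (\<xi> p c) (\<lambda>y. gm ?G y (chart_vfield (?X u) c y) (chart_vfield (?X v) c y)) (snd c p)"
      by (rule deriv_along_g[where X = \<xi> and Y = "?X u" and Z = "?X v", OF pc xi_tangent[OF pM] Xt Xt])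
        (simp_all add: smooth_on_cong[OF R.S eq] R.smooth_gm)
    also have "\<dots> = dd (\<xi> p c) (\<lambda>y. gm ?G y u v) (snd c p)"
      by (rule dd_cong[OF R.S _ eq]) (use p in auto)
    finally have L: "deriv_along M \<xi> (\<lambda>q. g q (?X u q) (?X v q)) p = dg ?G x (chart_vfield \<xi> c x) u v"
      using p c by (simp add: dg_def)
    have "(1/2) * lie_deriv_metric M \<xi> g (?X u) (?X v) p = (scalar_curvature M g p - lam) * g p (?X u p) (?X v p)"
      using soliton openin_chart[OF c] X p(2) unfolding yamabe_soliton_def by blast
    moreover have "lie_deriv_metric M \<xi> g (?X u) (?X v) p
      = dg ?G x (chart_vfield \<xi> c x) u v + gm ?G x (dd u (chart_vfield \<xi> c) x) v
        + gm ?G x u (dd v (chart_vfield \<xi> c) x)"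
      unfolding lie_deriv_metric_def L g_chart[OF pc br Xt[OF p(2)]] g_chart[OF pc Xt[OF p(2)] br] brc coord_tvec_self[OF pc]
      by (simp add: p(1) linear_neg[OF linear_gm1] linear_neg[OF linear_gm2])
    moreover have "g p (?X u p) (?X v p) = gm ?G x u v"
      by (simp add: gm_metric_matrix[OF pc] p(1))
    ultimately show "dg ?G x (chart_vfield \<xi> c x) u v + gm ?G x (dd u (chart_vfield \<xi> c) x) v
        + gm ?G x u (dd v (chart_vfield \<xi> c) x)
      = 2 * (scalar_curvature_coord ?G x - lam) * gm ?G x u v"
      by (simp add: scalar_curvature_chart[OF pc] p(1))
  qed
qed

text \<open>On coordinate fields the exterior derivative of the dual form is the expression \<open>deta\<close> of the chart,
  as their bracket vanishes; so the definition of \<open>\<phi>\<close> translates into the chart.\<close>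

lemma deta_operator:
  assumes pc: "c \<in> charts_at M p"
  shows "conformal_chart.deta (metric_matrix M g c) (chart_vfield \<xi> c) (snd c p) u v
    = 2 * g p (\<phi> p (coord_tvec M c p u)) (coord_tvec M c p v)"
proof -
  note cA = charts_atD[OF pc]
  let ?S = "snd c ` fst c" and ?G = "metric_matrix M g c" and ?X = "coord_field M c" and ?x = "snd c p"
  interpret C: conformal_chart ?S ?G "chart_vfield \<xi> c" "\<lambda>x. scalar_curvature_coord ?G x - lam"
    by (rule conformal_chart_soliton[OF cA(1)])
  have X: "smooth_vfield M (fst c) (?X u)" for u by (rule smooth_coord_field[OF cA(1)])
  have Xt: "?X u q \<in> tangent_space M q" if "q \<in> fst c" for u q
    using X that by (simp add: smooth_vfield_def)
  have xt: "\<xi> q \<in> tangent_space M q" if "q \<in> fst c" for q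
    using that openin_subset[OF openin_chart[OF cA(1)]] by (intro xi_tangent) blast
  have eq: "gm ?G y (chart_vfield (?X v) c y) (chart_vfield \<xi> c y) = C.eta y v" if "y \<in> ?S" for y v
    unfolding C.eta_def by (simp only: chart_vfield_coord[OF cA(1) that])
  have d: "deriv_along M (?X u) (\<lambda>q. g q (?X v q) (\<xi> q)) p = dd u (\<lambda>y. C.eta y v) ?x" for u v
  proof -
    have "deriv_along M (?X u) (\<lambda>q. g q (?X v q) (\<xi> q)) p
      = dd (?X u p c) (\<lambda>y. gm ?G y (chart_vfield (?X v) c y) (chart_vfield \<xi> c y)) ?x"
      by (rule deriv_along_g[where X = "?X u" and Y = "?X v" and Z = \<xi>, OF pc Xt[OF cA(2)] Xt xt])
        (simp_all add: smooth_on_cong[OF C.S eq] C.smooth_eta)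
    also have "\<dots> = dd u (\<lambda>y. C.eta y v) ?x"
      unfolding coord_tvec_self[OF pc] by (rule dd_cong[OF C.S _ eq]) (use cA in auto)
    finally show ?thesis .
  qed
  have "lie_bracket M (?X u) (?X v) p \<in> tangent_space M p"
    by (rule lie_bracket_tangent[OF openin_chart[OF cA(1)] X X cA(2)])
  moreover have "lie_bracket M (?X u) (?X v) p c = 0"
    by (simp add: lie_bracket_dd[OF pc] dd_chart_vfield_coord[OF pc])
  ultimately have b: "g p (lie_bracket M (?X u) (?X v) p) (\<xi> p) = 0"
    using g_chart[OF pc _ xt[OF cA(2)]] by (simp add: linear_0[OF linear_gm1])
  have "ext_deriv M (dual_form g \<xi>) (?X u) (?X v) p = C.deta ?x u v"
    unfolding ext_deriv_def dual_form_def d b C.deta_def by simp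
  moreover have "(1/2) * ext_deriv M (dual_form g \<xi>) (?X u) (?X v) p = g p (\<phi> p (?X u p)) (?X v p)"
    using operator openin_chart[OF cA(1)] X cA(2) unfolding associated_operator_def by blast
  ultimately show ?thesis by simp
qed

lemma yamabe_chart_soliton:
  assumes c: "c \<in> Atlas M"
  shows "yamabe_chart (snd c ` fst c) (metric_matrix M g c) (chart_vfield \<xi> c) lam"
proof -
  interpret C: conformal_chart "snd c ` fst c" "metric_matrix M g c" "chart_vfield \<xi> c"
    "\<lambda>x. scalar_curvature_coord (metric_matrix M g c) x - lam"
    by (rule conformal_chart_soliton[OF c])
  show ?thesis
  proof unfold_locales
    fix x v assume "x \<in> snd c ` fst c"
    then obtain p where p: "x = snd c p" "p \<in> fst c" by blast
    have pc: "c \<in> charts_at M p" using p c by (simp add: charts_at_def)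
    have pM: "p \<in> points M" by (rule charts_at_points[OF pc])
    have t: "coord_tvec M c p w \<in> tangent_space M p" for w by (rule coord_tvec_tangent[OF pc])
    have "coord_tvec M c p (\<xi> p c) = \<xi> p"
      using tangent_coord_tvec[OF xi_tangent[OF pM] pc] by simp
    then have "C.deta x (chart_vfield \<xi> c x) v = 2 * g p zero_tvec (coord_tvec M c p v)"
      using annihilates pM p c by (simp add: deta_operator[OF pc])
    moreover have "zero_tvec = lincomb 0 (coord_tvec M c p v) 0 (coord_tvec M c p v)"
      by (simp add: zero_tvec_def lincomb_def)
    then have "g p zero_tvec (coord_tvec M c p v) = 0"
      using g pM t[of v] unfolding riemannian_metric_def by (metis add_0 mult_zero_left)
    ultimately show "C.deta x (chart_vfield \<xi> c x) v = 0" by simp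
  qed
qed

definition soliton_factor :: "'a \<Rightarrow> real" where
  "soliton_factor p = scalar_curvature M g p - lam"

definition sqnorm :: "'a \<Rightarrow> real" where
  "sqnorm p = g p (\<xi> p) (\<xi> p)"

lemma soliton_factor_chart:
  "c \<in> charts_at M p \<Longrightarrow> soliton_factor p = scalar_curvature_coord (metric_matrix M g c) (snd c p) - lam"
  by (simp add: soliton_factor_def scalar_curvature_chart)

lemma sqnorm_chart:
  assumes c: "c \<in> charts_at M p"
  shows "sqnorm p = gm (metric_matrix M g c) (snd c p) (chart_vfield \<xi> c (snd c p)) (chart_vfield \<xi> c (snd c p))"
proof -
  have "\<xi> p \<in> tangent_space M p" by (rule xi_tangent[OF charts_at_points[OF c]])
  from g_chart[OF c this this] show ?thesis
    using charts_atD[OF c] by (simp add: sqnorm_def)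
qed

text \<open>Asking for \<open>f = 0\<close> near the point, and not only for vanishing of \<open>f\<close> and \<open>df\<close> at it, makes
  openness immediate; unique continuation then provides closedness.\<close>

definition static_set :: "real \<Rightarrow> 'a set" where
  "static_set s = {p \<in> points M. sqnorm p = s \<and> (\<exists>W. openin (Top M) W \<and> p \<in> W \<and> (\<forall>q\<in>W. soliton_factor q = 0))}"

lemma ball_in_static_set:
  assumes c: "c \<in> Atlas M" and r: "r > 0" "ball x r \<subseteq> snd c ` fst c"
    and f: "\<And>y. y \<in> ball x r \<Longrightarrow> scalar_curvature_coord (metric_matrix M g c) y - lam = 0"
    and s: "gm (metric_matrix M g c) x (chart_vfield \<xi> c x) (chart_vfield \<xi> c x) = s"
  shows "openin (Top M) (chart_inv c ` ball x r)" "chart_inv c x \<in> chart_inv c ` ball x r"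
    "chart_inv c ` ball x r \<subseteq> static_set s"
proof -
  interpret Y: yamabe_chart "snd c ` fst c" "metric_matrix M g c" "chart_vfield \<xi> c" lam
    by (rule yamabe_chart_soliton[OF c])
  let ?W = "chart_inv c ` ball x r"
  show W: "openin (Top M) ?W" by (rule openin_chart_preimage[OF c open_ball r(2)])
  show "chart_inv c x \<in> ?W" using r by simp
  have at: "c \<in> charts_at M (chart_inv c y)" "snd c (chart_inv c y) = y" if "y \<in> ball x r" for y
    using that r(2) c by (auto simp: charts_at_def f_inv_into_f inv_into_into dest!: subsetD)
  have 0: "\<forall>q\<in>?W. soliton_factor q = 0"
    using f by (auto simp: soliton_factor_chart[OF at(1)] at(2))
  have "sqnorm (chart_inv c y) = s" if y: "y \<in> ball x r" for y
  proof -
    have "Y.sqn y = Y.sqn x"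
      by (rule Y.sqn_constant_where_f_vanishes[OF r(2) _ y]) (use f in auto)
    then show ?thesis
      using s by (simp add: sqnorm_chart[OF at(1)[OF y]] at(2)[OF y] Y.sqn_def)
  qed
  with 0 W openin_subset[OF W] show "?W \<subseteq> static_set s"
    unfolding static_set_def by blast
qed

lemma openin_static_set: "openin (Top M) (static_set s)"
proof (subst openin_subopen, intro ballI)
  fix p assume p: "p \<in> static_set s"
  then obtain W where W: "openin (Top M) W" "p \<in> W" "\<And>q. q \<in> W \<Longrightarrow> soliton_factor q = 0"
    and pM: "p \<in> points M" and s: "sqnorm p = s"
    unfolding static_set_def by blast
  obtain c where c: "c \<in> charts_at M p" using point_chart[OF pM] by blast
  note cA = charts_atD[OF c]
  obtain r where r: "r > 0" "ball (snd c p) r \<subseteq> snd c ` (W \<inter> fst c)"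
    by (rule openE[OF open_chart_image[OF cA(1) W(1)]]) (use W(2) cA(2) in auto)
  have f: "scalar_curvature_coord (metric_matrix M g c) y - lam = 0" if y: "y \<in> ball (snd c p) r" for y
  proof -
    obtain q where q: "y = snd c q" "q \<in> W" "q \<in> fst c" using r(2) y by blast
    then have "c \<in> charts_at M q" using cA by (simp add: charts_at_def)
    from soliton_factor_chart[OF this] W(3)[OF q(2)] show ?thesis by (simp only: q(1))
  qed
  from r(2) have "ball (snd c p) r \<subseteq> snd c ` fst c" by blast
  note b = ball_in_static_set[OF cA(1) r(1) this f sqnorm_chart[OF c, symmetric], unfolded s chart_inv_snd[OF cA]]
  show "\<exists>T. openin (Top M) T \<and> p \<in> T \<and> T \<subseteq> static_set s"
    by (intro exI[of _ "chart_inv c ` ball (snd c p) r"] conjI b)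
qed

lemma static_set_limit:
  fixes h :: "real ^ 'n \<Rightarrow> real"
  assumes c: "c \<in> charts_at M p" and h: "continuous_on (snd c ` fst c) h"
    and lim: "\<And>W. openin (Top M) W \<Longrightarrow> p \<in> W \<Longrightarrow> \<exists>q\<in>W. q \<in> A"
    and 0: "\<And>q. q \<in> A \<Longrightarrow> q \<in> fst c \<Longrightarrow> h (snd c q) = 0"
  shows "h (snd c p) = 0"
proof (rule ccontr)
  assume ne: "h (snd c p) \<noteq> 0"
  note cA = charts_atD[OF c]
  let ?V = "snd c ` fst c \<inter> h -` (- {0})"
  have "open ?V"
    by (rule continuous_open_preimage[OF h open_chart[OF cA(1)]]) (simp add: open_Compl)
  then have "openin (Top M) (chart_inv c ` ?V)"
    by (rule openin_chart_preimage[OF cA(1)]) blast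
  moreover have "p \<in> chart_inv c ` ?V"
    using ne cA by (intro image_eqI[of _ _ "snd c p"]) auto
  ultimately obtain q where "q \<in> chart_inv c ` ?V" "q \<in> A" using lim by blast
  then show False using 0 cA(1) by auto
qed

text \<open>At a limit point, \<open>|\<xi>|\<^sup>2 = s\<close>, \<open>f = 0\<close> and \<open>\<xi>(f) = 0\<close> hold by continuity in a chart. As \<open>s > 0\<close>, the
  field does not vanish there, and unique continuation applies.\<close>

lemma closedin_static_set:
  assumes s: "s > 0" and n: "CARD('n) \<ge> 2"
  shows "closedin (Top M) (static_set s)"
  unfolding closedin_def
proof (intro conjI)
  show "static_set s \<subseteq> points M" by (auto simp: static_set_def)
  show "openin (Top M) (points M - static_set s)"
  proof (subst openin_subopen, intro ballI, rule ccontr)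
    fix p assume p: "p \<in> points M - static_set s"
      and no: "\<not> (\<exists>T. openin (Top M) T \<and> p \<in> T \<and> T \<subseteq> points M - static_set s)"
    \<comment> \<open>A point without a neighbourhood in the complement is a limit of points of the set.\<close>
    have lim: "\<exists>q\<in>W. q \<in> static_set s" if "openin (Top M) W" "p \<in> W" for W
      using no that openin_subset[OF that(1)] by blast
    obtain c where c: "c \<in> charts_at M p" using point_chart p by blast
    note cA = charts_atD[OF c]
    let ?S = "snd c ` fst c" and ?G = "metric_matrix M g c"
    interpret Y: yamabe_chart ?S ?G "chart_vfield \<xi> c" lam
      by (rule yamabe_chart_soliton[OF cA(1)])
    have at: "c \<in> charts_at M q" if "q \<in> fst c" for q using that cA by (simp add: charts_at_def)
    have xS: "snd c p \<in> ?S" using cA by simp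
    have "Y.sqn (snd c p) - s = 0"
    proof (rule static_set_limit[OF c _ lim, where h = "\<lambda>y. Y.sqn y - s"])
      show "continuous_on ?S (\<lambda>y. Y.sqn y - s)"
        by (intro continuous_intros smooth_on_continuous[OF Y.smooth_sqn])
      show "Y.sqn (snd c q) - s = 0" if "q \<in> static_set s" "q \<in> fst c" for q
        using that sqnorm_chart[OF at[OF that(2)]] by (simp add: static_set_def Y.sqn_def)
    qed
    then have ps: "Y.sqn (snd c p) = s" by simp
    then have p_nonvanishing: "snd c p \<in> Y.nonvanishing" using s xS by (simp add: Y.nonvanishing_def)
    have f0: "Y.f (snd c q) = 0" if "q \<in> static_set s" "q \<in> fst c" for q
      using that soliton_factor_chart[OF at[OF that(2)]] by (auto simp: static_set_def)
    have fp: "Y.f (snd c p) = 0"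
      by (rule static_set_limit[OF c smooth_on_continuous[OF Y.smooth_f] lim f0])
    have dfp: "dd (chart_vfield \<xi> c (snd c p)) Y.f (snd c p) = 0"
    proof (rule static_set_limit[OF c _ lim, where h = "\<lambda>y. dd (chart_vfield \<xi> c y) Y.f y"])
      show "continuous_on ?S (\<lambda>y. dd (chart_vfield \<xi> c y) Y.f y)"
        by (rule smooth_on_continuous, rule smooth_on_linear_field[where L = "\<lambda>y z. dd z Y.f y",
              OF Y.S Y.linear_df smooth_on_dd[OF Y.smooth_f] Y.smooth_xi])
      fix q assume q: "q \<in> static_set s" "q \<in> fst c"
      have "dd w Y.f (snd c q) = dd w (\<lambda>y. 0) (snd c q)" for w
      proof (rule dd_cong[OF open_chart_image[OF cA(1) openin_static_set[of s]]])
        show "snd c q \<in> snd c ` (static_set s \<inter> fst c)" using q by blast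
      qed (use f0 in auto)
      then show "dd (chart_vfield \<xi> c (snd c q)) Y.f (snd c q) = 0" by simp
    qed
    obtain r where r: "r > 0" "ball (snd c p) r \<subseteq> Y.nonvanishing" "\<And>y. y \<in> ball (snd c p) r \<Longrightarrow> Y.f y = 0"
      using Y.f_vanishes_locally[OF p_nonvanishing fp dfp n] by blast
    have "chart_inv c (snd c p) \<in> static_set s"
      using ball_in_static_set[OF cA(1) r(1) _ r(3) ps[unfolded Y.sqn_def]] r(2) Y.nonvanishing_subset by blast
    then show False using p cA by simp
  qed
qed

text \<open>As \<open>d\<eta>(X, Y)\<close> equals \<open>2 g(\<phi> X, Y)\<close>, its value at a point depends only on the values of \<open>X\<close> and
  \<open>Y\<close> there, and they may be replaced by coordinate fields. Near a point with \<open>d\<eta> \<noteq> 0\<close> and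
  \<open>\<xi> \<noteq> 0\<close>, \<open>f d\<eta> = 0\<close> forces \<open>f = 0\<close>.\<close>

lemma not_closed_imp_static_point:
  assumes "\<not> closed_vfield M g \<xi>"
  obtains s p where "s > 0" "p \<in> static_set s" "CARD('n) \<ge> 2"
proof -
  obtain W X Y p where W: "openin (Top M) W" "smooth_vfield M W X" "smooth_vfield M W Y" "p \<in> W"
    and ne: "ext_deriv M (dual_form g \<xi>) X Y p \<noteq> 0"
    using assms unfolding closed_vfield_def by blast
  have pM: "p \<in> points M" using openin_subset[OF W(1)] W(4) by blast
  obtain c where c: "c \<in> charts_at M p" using point_chart[OF pM] by blast
  note cA = charts_atD[OF c]
  have t: "X p \<in> tangent_space M p" "Y p \<in> tangent_space M p"
    using W by (simp_all add: smooth_vfield_def)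
  let ?S = "snd c ` fst c" and ?G = "metric_matrix M g c" and ?u = "X p c" and ?v = "Y p c"
  interpret Y: yamabe_chart ?S ?G "chart_vfield \<xi> c" lam
    by (rule yamabe_chart_soliton[OF cA(1)])
  have "(1/2) * ext_deriv M (dual_form g \<xi>) X Y p = g p (\<phi> p (X p)) (Y p)"
    using operator W unfolding associated_operator_def by blast
  then have "Y.deta (snd c p) ?u ?v \<noteq> 0"
    using ne tangent_coord_tvec[OF t(1) c] tangent_coord_tvec[OF t(2) c] by (simp add: deta_operator[OF c])
  then obtain y where y: "y \<in> Y.nonvanishing" "Y.deta y ?u ?v \<noteq> 0"
    using Y.not_closed_point[of "snd c p" ?u ?v] cA by blast
  let ?V = "?S \<inter> (\<lambda>y. Y.deta y ?u ?v) -` (- {0}) \<inter> Y.nonvanishing"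
  have "open ?V"
    by (intro open_Int Y.open_nonvanishing continuous_open_preimage[OF smooth_on_continuous[OF Y.smooth_deta] Y.S])
      (simp add: open_Compl)
  moreover have "y \<in> ?V" using y Y.nonvanishing_S by simp
  ultimately obtain r where r: "r > 0" "ball y r \<subseteq> ?V" using open_contains_ball by blast
  have "Y.f z = 0" if "z \<in> ball y r" for z
  proof -
    have "z \<in> Y.nonvanishing" "Y.deta z ?u ?v \<noteq> 0" using that r(2) by blast+
    then show ?thesis using Y.f_deta[OF Y.nonvanishing_S Y.nonvanishing_pos, of z ?u ?v] by simp
  qed
  from ball_in_static_set(2,3)[OF cA(1) r(1) _ this refl] r(2)
  have "chart_inv c y \<in> static_set (Y.sqn y)" unfolding Y.sqn_def by blast
  then show ?thesis
    by (rule that[OF Y.nonvanishing_pos[OF y(1)]]) (rule Y.dimension_ge_2[OF y])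
qed

end

theorem theorem4p2:
  fixes M :: "('a, 'n::finite) charted_space"
    and g :: "('a, 'n) metric"
    and \<xi> :: "('a, 'n) vfield"
    and lam :: real
    and \<phi> :: "'a \<Rightarrow> ('a, 'n) tvec \<Rightarrow> ('a, 'n) tvec"
  assumes "yamabe_soliton M g \<xi> lam"
    and "associated_operator M g \<xi> \<phi>"
    and "\<not> closed_vfield M g \<xi>"
    and "\<forall>p\<in>points M. \<phi> p (\<xi> p) = zero_tvec"
  shows "yamabe_metric M g"
proof -
  interpret annihilating_soliton M g \<xi> lam \<phi>
    by unfold_locales (fact assms)+
  obtain s p where s: "s > 0" and p: "p \<in> static_set s" and n: "CARD('n) \<ge> 2"
    using not_closed_imp_static_point[OF assms(3)] by blast
  have "connected_space (Top M)" using assms(1) by (simp add: yamabe_soliton_def)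
  then have "static_set s = points M"
    using openin_static_set closedin_static_set[OF s n] p unfolding connected_space_clopen_in by blast
  then have "scalar_curvature M g q = lam" if "q \<in> points M" for q
    using that by (auto simp: static_set_def soliton_factor_def)
  then show ?thesis unfolding yamabe_metric_def by blast
qed

end
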